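(* Let $\mathcal L:\sum_{i=1}^k c_i x_i=0$ be a homogeneous linear equation with $k\ge 3$ and $c_1,\dots,c_k\in\mathbb Z\setminus\{0\}$. Then $\delta_\chi(\mathcal L)=0$ if and only if there exists a subset $I\subseteq[k]$ with $|I|\ge 3$ and $\sum_{i\in I}c_i=0$.
   Context: For a prime $p$, $\mathbb F_p$ is the field with $p$ elements. A set $A\subseteq\mathbb F_p$ is $\mathcal L$-solution-free if there is no solution $(x_1,\dots,x_k)\in A^k$ of $\sum_i c_ix_i=0$ (in $\mathbb F_p$) with $x_1,\dots,x_k$ pairwise distinct. For an abelian group $\Gamma$ and $A\subseteq\Gamma$, $\mathsf{Cay}(\Gamma,A)$ is the Cayley digraph on vertex set $\Gamma$ with an arc $u\to v$ whenever $v-u\in A$; its chromatic number $\chi$ means the chromatic number of the underlying undirected graph. The chromatic threshold is $\delta_\chi(\mathcal L)=\inf\{d>0:\ \exists C=C(\mathcal L,d)$ such that for every prime $p$ and every $\mathcal L$-solution-free $A\subseteq\mathbb F_p$ with $|A|\ge dp$, $\chi(\mathsf{Cay}(\mathbb F_p,A))\le C\}$. Equivalently, $\delta_\chi(\mathcal L)=0$ means every $\mathcal L$-solution-free $A\subseteq\mathbb F_p$ whose Cayley graph has chromatic number tending to infinity as $p\to\infty$ has size $o(p)$. *)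

theory Defs
  imports Complex_Main "HOL-Computational_Algebra.Primes"
begin

text \<open>F_p is modelled as the residues {0..<p} (as integers), arithmetic taken mod p.
  The equation L is given by k and coefficients c 1, ..., c k.\<close>

definition solution_free :: "nat \<Rightarrow> (nat \<Rightarrow> int) \<Rightarrow> nat \<Rightarrow> int set \<Rightarrow> bool" where
  "solution_free k c p A \<longleftrightarrow>
     \<not> (\<exists>x :: nat \<Rightarrow> int. (\<forall>i\<in>{1..k}. x i \<in> A) \<and> inj_on x {1..k} \<and>
          (\<Sum>i=1..k. c i * x i) mod int p = 0)"

definition cayley_colorable :: "nat \<Rightarrow> int set \<Rightarrow> nat \<Rightarrow> bool" where
  "cayley_colorable p A C \<longleftrightarrow>
     (\<exists>f :: int \<Rightarrow> nat. (\<forall>u\<in>{0..<int p}. f u < C) \<and>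
        (\<forall>u\<in>{0..<int p}. \<forall>v\<in>{0..<int p}. u \<noteq> v \<and> (v - u) mod int p \<in> A \<longrightarrow> f u \<noteq> f v))"

definition cayley_chromatic :: "nat \<Rightarrow> int set \<Rightarrow> nat" where
  "cayley_chromatic p A = (LEAST C. cayley_colorable p A C)"

definition chromatic_threshold :: "nat \<Rightarrow> (nat \<Rightarrow> int) \<Rightarrow> real" where
  "chromatic_threshold k c = Inf {d :: real. d > 0 \<and>
     (\<exists>C :: nat. \<forall>p A. prime p \<longrightarrow> A \<subseteq> {0..<int p} \<longrightarrow> solution_free k c p A \<longrightarrow>
        real (card A) \<ge> d * real p \<longrightarrow> cayley_chromatic p A \<le> C)}"

end

theory Submission
  imports Defs "HOL-Number_Theory.Number_Theory" "HOL-Analysis.L2_Norm" "HOL-Library.FuncSet"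
begin

text \<open>Let \<open>I\<close> with \<open>card I \<ge> 3\<close> have zero coefficient sum, and let \<open>A\<close> be dense. By a Fourier regularity
  argument \<open>A\<close> contains many configurations \<open>x + t\<close>, \<open>x + u d\<close>, \<open>x + v d\<close> for all \<open>t\<close> in some Bohr set of bounded
  rank; merging two variables of the equation at a time, this yields solutions over \<open>I\<close> with every right-hand side in
  such a Bohr set. Small elements of \<open>A\<close>, that is, elements in the Bohr set, can thus serve as the variables outside \<open>I\<close>,
  so a solution-free \<open>A\<close> has only boundedly many of them. Finitely many further frequencies remove these, and then
  colouring by the cells of the Bohr set is proper.

  Otherwise fix a prime \<open>P\<close> and a large \<open>D\<close>. For rapidly increasing frequencies \<open>R ^ r\<close>, the \<open>a\<close> with
  \<open>ee p a\<close> near \<open>1\<close> and \<open>ee p (R ^ r * a)\<close> near \<open>ee P 1\<close> for all but boundedly many \<open>r \<le> D\<close> generate a Cayley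
  graph of large chromatic number: it contains the graph on \<open>{0..<P}^D\<close> in which \<open>y\<close> is joined to every word that agrees
  with \<open>y + (1, ..., 1)\<close> in almost all places, and a \<open>P\<close>-fold analogue of the Tucker--Fan lemma shows that every
  colouring of this graph with few colours is improper. This set is united with a dense set on which \<open>ee p\<close> is near
  \<open>ee N0 1\<close> and the exponential sum over the frequencies is almost constant and large. In a solution, the variables from
  the dense set have zero coefficient sum, so there are none or two of them, the latter with opposite coefficients. Both
  cases are impossible, since at most frequencies the variables in the first set contribute a nontrivial root of unity.\<close>

section \<open>Alternating chains in cyclic towers\<close>

text \<open>In the second direction the density must not depend on the number C of colours, while
  the number D of frequencies must grow with C. Prescribing D characters one by one on the dense set
  would cost a factor for each of them. So only their sum is prescribed, in units of sqrt D: by its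
  moments it has size comparable to sqrt D on a positive proportion of the residues, and boundedly
  many cells then make it almost constant. A solution would rotate this sum by a fixed nontrivial
  root of unity, except at no more than k * P * C frequencies; that error does not grow with D and
  loses against sqrt D. This is why the near-shift theorem must bound the number of exceptional
  coordinates independently of D. In the first direction the variables outside I come from a
  possibly tiny part of A, over which there is no statistical control. Hence solutions over I are
  needed for every right-hand side in a Bohr set, and they must avoid elements that are prescribed
  only after that Bohr set is known.\<close>

primrec coboundary :: "('a list \<Rightarrow> int) \<Rightarrow> 'a list \<Rightarrow> int" where
  "coboundary \<phi> [] = 0"
| "coboundary \<phi> (x # xs) = \<phi> xs - coboundary (\<lambda>ys. \<phi> (x # ys)) xs"

text \<open>The dual of the prism operator, which triangulates the prism between a simplex and its
  image under \<open>u\<close>. Like \<open>coboundary\<close> it acts on lists of every length at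
  once, so degrees are not tracked, and the empty list provides the augmentation.\<close>

primrec prism :: "('a \<Rightarrow> 'a) \<Rightarrow> ('a list \<Rightarrow> int) \<Rightarrow> 'a list \<Rightarrow> int" where
  "prism u \<phi> [] = 0"
| "prism u \<phi> (x # xs) = \<phi> (x # u x # map u xs) - prism u (\<lambda>ys. \<phi> (x # ys)) xs"

lemma coboundary_diff:
  "coboundary (\<lambda>ys. \<phi> ys - \<psi> ys) xs = coboundary \<phi> xs - coboundary \<psi> xs"
  by (induction xs arbitrary: \<phi> \<psi>) (simp_all add: algebra_simps)

lemma coboundary_mult:
  "coboundary (\<lambda>ys. c * \<phi> ys) xs = c * coboundary \<phi> xs"
  by (induction xs arbitrary: \<phi>) (simp_all add: algebra_simps)

lemma coboundary_sum:
  "coboundary (\<lambda>ys. \<Sum>j\<in>J. \<phi> j ys) xs = (\<Sum>j\<in>J. coboundary (\<phi> j) xs)"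
  by (induction xs arbitrary: \<phi>) (simp_all add: sum_subtractf)

lemma coboundary_map:
  "coboundary (\<lambda>ys. \<phi> (map h ys)) xs = coboundary \<phi> (map h xs)"
  by (induction xs arbitrary: \<phi>) simp_all

lemma prism_diff:
  "prism u (\<lambda>ys. \<phi> ys - \<psi> ys) xs = prism u \<phi> xs - prism u \<psi> xs"
  by (induction xs arbitrary: \<phi> \<psi>) (simp_all add: algebra_simps)

lemma prism_add:
  "prism u (\<lambda>ys. \<phi> ys + \<psi> ys) xs = prism u \<phi> xs + prism u \<psi> xs"
  by (induction xs arbitrary: \<phi> \<psi>) (simp_all add: algebra_simps)

lemma prism_mult:
  "prism u (\<lambda>ys. c * \<phi> ys) xs = c * prism u \<phi> xs"
  by (induction xs arbitrary: \<phi>) (simp_all add: algebra_simps)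

text \<open>The chain homotopy between the identity and \<open>u\<close>: neighbouring inner faces
  of the prism cancel, the side faces form the prism over the boundary, and only top and bottom
  survive.\<close>

lemma prism_coboundary:
  "prism u (coboundary \<phi>) xs + coboundary (prism u \<phi>) xs = \<phi> (map u xs) - \<phi> xs"
proof (induction xs arbitrary: \<phi>)
  case Nil
  then show ?case by simp
next
  case (Cons x xs)
  let ?f = "\<lambda>ys. \<phi> (x # ys)"
  have "prism u (coboundary \<phi>) (x # xs)
      = \<phi> (u x # map u xs) - (\<phi> (x # map u xs) - coboundary (\<lambda>ys. \<phi> (x # u x # ys)) (map u xs))
        - (prism u \<phi> xs - prism u (coboundary ?f) xs)"
    by (simp add: prism_diff)
  moreover have "coboundary (prism u \<phi>) (x # xs)
      = prism u \<phi> xs - (coboundary (\<lambda>ys. \<phi> (x # u x # ys)) (map u xs) - coboundary (prism u ?f) xs)"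
    by (simp add: coboundary_diff coboundary_map[of "\<lambda>ys. \<phi> (x # u x # ys)"])
  ultimately show ?case
    using Cons.IH[of ?f] by simp
qed

lemma prism_cong:
  assumes "\<And>i. i < length xs \<Longrightarrow>
    \<phi> (take (Suc i) xs @ map u (drop i xs)) = \<psi> (take (Suc i) xs @ map u (drop i xs))"
  shows "prism u \<phi> xs = prism u \<psi> xs"
  using assms
proof (induction xs arbitrary: \<phi> \<psi>)
  case Nil
  then show ?case by simp
next
  case (Cons x xs)
  have "prism u (\<lambda>ys. \<phi> (x # ys)) xs = prism u (\<lambda>ys. \<psi> (x # ys)) xs"
    using Cons.prems[of "Suc i" for i] by (intro Cons.IH) simp
  then show ?case
    using Cons.prems[of 0] by simp
qed

section \<open>Cocycles of the cyclic group of order \<open>P\<close>\<close>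

definition cyc_diff :: "int \<Rightarrow> int \<Rightarrow> int \<Rightarrow> int" where
  "cyc_diff P a b = (b - a) mod P"

text \<open>The Bockstein of \<open>cyc_diff\<close>: the latter is a cocycle only modulo
  \<open>P\<close>, and \<open>carry\<close> is its integral coboundary divided by
  \<open>P\<close>.\<close>

definition carry :: "int \<Rightarrow> int \<Rightarrow> int \<Rightarrow> int \<Rightarrow> int" where
  "carry P a b c = (cyc_diff P a b + cyc_diff P b c - cyc_diff P a c) div P"

lemma P_carry: "P * carry P a b c = cyc_diff P a b + cyc_diff P b c - cyc_diff P a c"
proof -
  have "[cyc_diff P a b + cyc_diff P b c - cyc_diff P a c = (b - a) + (c - b) - (c - a)] (mod P)"
    unfolding cyc_diff_def by (intro cong_diff cong_add) (simp_all add: cong_def)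
  then have "(cyc_diff P a b + cyc_diff P b c - cyc_diff P a c) mod P = 0"
    by (simp add: cong_def)
  then show ?thesis unfolding carry_def by (simp add: mod_0_imp_dvd)
qed

lemma carry_same:
  assumes "P > 0"
  shows "carry P a a c = 0" "carry P a c c = 0"
  unfolding carry_def cyc_diff_def by simp_all

text \<open>\<open>P * carry\<close> is a coboundary, hence closed, and \<open>P\<close> cancels
  over the integers.\<close>

lemma carry_cocycle:
  assumes "P > 0"
  shows "carry P b c d - carry P a c d + carry P a b d - carry P a b c = 0"
proof -
  have "P * (carry P b c d - carry P a c d + carry P a b d - carry P a b c) = 0"
    unfolding right_diff_distrib distrib_left P_carry by simp
  then show ?thesis using assms by simp
qed

text \<open>Restricted to lists of length $k+1$, this is the standard generator of the degree-$k$ cohomology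
  of the cyclic group of order $P$: a product of Bocksteins, times the degree-one class if $k$ is odd.\<close>

fun cyc_class :: "int \<Rightarrow> int list \<Rightarrow> int" where
  "cyc_class P [] = 0"
| "cyc_class P [a] = 1"
| "cyc_class P [a, b] = cyc_diff P a b"
| "cyc_class P (a # b # c # xs) = carry P a b c * cyc_class P (c # xs)"

text \<open>The Leibniz rule for a product with the closed cochain \<open>carry\<close>. It reduces
  identities for \<open>cyc_class\<close> to the lowest degree of each parity.\<close>

lemma coboundary_carry_step:
  assumes "P > 0"
    and step: "\<And>a b c ys. \<psi> (a # b # c # ys) = carry P a b c * \<psi> (c # ys)"
  shows "coboundary \<psi> (a # b # c # d # xs) = carry P a b c * coboundary \<psi> (c # d # xs)"
proof -
  have "coboundary \<psi> (a # b # c # d # xs)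
      = (carry P b c d - carry P a c d + carry P a b d) * \<psi> (d # xs)
        - carry P a b c * coboundary (\<lambda>ys. \<psi> (c # ys)) (d # xs)"
  proof -
    have "coboundary (\<lambda>ys. \<psi> (a # b # c # ys)) (d # xs)
        = carry P a b c * coboundary (\<lambda>ys. \<psi> (c # ys)) (d # xs)"
      unfolding step by (rule coboundary_mult)
    then show ?thesis
      by (simp add: step algebra_simps)
  qed
  also have "carry P b c d - carry P a c d + carry P a b d = carry P a b c"
    using carry_cocycle[OF \<open>P > 0\<close>, of b c d a] by simp
  also have "carry P a b c * \<psi> (d # xs) - carry P a b c * coboundary (\<lambda>ys. \<psi> (c # ys)) (d # xs)
      = carry P a b c * coboundary \<psi> (c # d # xs)"
    by (simp add: algebra_simps)
  finally show ?thesis .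
qed

text \<open>In odd degree the class is a product of carries and one \<open>cyc_diff\<close>, and the
  coboundary of \<open>cyc_diff\<close> is \<open>P\<close> times a carry.\<close>

lemma coboundary_cyc_class_odd:
  assumes "P > 0"
  shows "length xs = 2 * n + 3 \<Longrightarrow> coboundary (cyc_class P) xs = P * cyc_class P xs"
proof (induction n arbitrary: xs)
  case 0
  then obtain a b c where "xs = [a, b, c]"
    by (auto simp: length_Suc_conv numeral_3_eq_3)
  then show ?case using P_carry[of P a b c] by simp
next
  case (Suc n)
  then obtain a b c d ys where xs: "xs = a # b # c # d # ys" and "length ys = 2 * n + 1"
    by (auto simp: length_Suc_conv numeral_eq_Suc)
  then have "length (c # d # ys) = 2 * n + 3" by simp
  then have "coboundary (cyc_class P) (c # d # ys) = P * cyc_class P (c # d # ys)"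
    by (rule Suc.IH)
  moreover have "coboundary (cyc_class P) (a # b # c # d # ys)
      = carry P a b c * coboundary (cyc_class P) (c # d # ys)"
    by (rule coboundary_carry_step) (use assms in auto)
  ultimately show ?case
    unfolding xs by (simp only: cyc_class.simps mult.left_commute)
qed

text \<open>Modulo \<open>P\<close>, \<open>cyc_diff\<close> is the coboundary of the identity on
  labels. The resulting primitive of the odd class is not invariant under rotation of the labels: it
  changes by the even class one degree lower, which drives the induction in
  \<open>eval_chain_cyc_class\<close>.\<close>

lemma coboundary_cyc_class_last_even:
  assumes "P > 0"
  shows "length xs = 2 * n + 2 \<Longrightarrow>
    [coboundary (\<lambda>ys. cyc_class P ys * last ys) xs = cyc_class P xs] (mod P)"
proof (induction n arbitrary: xs)
  case 0
  then obtain a b where "xs = [a, b]"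
    by (auto simp: length_Suc_conv numeral_2_eq_2)
  then show ?case by (simp add: cyc_diff_def cong_def)
next
  case (Suc n)
  then have "length xs = Suc (Suc (Suc (Suc (2 * n))))" by simp
  then obtain a b c d ys where xs: "xs = a # b # c # d # ys" and "length ys = 2 * n"
    unfolding length_Suc_conv by blast
  then have IH: "[coboundary (\<lambda>ys. cyc_class P ys * last ys) (c # d # ys) = cyc_class P (c # d # ys)] (mod P)"
    by (intro Suc.IH) simp
  have "coboundary (\<lambda>ys. cyc_class P ys * last ys) (a # b # c # d # ys)
      = carry P a b c * coboundary (\<lambda>ys. cyc_class P ys * last ys) (c # d # ys)"
    by (rule coboundary_carry_step) (use assms in auto)
  then show ?case
    unfolding xs using cong_scalar_left[OF IH] by (simp only: cyc_class.simps)
qed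

lemma cyc_class_shift: "cyc_class P (map (\<lambda>a. (a + 1) mod P) xs) = cyc_class P xs"
proof -
  have "cyc_diff P ((a + 1) mod P) ((b + 1) mod P) = cyc_diff P a b" for a b
    unfolding cyc_diff_def by (simp add: mod_simps)
  then show ?thesis
    by (induction P xs rule: cyc_class.induct) (simp_all add: carry_def)
qed

text \<open>\<open>carry\<close> and \<open>cyc_diff\<close> vanish at equal neighbours, so a
  nonzero class detects alternation.\<close>

lemma cyc_class_nonzero:
  shows "P > 0 \<Longrightarrow> cyc_class P xs \<noteq> 0 \<Longrightarrow> successively (\<noteq>) xs"
proof (induction P xs rule: cyc_class.induct)
  case (4 P a b c xs)
  then show ?case by (auto simp: carry_same)
qed (auto simp: cyc_diff_def)

text \<open>A tower of posets \<open>W 0 \<subseteq> W 1 \<subseteq> \<dots>\<close> with an action of the cyclic group of order \<open>P\<close>, in which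
  \<open>x \<le> u k x \<ge> e (k + 1)\<close> contracts \<open>W k\<close> inside \<open>W (k + 1)\<close>.\<close>

locale cyclic_tower =
  fixes P :: nat and g :: "'w \<Rightarrow> 'w" and W :: "nat \<Rightarrow> 'w set" and le :: "'w \<Rightarrow> 'w \<Rightarrow> bool"
    and e :: "nat \<Rightarrow> 'w" and u :: "nat \<Rightarrow> 'w \<Rightarrow> 'w"
  assumes le_refl: "le x x"
    and le_trans: "le x y \<Longrightarrow> le y z \<Longrightarrow> le x z"
    and g_in: "x \<in> W k \<Longrightarrow> g x \<in> W k"
    and g_mono: "le x y \<Longrightarrow> le (g x) (g y)"
    and g_period: "x \<in> W k \<Longrightarrow> (g ^^ P) x = x"
    and W_Suc: "W k \<subseteq> W (Suc k)"
    and e_in: "e k \<in> W k"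
    and u_in: "x \<in> W k \<Longrightarrow> u k x \<in> W (Suc k)"
    and u_mono: "le x y \<Longrightarrow> le (u k x) (u k y)"
    and le_u: "x \<in> W k \<Longrightarrow> le x (u k x)"
    and e_le_u: "le (e (Suc k)) (u k x)"
begin

definition chains :: "nat \<Rightarrow> 'w list set" where
  "chains k = {xs. length xs = Suc k \<and> sorted_wrt le xs \<and> set xs \<subseteq> W k}"

text \<open>The elements \<open>g - 1\<close> and \<open>1 + g + \<dots> + g^(P-1)\<close> of the group ring, acting on cochains.\<close>

definition twist :: "nat \<Rightarrow> ('w list \<Rightarrow> int) \<Rightarrow> 'w list \<Rightarrow> int" where
  "twist k \<phi> xs =
     (if even k then \<phi> (map g xs) - \<phi> xs else (\<Sum>j<P. \<phi> (map (g ^^ j) xs)))"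

text \<open>Dual to a contraction of the chains of \<open>W k\<close> inside
  \<open>W (k + 1)\<close>: a simplex is moved to its image under \<open>u k\<close> along the
  prism, and the image is coned off from \<open>e (k + 1)\<close>.\<close>

definition contract :: "nat \<Rightarrow> ('w list \<Rightarrow> int) \<Rightarrow> 'w list \<Rightarrow> int" where
  "contract k \<phi> xs = \<phi> (e (Suc k) # map (u k) xs) - prism (u k) \<phi> xs"

text \<open>Evaluation of cochains on a \<open>k\<close>-chain \<open>h k\<close> whose boundary is the \<open>k\<close>-th twist of \<open>h (k - 1)\<close>;
  working with the functional avoids formal sums of simplices.\<close>

primrec eval_chain :: "nat \<Rightarrow> ('w list \<Rightarrow> int) \<Rightarrow> int" where
  "eval_chain 0 \<phi> = \<phi> [e 0]"
| "eval_chain (Suc k) \<phi> = eval_chain k (twist k (contract k \<phi>))"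

lemma W_mono: "k \<le> n \<Longrightarrow> W k \<subseteq> W n"
  using W_Suc by (rule lift_Suc_mono_le)

lemma g_funpow_in: "x \<in> W k \<Longrightarrow> (g ^^ j) x \<in> W k"
  by (induction j) (auto intro: g_in)

lemma map_g_chains: "xs \<in> chains k \<Longrightarrow> map g xs \<in> chains k"
  unfolding chains_def by (auto simp: sorted_wrt_map intro: sorted_wrt_mono_rel[rotated] g_mono g_in)

lemma map_g_funpow_chains: "xs \<in> chains k \<Longrightarrow> map (g ^^ j) xs \<in> chains k"
proof (induction j)
  case 0
  then show ?case by simp
next
  case (Suc j)
  then show ?case using map_g_chains[of "map (g ^^ j) xs" k] by (simp add: comp_def)
qed

lemma contract_chains_cone:
  assumes "xs \<in> chains k"
  shows "e (Suc k) # map (u k) xs \<in> chains (Suc k)"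
  using assms unfolding chains_def
  by (auto simp: sorted_wrt_map e_le_u intro: sorted_wrt_mono_rel[rotated] u_mono u_in e_in)

lemma contract_chains_prism:
  assumes xs: "xs \<in> chains k" and i: "i < length xs"
  shows "take (Suc i) xs @ map (u k) (drop i xs) \<in> chains (Suc k)"
proof -
  have sorted: "sorted_wrt le xs" and W: "set xs \<subseteq> W k" and len: "length xs = Suc k"
    using xs unfolding chains_def by auto
  have "le a (u k b)" if a: "a \<in> set (take (Suc i) xs)" and b: "b \<in> set (drop i xs)" for a b
  proof -
    obtain m where m: "m \<le> i" "a = xs ! m"
      using a i unfolding in_set_conv_nth by (auto simp: less_Suc_eq_le)
    obtain n where n: "i + n < length xs" "b = xs ! (i + n)"
    proof -
      from b obtain n where "n < length xs - i" "b = xs ! (i + n)"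
        unfolding in_set_conv_nth by auto
      then show ?thesis by (intro that[of n]) auto
    qed
    have "le a b"
    proof (cases "m = i + n")
      case True
      then show ?thesis using m n le_refl by simp
    next
      case False
      then show ?thesis
        using m n sorted by (simp add: sorted_wrt_nth_less)
    qed
    moreover have "b \<in> W k" using b W by (meson in_set_dropD subsetD)
    ultimately show ?thesis using le_u le_trans by blast
  qed
  moreover have "sorted_wrt le (take (Suc i) xs)" "sorted_wrt le (drop i xs)"
    using sorted by (simp_all add: sorted_wrt_take sorted_wrt_drop)
  moreover have "set (take (Suc i) xs) \<subseteq> W (Suc k)"
    using W W_Suc by (meson set_take_subset order_trans)
  moreover have "set (map (u k) (drop i xs)) \<subseteq> W (Suc k)"
    using W set_drop_subset[of i xs] by (auto intro!: u_in)
  ultimately show ?thesis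
    unfolding chains_def using len i
    by (auto simp: sorted_wrt_append sorted_wrt_map intro: sorted_wrt_mono_rel[rotated] u_mono)
qed

text \<open>This replaces the statement that the underlying chain is supported on increasing lists
  inside \<open>W k\<close>.\<close>

lemma eval_chain_cong:
  assumes "\<And>xs. xs \<in> chains k \<Longrightarrow> \<phi> xs = \<psi> xs"
  shows "eval_chain k \<phi> = eval_chain k \<psi>"
  using assms
proof (induction k arbitrary: \<phi> \<psi>)
  case 0
  then show ?case using e_in[of 0] by (simp add: chains_def)
next
  case (Suc k)
  have contract: "contract k \<phi> xs = contract k \<psi> xs" if xs: "xs \<in> chains k" for xs
  proof -
    have "prism (u k) \<phi> xs = prism (u k) \<psi> xs"
      by (rule prism_cong) (use Suc.prems contract_chains_prism[OF xs] in blast)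
    then show ?thesis
      unfolding contract_def using Suc.prems contract_chains_cone[OF xs] by simp
  qed
  have "twist k (contract k \<phi>) xs = twist k (contract k \<psi>) xs" if xs: "xs \<in> chains k" for xs
    unfolding twist_def using contract xs map_g_chains[OF xs] map_g_funpow_chains[OF xs] by simp
  then show ?case unfolding eval_chain.simps by (rule Suc.IH)
qed

lemma contract_diff: "contract k (\<lambda>xs. \<phi> xs - \<psi> xs) = (\<lambda>xs. contract k \<phi> xs - contract k \<psi> xs)"
  unfolding contract_def by (simp add: prism_diff fun_eq_iff)

lemma contract_add: "contract k (\<lambda>xs. \<phi> xs + \<psi> xs) = (\<lambda>xs. contract k \<phi> xs + contract k \<psi> xs)"
  unfolding contract_def by (simp add: prism_add fun_eq_iff)

lemma contract_mult: "contract k (\<lambda>xs. c * \<phi> xs) = (\<lambda>xs. c * contract k \<phi> xs)"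
  unfolding contract_def by (simp add: prism_mult fun_eq_iff algebra_simps)

lemma twist_diff: "twist k (\<lambda>xs. \<phi> xs - \<psi> xs) = (\<lambda>xs. twist k \<phi> xs - twist k \<psi> xs)"
  unfolding twist_def by (auto simp: sum_subtractf fun_eq_iff)

lemma twist_add: "twist k (\<lambda>xs. \<phi> xs + \<psi> xs) = (\<lambda>xs. twist k \<phi> xs + twist k \<psi> xs)"
  unfolding twist_def by (auto simp: sum.distrib fun_eq_iff)

lemma twist_mult: "twist k (\<lambda>xs. c * \<phi> xs) = (\<lambda>xs. c * twist k \<phi> xs)"
  unfolding twist_def by (auto simp: sum_distrib_left fun_eq_iff algebra_simps)

lemma eval_chain_diff: "eval_chain k (\<lambda>xs. \<phi> xs - \<psi> xs) = eval_chain k \<phi> - eval_chain k \<psi>"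
  by (induction k arbitrary: \<phi> \<psi>) (simp_all add: contract_diff twist_diff)

lemma eval_chain_add: "eval_chain k (\<lambda>xs. \<phi> xs + \<psi> xs) = eval_chain k \<phi> + eval_chain k \<psi>"
  by (induction k arbitrary: \<phi> \<psi>) (simp_all add: contract_add twist_add)

lemma eval_chain_mult: "eval_chain k (\<lambda>xs. c * \<phi> xs) = c * eval_chain k \<phi>"
  by (induction k arbitrary: \<phi>) (simp_all add: contract_mult twist_mult)

lemma contract_coboundary:
  "contract k (coboundary \<phi>) = (\<lambda>xs. \<phi> xs - coboundary (contract k \<phi>) xs)"
proof
  fix xs
  have "coboundary (contract k \<phi>) xs
      = coboundary (\<lambda>ys. \<phi> (e (Suc k) # ys)) (map (u k) xs) - coboundary (prism (u k) \<phi>) xs"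
    unfolding contract_def
    by (simp add: coboundary_diff coboundary_map[of "\<lambda>ys. \<phi> (e (Suc k) # ys)"])
  then show "contract k (coboundary \<phi>) xs = \<phi> xs - coboundary (contract k \<phi>) xs"
    using prism_coboundary[of "u k" \<phi> xs] by (simp add: contract_def)
qed

lemma twist_coboundary: "twist k (coboundary \<phi>) = coboundary (twist k \<phi>)"
proof
  fix xs
  show "twist k (coboundary \<phi>) xs = coboundary (twist k \<phi>) xs"
    unfolding twist_def
    by (simp add: coboundary_diff coboundary_sum coboundary_map)
qed

text \<open>In the group ring, \<open>g - 1\<close> times \<open>1 + g + ... + g^(P-1)\<close> is
  \<open>g^P - 1\<close>, which acts as zero.\<close>

lemma twist_twist:
  assumes xs: "xs \<in> chains k"
  shows "twist k (twist (Suc k) \<phi>) xs = 0"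
proof -
  have tele: "(\<Sum>j<P. \<phi> (map (g ^^ Suc j) xs)) = (\<Sum>j<P. \<phi> (map (g ^^ j) xs))"
  proof -
    have "map (g ^^ P) xs = xs"
      using xs by (auto simp: chains_def intro!: map_idI g_period[of _ k])
    then show ?thesis
      using sum_lessThan_telescope[of "\<lambda>j. \<phi> (map (g ^^ j) xs)" P]
      by (simp add: sum_subtractf)
  qed
  have *: "map (g ^^ j) (map g xs) = map (g ^^ Suc j) xs" "map g (map (g ^^ j) xs) = map (g ^^ Suc j) xs" for j
    by (simp_all add: funpow_swap1)
  show ?thesis
    unfolding twist_def by (cases "even k") (use tele in \<open>simp_all add: sum_subtractf * del: map_map funpow.simps\<close>)
qed

text \<open>The chain in degree \<open>k + 1\<close> is the contraction of the twisted chain in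
  degree \<open>k\<close>, so its boundary is that twisted chain as soon as the latter is a cycle.
  This holds by induction, two successive twists being zero.\<close>

lemma eval_chain_coboundary: "eval_chain (Suc k) (coboundary \<phi>) = eval_chain k (twist k \<phi>)"
proof -
  have "eval_chain k (coboundary (twist k \<psi>)) = 0" for \<psi>
  proof (induction k arbitrary: \<psi>)
    case 0
    then show ?case by (simp add: twist_def)
  next
    case (Suc k)
    have "eval_chain (Suc k) (coboundary (twist (Suc k) \<psi>))
        = eval_chain k (twist k (twist (Suc k) \<psi>))
          - eval_chain k (coboundary (twist k (contract k (twist (Suc k) \<psi>))))"
      by (simp add: contract_coboundary twist_diff twist_coboundary eval_chain_diff)
    also have "eval_chain k (twist k (twist (Suc k) \<psi>)) = eval_chain k (\<lambda>xs. 0 * (0::int))"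
      by (rule eval_chain_cong) (simp add: twist_twist)
    also have "\<dots> = 0" by (subst eval_chain_mult) simp
    finally show ?case using Suc by simp
  qed
  then show ?thesis
    by (simp add: contract_coboundary twist_diff twist_coboundary eval_chain_diff)
qed

text \<open>Each degree inherits the value from the one below. From even to odd, the class has a
  primitive modulo \<open>P\<close>, and the twist \<open>g - 1\<close> turns it into the lower
  class. From odd to even, \<open>P\<close> times the class is a coboundary, the sum over the group
  multiplies the invariant lower class by \<open>P\<close>, and \<open>P\<close> cancels.\<close>

lemma eval_chain_cyc_class:
  fixes s :: "'w \<Rightarrow> int"
  assumes P: "P > 0" and s: "\<And>x. x \<in> W n \<Longrightarrow> s (g x) = (s x + 1) mod int P"
  shows "k \<le> n \<Longrightarrow> [eval_chain k (\<lambda>xs. cyc_class (int P) (map s xs)) = 1] (mod int P)"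
proof (induction k)
  case 0
  then show ?case by simp
next
  case (Suc k)
  let ?P = "int P"
  let ?c = "\<lambda>xs. cyc_class ?P (map s xs)"
  have shift: "map s (map g xs) = map (\<lambda>a. (a + 1) mod ?P) (map s xs)" if "xs \<in> chains k" for xs
  proof -
    have "s (g x) = (s x + 1) mod ?P" if "x \<in> set xs" for x
      using s W_mono[of k n] Suc.prems \<open>xs \<in> chains k\<close> that unfolding chains_def by auto
    then show ?thesis by simp
  qed
  have inv: "?c (map g xs) = ?c xs" if "xs \<in> chains k" for xs
    unfolding shift[OF that] by (rule cyc_class_shift)
  show ?case
  proof (cases "even k")
    case True
    let ?\<psi> = "\<lambda>xs. ?c xs * last (map s xs)"
    \<comment> \<open>Integral quotients of the errors: they turn congruences on chains into
      equations, to which the linear functional \<open>eval_chain\<close> applies.\<close>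
    define r where "r xs = (?c xs - coboundary ?\<psi> xs) div ?P" for xs
    define r' where "r' xs = (?\<psi> (map g xs) - ?\<psi> xs - ?c xs) div ?P" for xs
    have "?c xs = coboundary ?\<psi> xs + ?P * r xs" if "xs \<in> chains (Suc k)" for xs
    proof -
      obtain m where "k = 2 * m" using True by auto
      then have "length (map s xs) = 2 * m + 2" using that by (simp add: chains_def)
      then have "[coboundary (\<lambda>ys. cyc_class ?P ys * last ys) (map s xs) = ?c xs] (mod ?P)"
        using P by (intro coboundary_cyc_class_last_even) auto
      then have "?P dvd ?c xs - coboundary ?\<psi> xs"
        using coboundary_map[of "\<lambda>ys. cyc_class ?P ys * last ys" s xs]
        by (simp add: cong_iff_dvd_diff dvd_diff_commute)
      then show ?thesis unfolding r_def by simp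
    qed
    then have "eval_chain (Suc k) ?c = eval_chain (Suc k) (\<lambda>xs. coboundary ?\<psi> xs + ?P * r xs)"
      by (rule eval_chain_cong)
    also have "\<dots> = eval_chain k (twist k ?\<psi>) + ?P * eval_chain (Suc k) r"
      by (simp only: eval_chain_add eval_chain_mult eval_chain_coboundary)
    also have "eval_chain k (twist k ?\<psi>) = eval_chain k (\<lambda>xs. ?c xs + ?P * r' xs)"
    proof (rule eval_chain_cong)
      fix xs assume xs: "xs \<in> chains k"
      then have ne: "xs \<noteq> []" by (auto simp: chains_def)
      have "?\<psi> (map g xs) = ?c xs * ((last (map s xs) + 1) mod ?P)"
        unfolding shift[OF xs] cyc_class_shift using ne by (simp add: last_map)
      then have "[?\<psi> (map g xs) = ?\<psi> xs + ?c xs] (mod ?P)"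
        by (simp only: cong_def mod_mult_right_eq distrib_left mult_1_right)
      then have "?P dvd ?\<psi> (map g xs) - ?\<psi> xs - ?c xs"
        by (simp only: cong_iff_dvd_diff diff_diff_eq)
      then have "?P * r' xs = ?\<psi> (map g xs) - ?\<psi> xs - ?c xs"
        unfolding r'_def by simp
      then show "twist k ?\<psi> xs = ?c xs + ?P * r' xs"
        unfolding twist_def using True by simp
    qed
    also have "\<dots> = eval_chain k ?c + ?P * eval_chain k r'"
      by (simp only: eval_chain_add eval_chain_mult)
    finally have "eval_chain (Suc k) ?c
        = eval_chain k ?c + ?P * (eval_chain k r' + eval_chain (Suc k) r)"
      by (simp add: algebra_simps)
    then have "[eval_chain (Suc k) ?c = eval_chain k ?c] (mod ?P)"
      by (simp add: cong_def)
    with Suc show ?thesis using cong_trans Suc_leD by blast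
  next
    case False
    have inv': "?c (map (g ^^ j) xs) = ?c xs" if xs: "xs \<in> chains k" for xs j
    proof (induction j)
      case 0
      then show ?case by simp
    next
      case (Suc j)
      have "?c (map (g ^^ Suc j) xs) = ?c (map g (map (g ^^ j) xs))"
        by simp
      also have "\<dots> = ?c (map (g ^^ j) xs)"
        using inv map_g_funpow_chains[OF xs] by blast
      finally show ?case using Suc.IH by (simp only:)
    qed
    \<comment> \<open>Here cochains with integer values are essential, since \<open>P\<close> is
      cancelled at the end.\<close>
    have "?P * eval_chain (Suc k) ?c = eval_chain (Suc k) (coboundary ?c)"
    proof -
      have "coboundary ?c xs = ?P * ?c xs" if "xs \<in> chains (Suc k)" for xs
      proof -
        obtain m where "k = 2 * m + 1" using False oddE by blast
        then have "length (map s xs) = 2 * m + 3" using that by (simp add: chains_def)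
        then show ?thesis
          using coboundary_cyc_class_odd[of ?P "map s xs" m] P by (simp add: coboundary_map)
      qed
      then show ?thesis
        using eval_chain_cong[of "Suc k" "coboundary ?c" "\<lambda>xs. ?P * ?c xs"]
        by (simp only: eval_chain_mult)
    qed
    also have "\<dots> = eval_chain k (\<lambda>xs. ?P * ?c xs)"
      unfolding eval_chain_coboundary
      by (rule eval_chain_cong) (use False inv' in \<open>simp add: twist_def\<close>)
    also have "\<dots> = ?P * eval_chain k ?c" by (rule eval_chain_mult)
    finally show ?thesis using Suc P by simp
  qed
qed

text \<open>Without an alternating chain the class would vanish on all chains and evaluate to 0, not
  to 1 modulo \<open>P\<close>.\<close>

theorem ex_alternating_chain:
  fixes s :: "'w \<Rightarrow> int"
  assumes P: "P > 1" and s: "\<And>x. x \<in> W k \<Longrightarrow> s (g x) = (s x + 1) mod int P"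
  obtains xs where "xs \<in> chains k" "successively (\<noteq>) (map s xs)"
proof -
  have "\<exists>xs\<in>chains k. cyc_class (int P) (map s xs) \<noteq> 0"
  proof (rule ccontr)
    assume "\<not> ?thesis"
    then have "eval_chain k (\<lambda>xs. cyc_class (int P) (map s xs)) = eval_chain k (\<lambda>xs. 0 * (0::int))"
      by (intro eval_chain_cong) auto
    also have "\<dots> = 0" by (subst eval_chain_mult) simp
    finally have "[0 = 1] (mod int P)"
      using eval_chain_cyc_class[of k s k] s P by simp
    then show False using P by (simp add: cong_def)
  qed
  then show ?thesis using that cyc_class_nonzero[of "int P"] P by auto
qed

end

section \<open>Near-shifts in colourings of words\<close>

definition word_rot :: "nat \<Rightarrow> (nat \<rightharpoonup> int) \<Rightarrow> (nat \<rightharpoonup> int)" where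
  "word_rot P x = (\<lambda>i. map_option (\<lambda>a. (a + 1) mod int P) (x i))"

text \<open>Ordered by extension, these partial words are the simplices of the join of
  \<open>k + 1\<close> copies of a set of \<open>P\<close> points, and \<open>word_rot\<close> is
  the diagonal rotation.\<close>

definition words :: "nat \<Rightarrow> nat \<Rightarrow> (nat \<rightharpoonup> int) set" where
  "words P k = {x. dom x \<noteq> {} \<and> dom x \<subseteq> {..k} \<and> ran x \<subseteq> {0..<int P}}"

lemma dom_word_rot [simp]: "dom (word_rot P x) = dom x"
  by (auto simp: word_rot_def dom_def)

lemma word_rot_funpow:
  "(word_rot P ^^ n) x = (\<lambda>i. map_option (\<lambda>a. if n = 0 then a else (a + int n) mod int P) (x i))"
proof (induction n)
  case 0
  then show ?case by (simp add: option.map_ident)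
next
  case (Suc n)
  then show ?case
    by (auto simp: word_rot_def fun_eq_iff option.map_comp comp_def mod_simps add_ac
        intro!: option.map_cong)
qed

lemma word_rot_period:
  assumes "P > 0" "x \<in> words P k"
  shows "(word_rot P ^^ P) x = x"
proof -
  have "map_option (\<lambda>a. (a + int P) mod int P) (x i) = x i" for i
    using assms(2) by (cases "x i") (auto simp: words_def ran_def)
  then show ?thesis using assms(1) by (simp add: word_rot_funpow)
qed

lemma word_rot_words: "P > 0 \<Longrightarrow> x \<in> words P k \<Longrightarrow> word_rot P x \<in> words P k"
  by (auto simp: words_def ran_def word_rot_def dom_def)

lemma word_rot_mono: "x \<subseteq>\<^sub>m y \<Longrightarrow> word_rot P x \<subseteq>\<^sub>m word_rot P y"
  by (auto simp: map_le_def word_rot_def dom_def)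

lemma cyclic_tower_words:
  assumes "P > 0"
  shows "cyclic_tower P (word_rot P) (words P) (\<subseteq>\<^sub>m) (\<lambda>k. [k \<mapsto> 0]) (\<lambda>k x. x(Suc k \<mapsto> 0))"
proof
  show "(x :: nat \<rightharpoonup> int) \<subseteq>\<^sub>m x" for x by simp
  show "(x :: nat \<rightharpoonup> int) \<subseteq>\<^sub>m y \<Longrightarrow> y \<subseteq>\<^sub>m z \<Longrightarrow> x \<subseteq>\<^sub>m z" for x y z
    by (rule map_le_trans)
  show "x \<in> words P k \<Longrightarrow> word_rot P x \<in> words P k" for x k
    using assms by (rule word_rot_words)
  show "x \<subseteq>\<^sub>m y \<Longrightarrow> word_rot P x \<subseteq>\<^sub>m word_rot P y" for x y
    by (rule word_rot_mono)
  show "x \<in> words P k \<Longrightarrow> (word_rot P ^^ P) x = x" for x k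
    using assms by (rule word_rot_period)
  show "words P k \<subseteq> words P (Suc k)" for k
    by (auto simp: words_def)
  show "[k \<mapsto> 0] \<in> words P k" for k
    using assms by (auto simp: words_def)
  show "x(Suc k \<mapsto> 0) \<in> words P (Suc k)" if "x \<in> words P k" for x k
    using assms that by (auto simp: words_def ran_def dom_def split: if_splits)
  show "x \<subseteq>\<^sub>m y \<Longrightarrow> x(Suc k \<mapsto> 0) \<subseteq>\<^sub>m y(Suc k \<mapsto> 0)" for x y :: "nat \<rightharpoonup> int" and k
    by (rule map_le_upd)
  show "x \<subseteq>\<^sub>m x(Suc k \<mapsto> 0)" if "x \<in> words P k" for x k
    using that by (force simp: words_def map_le_def)
  show "[Suc k \<mapsto> 0] \<subseteq>\<^sub>m x(Suc k \<mapsto> 0)" for x :: "nat \<rightharpoonup> int" and k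
    by (auto simp: map_le_def)
qed

text \<open>Minus the average of \<open>B\<close> modulo \<open>P\<close>: an equivariant choice of
  a point for a set of residues. The sign compensates that rotating a word moves its index sets by
  -1.\<close>

definition anchor :: "nat \<Rightarrow> int set \<Rightarrow> int" where
  "anchor P B = (- \<Sum>B * (SOME m. [int (card B) * m = 1] (mod int P))) mod int P"

text \<open>\<open>card B\<close> lies strictly between 0 and the prime \<open>P\<close>, hence is
  invertible modulo \<open>P\<close>.\<close>

lemma anchor_shift:
  assumes P: "prime P" and B: "B \<subseteq> {0..<int P}" "B \<noteq> {}" "B \<noteq> {0..<int P}"
  shows "anchor P ((\<lambda>j. (j - 1) mod int P) ` B) = (anchor P B + 1) mod int P"
proof -
  have fin: "finite B" using B finite_subset by blast
  have inj: "inj_on (\<lambda>j. (j - 1) mod int P) B"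
  proof (rule inj_onI)
    fix i j assume ij: "i \<in> B" "j \<in> B" "(i - 1) mod int P = (j - 1) mod int P"
    then have "[i - 1 + 1 = j - 1 + 1] (mod int P)" by (intro cong_add) (simp_all add: cong_def)
    moreover have "i \<in> {0..<int P}" "j \<in> {0..<int P}" using B(1) ij by blast+
    ultimately show "i = j" by (simp add: cong_def)
  qed
  have "card B < P"
  proof -
    have "card B < card {0..<int P}" using B by (intro psubset_card_mono) auto
    then show ?thesis by simp
  qed
  moreover have "card B > 0" using B fin by (simp add: card_gt_0_iff)
  ultimately have "\<not> P dvd card B" by (meson nat_dvd_not_less)
  then have "coprime (card B) P" using P by (metis coprime_commute prime_imp_coprime)
  then have "coprime (int (card B)) (int P)" by simp
  then have ex: "\<exists>m. [int (card B) * m = 1] (mod int P)"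
    by (rule cong_solve_coprime_int)
  define m where "m = (SOME m. [int (card B) * m = 1] (mod int P))"
  have m: "[int (card B) * m = 1] (mod int P)" unfolding m_def using ex by (rule someI_ex)
  have "[\<Sum>((\<lambda>j. (j - 1) mod int P) ` B) = (\<Sum>j\<in>B. j - 1)] (mod int P)"
    unfolding sum.reindex[OF inj] comp_def by (rule cong_sum) (simp add: cong_def)
  then have "[\<Sum>((\<lambda>j. (j - 1) mod int P) ` B) = \<Sum>B - int (card B)] (mod int P)"
    by (simp add: sum_subtractf)
  then have "[- \<Sum>((\<lambda>j. (j - 1) mod int P) ` B) * m = - (\<Sum>B - int (card B)) * m] (mod int P)"
    by (intro cong_mult cong_refl) (simp only: cong_minus_minus_iff)
  also have "- (\<Sum>B - int (card B)) * m = - \<Sum>B * m + int (card B) * m"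
    by (simp add: algebra_simps)
  also have "[- \<Sum>B * m + int (card B) * m = anchor P B + 1] (mod int P)"
    using m unfolding anchor_def m_def[symmetric] by (intro cong_add) (simp_all add: cong_def)
  finally show ?thesis
    unfolding anchor_def card_image[OF inj] m_def[symmetric] by (simp add: cong_def)
qed

definition completions :: "nat \<Rightarrow> nat \<Rightarrow> (nat \<rightharpoonup> int) \<Rightarrow> (nat \<Rightarrow> int) set" where
  "completions P D x = {y. (\<forall>i<D. y i \<in> {0..<int P}) \<and> (\<forall>i a. x i = Some a \<longrightarrow> y i = a)}"

lemma completions_nonempty:
  assumes "P > 0" "x \<in> words P k"
  shows "completions P D x \<noteq> {}"
proof -
  have "(\<lambda>i. case x i of None \<Rightarrow> 0 | Some a \<Rightarrow> a) \<in> completions P D x"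
    using assms by (auto simp: completions_def words_def ran_def split: option.splits)
  then show ?thesis by blast
qed

lemma completions_antimono: "x \<subseteq>\<^sub>m y \<Longrightarrow> completions P D y \<subseteq> completions P D x"
  by (force simp: completions_def map_le_def dom_def)

text \<open>Without such a pair the words admit an equivariant labelling, and hence an alternating
  chain of \<open>D\<close> words. Over its last part the labels depend only on the colours seen by
  completions. These colour sets shrink along the chain, and each change of label makes them shrink
  strictly, which can happen fewer than \<open>P * C\<close> times.\<close>

theorem ex_monochromatic_near_shift:
  fixes f :: "(nat \<Rightarrow> int) \<Rightarrow> nat"
  assumes P: "prime P" and D: "D > P * C"
    and f: "\<And>y. (\<forall>i<D. y i \<in> {0..<int P}) \<Longrightarrow> f y < C"
  obtains y y' where "\<forall>i<D. y i \<in> {0..<int P}" "\<forall>i<D. y' i \<in> {0..<int P}" "f y = f y'"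
    "card {i. i < D \<and> y' i \<noteq> (y i + 1) mod int P} \<le> P * C"
proof (rule ccontr)
  assume contra: "\<not> thesis"
  note thesisI = that
  note P0 = prime_gt_0_nat[OF P] and P1 = prime_gt_1_nat[OF P]
  define t where "t = P * C"
  let ?rot = "word_rot P"
  interpret cyclic_tower P ?rot "words P" "(\<subseteq>\<^sub>m)" "\<lambda>k. [k \<mapsto> 0]" "\<lambda>k x. x(Suc k \<mapsto> 0)"
    using P0 by (rule cyclic_tower_words)
  define S where "S x = f ` completions P D x" for x
  \<comment> \<open>The colours of the completions at all rotations of the word. The restriction
    makes two such families equal as soon as they agree at the \<open>P\<close> rotations.\<close>
  define S' where "S' x = (\<lambda>j\<in>{0..<int P}. S ((?rot ^^ nat j) x))" for x
  define B where "B T c = {j \<in> {0..<int P}. c \<in> T j}" for T :: "int \<Rightarrow> nat set" and c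
  define \<sigma> where "\<sigma> T = anchor P (B T (LEAST c. B T c \<noteq> {}))" for T
  \<comment> \<open>A long word, lacking at most \<open>t\<close> letters, is labelled by the
    rotations at which the least occurring colour is seen; a short word by its first letter. Both
    labels rotate with the word.\<close>
  define s where "s x = (if card (dom x) \<ge> D - t then \<sigma> (S' x) else the (x (LEAST i. i \<in> dom x)))" for x
  have S_sub: "S x \<subseteq> {..<C}" for x
    unfolding S_def completions_def using f by auto
  have S_ne: "S x \<noteq> {}" if "x \<in> words P k" for x k
    unfolding S_def using completions_nonempty[OF P0 that] by simp
  have S_anti: "S y \<subseteq> S x" if "x \<subseteq>\<^sub>m y" for x y
    unfolding S_def using completions_antimono[OF that] by blast
  have rot_mono: "(?rot ^^ n) x \<subseteq>\<^sub>m (?rot ^^ n) y" if "x \<subseteq>\<^sub>m y" for n x y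
    by (induction n) (use that word_rot_mono in auto)
  have dom_rot: "dom ((?rot ^^ n) x) = dom x" for n x
    by (induction n) auto
  \<comment> \<open>A common colour would give completions of \<open>x\<close> and of its rotation
    that are shifts of each other on \<open>dom x\<close>, that is, off at most \<open>t\<close>
    coordinates.\<close>
  have disj: "c \<notin> S (?rot x)" if "c \<in> S x" "card (dom x) \<ge> D - t" "x \<in> words P (D - 1)" for c x
  proof
    assume "c \<in> S (?rot x)"
    then obtain y' where y': "y' \<in> completions P D (?rot x)" "c = f y'" unfolding S_def by blast
    obtain y where y: "y \<in> completions P D x" "c = f y" using \<open>c \<in> S x\<close> unfolding S_def by blast
    have "{i. i < D \<and> y' i \<noteq> (y i + 1) mod int P} \<subseteq> {..<D} - dom x"
      using y y' by (auto simp: completions_def word_rot_def)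
    then have "card {i. i < D \<and> y' i \<noteq> (y i + 1) mod int P} \<le> card ({..<D} - dom x)"
      by (intro card_mono) auto
    also have "\<dots> = D - card (dom x)"
    proof -
      have "dom x \<subseteq> {..D - 1}" using that unfolding words_def by blast
      then have "dom x \<subseteq> {..<D}" using D by force
      then show ?thesis by (subst card_Diff_subset) (auto intro: finite_subset)
    qed
    also have "\<dots> \<le> t" using that by linarith
    finally have "card {i. i < D \<and> y' i \<noteq> (y i + 1) mod int P} \<le> P * C" unfolding t_def .
    then have thesis
      by (intro thesisI[of y y']) (use y y' in \<open>auto simp: completions_def\<close>)
    then show False using contra by contradiction
  qed
  have S'_shift: "B (S' (?rot x)) c = (\<lambda>j. (j - 1) mod int P) ` B (S' x) c" if x: "x \<in> words P k" for x k c
  proof -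
    have step: "(?rot ^^ nat ((j - 1) mod int P)) (?rot x) = (?rot ^^ nat j) x" if "j \<in> {0..<int P}" for j
    proof (cases "j = 0")
      case True
      have "(0 - 1) mod int P = int P - 1" using P1 by (simp add: zmod_minus1)
      then have "nat ((j - 1) mod int P) = P - 1" using True by simp
      moreover have "(?rot ^^ (P - 1)) (?rot x) = (?rot ^^ Suc (P - 1)) x"
        by (simp only: funpow_Suc_right comp_apply)
      ultimately show ?thesis
        using True P0 word_rot_period[OF P0 x] by simp
    next
      case False
      then have "(j - 1) mod int P = j - 1" using that by auto
      moreover have "nat j = Suc (nat (j - 1))" using False that by auto
      ultimately show ?thesis by (simp only: funpow_Suc_right comp_apply)
    qed
    show ?thesis
    proof (intro equalityI subsetI)
      fix j assume j: "j \<in> B (S' (?rot x)) c"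
      define i where "i = (j + 1) mod int P"
      have "i \<in> {0..<int P}" unfolding i_def using P0 by auto
      moreover have ji: "(i - 1) mod int P = j"
        unfolding i_def using j by (auto simp: B_def mod_simps)
      ultimately have "i \<in> B (S' x) c"
        using j step[of i] P0 unfolding B_def S'_def by auto
      then show "j \<in> (\<lambda>j. (j - 1) mod int P) ` B (S' x) c" using ji by blast
    next
      fix j assume "j \<in> (\<lambda>j. (j - 1) mod int P) ` B (S' x) c"
      then obtain i where "i \<in> B (S' x) c" "j = (i - 1) mod int P" by blast
      then show "j \<in> B (S' (?rot x)) c"
        using step[of i] P0 unfolding B_def S'_def by auto
    qed
  qed
  have s_rot: "s (?rot x) = (s x + 1) mod int P" if x: "x \<in> words P (D - 1)" for x
  proof (cases "card (dom x) \<ge> D - t")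
    case True
    define c where "c = (LEAST c. B (S' x) c \<noteq> {})"
    have c': "(LEAST c. B (S' (?rot x)) c \<noteq> {}) = c"
      unfolding c_def S'_shift[OF x] by simp
    obtain c1 where "c1 \<in> S x" using S_ne[OF x] by blast
    then have "0 \<in> B (S' x) c1" using P0 by (auto simp: B_def S'_def)
    then have "B (S' x) c1 \<noteq> {}" by blast
    then have Bne: "B (S' x) c \<noteq> {}" unfolding c_def by (rule LeastI[of "\<lambda>c. B (S' x) c \<noteq> {}"])
    then obtain j where j: "j \<in> {0..<int P}" "c \<in> S ((?rot ^^ nat j) x)" unfolding B_def S'_def by auto
    have nS: "c \<notin> S (?rot ((?rot ^^ nat j) x))"
      by (rule disj) (use j True x g_funpow_in dom_rot in auto)
    \<comment> \<open>A colour present at every rotation would be present at two consecutive ones,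
      against \<open>disj\<close>.\<close>
    have "B (S' x) c \<noteq> {0..<int P}"
    proof (cases "j + 1 < int P")
      case True
      then have "nat (j + 1) = Suc (nat j)" "j + 1 \<in> {0..<int P}" using j by auto
      then have "j + 1 \<notin> B (S' x) c" using nS by (simp add: B_def S'_def)
      then show ?thesis using True j by auto
    next
      case False
      then have "Suc (nat j) = P" using j by auto
      then have "?rot ((?rot ^^ nat j) x) = x"
        using word_rot_period[OF P0 x] by (metis comp_apply funpow.simps(2))
      then have "0 \<notin> B (S' x) c" using nS P0 by (simp add: B_def S'_def)
      then show ?thesis using P0 by auto
    qed
    moreover have "B (S' x) c \<subseteq> {0..<int P}" unfolding B_def by auto
    ultimately have "anchor P (B (S' (?rot x)) c) = (anchor P (B (S' x) c) + 1) mod int P"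
      unfolding S'_shift[OF x, of c] using anchor_shift[OF P _ Bne] by blast
    moreover have "\<sigma> (S' (?rot x)) = anchor P (B (S' (?rot x)) c)" "\<sigma> (S' x) = anchor P (B (S' x) c)"
      unfolding \<sigma>_def c' c_def[symmetric] by (rule refl)+
    ultimately show ?thesis
      unfolding s_def using True by simp
  next
    case False
    define i where "i = (LEAST i. i \<in> dom x)"
    have "\<exists>i. i \<in> dom x" using x by (auto simp: words_def)
    then have "i \<in> dom x" unfolding i_def by (rule LeastI_ex)
    then obtain a where "x i = Some a" by blast
    then have "the (?rot x i) = (the (x i) + 1) mod int P" by (simp add: word_rot_def)
    then show ?thesis
      using False unfolding s_def dom_word_rot i_def[symmetric] by simp
  qed
  obtain xs where xs: "xs \<in> chains (D - 1)" "successively (\<noteq>) (map s xs)"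
    using ex_alternating_chain[OF P1, of "D - 1" s] s_rot by blast
  have len: "length xs = D" using xs D by (simp add: chains_def)
  have in_words: "xs ! i \<in> words P (D - 1)" if "i < D" for i
    using xs that len unfolding chains_def by auto
  have le: "xs ! i \<subseteq>\<^sub>m xs ! Suc i" if "Suc i < D" for i
    using xs that len by (auto simp: chains_def sorted_wrt_nth_less)
  have alt: "s (xs ! i) \<noteq> s (xs ! Suc i)" if "Suc i < D" for i
    using xs(2) that len unfolding successively_conv_nth by simp
  have fin_dom: "finite (dom (xs ! i))" if "i < D" for i
    using in_words[OF that] unfolding words_def by (auto intro: finite_subset)
  \<comment> \<open>Alternating labels force distinct neighbours, so every step adds a letter. In
    particular the words from index \<open>D - 1 - t\<close> on are long.\<close>
  have card_dom: "i < card (dom (xs ! i))" if "i < D" for i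
    using that
  proof (induction i)
    case 0
    then show ?case using in_words[of 0] fin_dom[of 0] by (auto simp: words_def card_gt_0_iff)
  next
    case (Suc i)
    have "dom (xs ! i) \<noteq> dom (xs ! Suc i)"
    proof
      assume "dom (xs ! i) = dom (xs ! Suc i)"
      then have "xs ! i = xs ! Suc i" using le[OF Suc.prems] by (metis map_le_antisym map_le_def)
      then show False using alt[OF Suc.prems] by simp
    qed
    then have "dom (xs ! i) \<subset> dom (xs ! Suc i)" using map_le_implies_dom_le[OF le[OF Suc.prems]] by blast
    then have "card (dom (xs ! i)) < card (dom (xs ! Suc i))"
      using fin_dom[OF Suc.prems] by (rule psubset_card_mono[rotated])
    then show ?case using Suc by simp
  qed
  \<comment> \<open>A potential that is at most \<open>P * C = t\<close>, drops at each of the last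
    \<open>t\<close> steps, and is still positive at the end.\<close>
  define w where "w i = (\<Sum>j<P. card (S ((?rot ^^ j) (xs ! i))))" for i
  have fin_S: "finite (S x)" for x using S_sub finite_subset by blast
  have w_less: "w (Suc i) < w i" if i: "D - t \<le> Suc i" "Suc i < D" for i
  proof -
    have sub: "S ((?rot ^^ j) (xs ! Suc i)) \<subseteq> S ((?rot ^^ j) (xs ! i))" for j
      by (intro S_anti rot_mono le i)
    have "card (dom (xs ! i)) \<ge> D - t" "card (dom (xs ! Suc i)) \<ge> D - t"
      using card_dom[of i] card_dom[of "Suc i"] i by linarith+
    then have "S' (xs ! i) \<noteq> S' (xs ! Suc i)" using alt[OF i(2)] unfolding s_def by auto
    then obtain j where "j \<in> {0..<int P}" "S ((?rot ^^ nat j) (xs ! i)) \<noteq> S ((?rot ^^ nat j) (xs ! Suc i))"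
      unfolding S'_def by (metis (no_types, lifting) restrict_ext)
    then have "nat j < P" "card (S ((?rot ^^ nat j) (xs ! Suc i))) < card (S ((?rot ^^ nat j) (xs ! i)))"
      using sub[of "nat j"] fin_S by (auto intro!: psubset_card_mono)
    then show ?thesis
      unfolding w_def by (intro sum_strict_mono_ex1) (use sub fin_S in \<open>auto intro: card_mono\<close>)
  qed
  have D': "t < D" using D by (simp add: t_def)
  have "w (D - 1 - t + m) + m \<le> w (D - 1 - t)" if "m \<le> t" for m
    using that
  proof (induction m)
    case 0
    then show ?case by simp
  next
    case (Suc m)
    have "w (Suc (D - 1 - t + m)) < w (D - 1 - t + m)"
      by (rule w_less) (use Suc.prems D' in auto)
    then show ?case using Suc by simp
  qed
  from this[of t] have "w (D - 1) + t \<le> w (D - 1 - t)" using D' by simp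
  moreover have "w (D - 1 - t) \<le> (\<Sum>j<P. C)"
    unfolding w_def using S_sub by (intro sum_mono) (metis card_lessThan card_mono finite_lessThan)
  moreover have "w (D - 1) > 0"
  proof -
    have "S (xs ! (D - 1)) \<noteq> {}" using in_words[of "D - 1"] S_ne D by auto
    then have "card (S ((?rot ^^ 0) (xs ! (D - 1)))) > 0" using fin_S by (simp add: card_gt_0_iff)
    then show ?thesis unfolding w_def using P0 by (intro sum_pos2[of _ 0]) auto
  qed
  ultimately show False by (simp add: t_def)
qed

section \<open>Fourier analysis on residues\<close>

abbreviation resid :: "nat \<Rightarrow> int set" where
  "resid p \<equiv> {0..<int p}"

definition periodic :: "nat \<Rightarrow> (int \<Rightarrow> 'a) \<Rightarrow> bool" where
  "periodic p F \<longleftrightarrow> (\<forall>x. F (x mod int p) = F x)"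

lemma periodic_cong: "periodic p F \<Longrightarrow> [x = y] (mod int p) \<Longrightarrow> F x = F y"
  unfolding periodic_def cong_def by metis

lemma periodicI:
  assumes "\<And>x y. [x = y] (mod int p) \<Longrightarrow> F x = F y"
  shows "periodic p F"
  unfolding periodic_def by (intro allI assms) (simp add: cong_def)

lemma bij_betw_affine_mod:
  assumes "p > 0" "coprime u (int p)"
  shows "bij_betw (\<lambda>x. (u * x + h) mod int p) (resid p) (resid p)"
proof -
  have "inj_on (\<lambda>x. (u * x + h) mod int p) (resid p)"
  proof (rule inj_onI)
    fix x y assume xy: "x \<in> resid p" "y \<in> resid p" "(u * x + h) mod int p = (u * y + h) mod int p"
    then have "[u * x + h = u * y + h] (mod int p)" by (simp add: cong_def)
    then have "[u * x = u * y] (mod int p)" by (simp add: cong_add_rcancel)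
    then have "[x = y] (mod int p)" using assms(2) by (simp add: cong_mult_lcancel)
    then show "x = y" using xy by (simp add: cong_def)
  qed
  moreover have "(\<lambda>x. (u * x + h) mod int p) ` resid p \<subseteq> resid p" using assms(1) by auto
  ultimately show ?thesis
    by (intro bij_betw_imageI endo_inj_surj) auto
qed

lemma sum_affine:
  fixes F :: "int \<Rightarrow> 'a::comm_monoid_add"
  assumes "p > 0" "coprime u (int p)" "periodic p F"
  shows "(\<Sum>x\<in>resid p. F (u * x + h)) = (\<Sum>x\<in>resid p. F x)"
proof -
  have "(\<Sum>x\<in>resid p. F (u * x + h)) = (\<Sum>x\<in>resid p. F ((u * x + h) mod int p))"
    using assms(3) by (simp add: periodic_def)
  also have "\<dots> = (\<Sum>x\<in>resid p. F x)"
    by (rule sum.reindex_bij_betw[OF bij_betw_affine_mod[OF assms(1,2)]])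
  finally show ?thesis .
qed

lemma sum_shift:
  fixes F :: "int \<Rightarrow> 'a::comm_monoid_add"
  assumes "p > 0" "periodic p F"
  shows "(\<Sum>x\<in>resid p. F (x + h)) = (\<Sum>x\<in>resid p. F x)"
  using sum_affine[of p 1 F h] assms by simp

section \<open>Additive characters\<close>

definition ee :: "nat \<Rightarrow> int \<Rightarrow> complex" where
  "ee p x = cis (2 * pi * of_int x / of_nat p)"

lemma ee_add: "ee p (x + y) = ee p x * ee p y"
  by (simp add: ee_def cis_mult add_divide_distrib distrib_left)

lemma ee_0 [simp]: "ee p 0 = 1"
  by (simp add: ee_def)

lemma norm_ee [simp]: "norm (ee p x) = 1"
  by (simp add: ee_def)

lemma ee_minus: "ee p (- x) = cnj (ee p x)"
  by (simp add: ee_def cis_cnj)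

lemma ee_diff: "ee p (x - y) = ee p x * cnj (ee p y)"
  using ee_add[of p x "- y"] by (simp add: ee_minus)

lemma cis_eq_1_iff: "cis a = 1 \<longleftrightarrow> (\<exists>k::int. a = 2 * pi * k)"
proof
  assume "cis a = 1"
  then have "cos a = 1" by (metis cis.simps(1) one_complex.simps(1))
  then obtain k :: int where "a = k * 2 * pi" using cos_one_2pi_int[of a] by auto
  then show "\<exists>k::int. a = 2 * pi * k" by (auto simp: mult_ac)
qed (auto simp: cis_multiple_2pi)

lemma ee_eq_1_iff:
  assumes "p > 0"
  shows "ee p x = 1 \<longleftrightarrow> int p dvd x"
proof
  assume "ee p x = 1"
  then obtain k :: int where "2 * pi * of_int x / of_nat p = 2 * pi * k"
    unfolding ee_def cis_eq_1_iff by blast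
  then have "real_of_int x = real_of_int (int p * k)" using assms by (simp add: field_simps)
  then have "x = int p * k" by linarith
  then show "int p dvd x" by simp
next
  assume "int p dvd x"
  then obtain k where "x = int p * k" by blast
  then have "2 * pi * of_int x / of_nat p = 2 * pi * of_int k" using assms by simp
  then show "ee p x = 1" unfolding ee_def cis_eq_1_iff by blast
qed

lemma ee_cong: "[x = y] (mod int p) \<Longrightarrow> ee p x = ee p y"
proof (cases "p > 0")
  case True
  assume "[x = y] (mod int p)"
  then have "ee p (x - y) = 1" using True by (simp add: ee_eq_1_iff cong_iff_dvd_diff)
  moreover have "ee p x = ee p (x - y) * ee p y" by (simp flip: ee_add)
  ultimately show ?thesis by simp
qed (simp add: cong_def)

lemma periodic_ee: "periodic p (\<lambda>x. ee p (a * x))"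
  by (intro periodicI ee_cong cong_mult cong_refl)

lemma sum_ee:
  assumes "p > 0"
  shows "(\<Sum>x\<in>resid p. ee p (a * x)) = (if int p dvd a then of_nat p else 0)"
proof (cases "int p dvd a")
  case True
  then have "ee p (a * x) = 1" for x using assms by (simp add: ee_eq_1_iff)
  then show ?thesis using True by simp
next
  case False
  have "(\<Sum>x\<in>resid p. ee p (a * x)) = (\<Sum>x\<in>resid p. ee p (a * (x + 1)))"
    using sum_shift[OF assms periodic_ee, of a 1] by simp
  also have "\<dots> = (\<Sum>x\<in>resid p. ee p (a * x)) * ee p a"
    by (simp add: distrib_left ee_add sum_distrib_right)
  finally have "(\<Sum>x\<in>resid p. ee p (a * x)) * (1 - ee p a) = 0" by (simp add: algebra_simps)
  then show ?thesis using False ee_eq_1_iff[OF assms, of a] by simp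
qed

lemma norm_unit_mult_diff_le:
  fixes z w z' w' :: complex
  assumes "norm w = 1" "norm z' = 1"
  shows "norm (z * w - z' * w') \<le> norm (z - z') + norm (w - w')"
proof -
  have "z * w - z' * w' = (z - z') * w + z' * (w - w')" by (simp add: algebra_simps)
  then show ?thesis
    using norm_triangle_ineq[of "(z - z') * w" "z' * (w - w')"] assms by (simp add: norm_mult)
qed

lemma norm_cis_mult_diff_le:
  "norm (cis (of_int c * a) - cis (of_int c * b)) \<le> \<bar>of_int c\<bar> * norm (cis a - cis b)"
proof -
  have nat: "norm (cis (of_nat n * a) - cis (of_nat n * b)) \<le> of_nat n * norm (cis a - cis b)" for n
  proof (induction n)
    case 0
    then show ?case by simp
  next
    case (Suc n)
    have "norm (cis (of_nat (Suc n) * a) - cis (of_nat (Suc n) * b))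
        = norm (cis a * cis (of_nat n * a) - cis b * cis (of_nat n * b))"
      by (simp add: cis_mult distrib_right)
    also have "\<dots> \<le> norm (cis a - cis b) + norm (cis (of_nat n * a) - cis (of_nat n * b))"
      by (rule norm_unit_mult_diff_le) simp_all
    finally show ?case using Suc by (simp add: distrib_right)
  qed
  show ?thesis
  proof (cases "c \<ge> 0")
    case True
    then obtain n where "c = int n" using nonneg_int_cases by blast
    then show ?thesis using nat[of n] by simp
  next
    case False
    then obtain n where "c = - int n" by (metis linorder_le_cases nonpos_int_cases)
    moreover have "norm (cis (- (of_nat n * a)) - cis (- (of_nat n * b)))
        = norm (cis (of_nat n * a) - cis (of_nat n * b))"
      by (metis cis_cnj complex_cnj_diff complex_mod_cnj)
    ultimately show ?thesis using nat[of n] by simp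
  qed
qed

lemma norm_ee_mult_diff_le:
  "norm (ee p (c * x) - cis (of_int c * a)) \<le> \<bar>of_int c\<bar> * norm (ee p x - cis a)"
  using norm_cis_mult_diff_le[of c "2 * pi * of_int x / of_nat p" a]
  by (simp add: ee_def mult_ac)

lemma norm_ee_mult_diff_1_le: "norm (ee p (c * x) - 1) \<le> \<bar>of_int c\<bar> * norm (ee p x - 1)"
  using norm_ee_mult_diff_le[of p c x 0] by simp

lemma norm_ee_add_diff_1_le: "norm (ee p (x + y) - 1) \<le> norm (ee p x - 1) + norm (ee p y - 1)"
  using norm_unit_mult_diff_le[of "ee p y" 1 "ee p x" 1] by (simp add: ee_add)

lemma norm_ee_minus_diff_1: "norm (ee p (- x) - 1) = norm (ee p x - 1)"
  by (metis ee_minus complex_cnj_diff complex_cnj_one complex_mod_cnj)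

lemma norm_ee_sum_diff_le:
  assumes "finite J"
  shows "norm (ee p (\<Sum>l\<in>J. c l * x l) - cis (\<Sum>l\<in>J. of_int (c l) * a l))
    \<le> (\<Sum>l\<in>J. \<bar>of_int (c l)\<bar> * norm (ee p (x l) - cis (a l)))"
  using assms
proof (induction J)
  case empty
  then show ?case by simp
next
  case (insert l J)
  have "norm (ee p (\<Sum>l\<in>insert l J. c l * x l) - cis (\<Sum>l\<in>insert l J. of_int (c l) * a l))
      = norm (ee p (c l * x l) * ee p (\<Sum>l\<in>J. c l * x l)
          - cis (of_int (c l) * a l) * cis (\<Sum>l\<in>J. of_int (c l) * a l))"
    using insert by (simp add: ee_add cis_mult)
  also have "\<dots> \<le> norm (ee p (c l * x l) - cis (of_int (c l) * a l))
      + norm (ee p (\<Sum>l\<in>J. c l * x l) - cis (\<Sum>l\<in>J. of_int (c l) * a l))"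
    by (rule norm_unit_mult_diff_le) simp_all
  finally show ?case
    using insert norm_ee_mult_diff_le[of p "c l" "x l" "a l"] by simp
qed

section \<open>The Fourier transform, normalised so that Parseval equates a sum over frequencies
  with a mean over residues\<close>

definition ft :: "nat \<Rightarrow> (int \<Rightarrow> complex) \<Rightarrow> int \<Rightarrow> complex" where
  "ft p f \<xi> = (\<Sum>x\<in>resid p. f x * ee p (- (\<xi> * x))) / of_nat p"

definition msq :: "nat \<Rightarrow> (int \<Rightarrow> complex) \<Rightarrow> real" where
  "msq p f = (\<Sum>x\<in>resid p. (norm (f x))\<^sup>2) / of_nat p"

lemma periodic_ft: "periodic p (ft p f)"
proof (rule periodicI)
  fix x y assume "[x = y] (mod int p)"
  then have "ee p (- (x * z)) = ee p (- (y * z))" for z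
    by (intro ee_cong) (simp add: cong_minus_minus_iff cong_scalar_right)
  then show "ft p f x = ft p f y" by (simp add: ft_def)
qed

lemma ft_inversion:
  assumes "p > 0" "periodic p f"
  shows "f x = (\<Sum>\<xi>\<in>resid p. ft p f \<xi> * ee p (\<xi> * x))"
proof -
  have "(\<Sum>\<xi>\<in>resid p. ft p f \<xi> * ee p (\<xi> * x))
      = (\<Sum>\<xi>\<in>resid p. \<Sum>y\<in>resid p. f y * ee p ((x - y) * \<xi>)) / of_nat p"
  proof -
    have "f y * ee p (- (\<xi> * y)) * ee p (\<xi> * x) = f y * ee p ((x - y) * \<xi>)" for \<xi> y
      unfolding mult.assoc ee_add[symmetric] by (simp add: algebra_simps)
    then show ?thesis by (simp only: ft_def times_divide_eq_left sum_distrib_right sum_divide_distrib)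
  qed
  also have "\<dots> = (\<Sum>y\<in>resid p. f y * (\<Sum>\<xi>\<in>resid p. ee p ((x - y) * \<xi>))) / of_nat p"
    by (subst sum.swap) (simp add: sum_distrib_left)
  also have "\<dots> = (\<Sum>y\<in>resid p. if y = x mod int p then of_nat p * f y else 0) / of_nat p"
  proof -
    have "int p dvd x - y \<longleftrightarrow> y = x mod int p" if "y \<in> resid p" for y
      using that by (metis atLeastLessThan_iff mod_eq_dvd_iff mod_pos_pos_trivial)
    then show ?thesis using assms(1) by (simp add: sum_ee if_distrib cong: if_cong)
  qed
  also have "\<dots> = f (x mod int p)" using assms(1) by simp
  also have "\<dots> = f x" using assms(2) by (simp add: periodic_def)
  finally show ?thesis by simp
qed

lemma msq_trig:
  assumes "p > 0" "W \<subseteq> resid p"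
  shows "msq p (\<lambda>x. \<Sum>\<xi>\<in>W. a \<xi> * ee p (\<xi> * x)) = (\<Sum>\<xi>\<in>W. (norm (a \<xi>))\<^sup>2)"
proof -
  have fin: "finite W" using assms(2) finite_subset by blast
  have "complex_of_real (\<Sum>x\<in>resid p. (norm (\<Sum>\<xi>\<in>W. a \<xi> * ee p (\<xi> * x)))\<^sup>2)
      = (\<Sum>x\<in>resid p. \<Sum>\<xi>\<in>W. \<Sum>\<zeta>\<in>W. a \<xi> * cnj (a \<zeta>) * ee p ((\<xi> - \<zeta>) * x))"
    unfolding of_real_sum
  proof (rule sum.cong[OF refl])
    fix x
    have "ee p ((\<xi> - \<zeta>) * x) = ee p (\<xi> * x) * cnj (ee p (\<zeta> * x))" for \<xi> \<zeta>
      by (simp add: ee_diff left_diff_distrib)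
    then show "complex_of_real ((norm (\<Sum>\<xi>\<in>W. a \<xi> * ee p (\<xi> * x)))\<^sup>2)
        = (\<Sum>\<xi>\<in>W. \<Sum>\<zeta>\<in>W. a \<xi> * cnj (a \<zeta>) * ee p ((\<xi> - \<zeta>) * x))"
      unfolding complex_norm_square cnj_sum sum_product by (simp add: mult_ac)
  qed
  also have "\<dots> = (\<Sum>\<xi>\<in>W. \<Sum>\<zeta>\<in>W. a \<xi> * cnj (a \<zeta>) * (\<Sum>x\<in>resid p. ee p ((\<xi> - \<zeta>) * x)))"
    by (subst sum.swap, rule sum.cong[OF refl], subst sum.swap) (simp add: sum_distrib_left)
  also have "\<dots> = (\<Sum>\<xi>\<in>W. \<Sum>\<zeta>\<in>W. if \<zeta> = \<xi> then of_nat p * (a \<xi> * cnj (a \<xi>)) else 0)"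
  proof (intro sum.cong refl)
    fix \<xi> \<zeta> assume "\<xi> \<in> W" "\<zeta> \<in> W"
    then have "\<xi> \<in> resid p" "\<zeta> \<in> resid p" using assms(2) by auto
    then have "int p dvd \<xi> - \<zeta> \<longleftrightarrow> \<zeta> = \<xi>"
      by (metis atLeastLessThan_iff mod_eq_dvd_iff mod_pos_pos_trivial)
    then show "a \<xi> * cnj (a \<zeta>) * (\<Sum>x\<in>resid p. ee p ((\<xi> - \<zeta>) * x))
        = (if \<zeta> = \<xi> then of_nat p * (a \<xi> * cnj (a \<xi>)) else 0)"
      using assms(1) by (simp add: sum_ee)
  qed
  also have "\<dots> = complex_of_real (of_nat p * (\<Sum>\<xi>\<in>W. (norm (a \<xi>))\<^sup>2))"
    unfolding of_real_mult of_real_sum complex_norm_square using fin by (simp add: sum_distrib_left)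
  finally have "(\<Sum>x\<in>resid p. (norm (\<Sum>\<xi>\<in>W. a \<xi> * ee p (\<xi> * x)))\<^sup>2) = of_nat p * (\<Sum>\<xi>\<in>W. (norm (a \<xi>))\<^sup>2)"
    by (simp only: of_real_eq_iff)
  then show ?thesis using assms(1) by (simp add: msq_def)
qed

lemma parseval:
  assumes "p > 0" "periodic p f"
  shows "(\<Sum>\<xi>\<in>resid p. (norm (ft p f \<xi>))\<^sup>2) = msq p f"
proof -
  have "msq p f = msq p (\<lambda>x. \<Sum>\<xi>\<in>resid p. ft p f \<xi> * ee p (\<xi> * x))"
    by (intro arg_cong[of _ _ "msq p"] ext ft_inversion assms)
  then show ?thesis using msq_trig[OF assms(1), of "resid p" "ft p f"] by simp
qed

lemma msq_nonneg: "msq p f \<ge> 0"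
  by (simp add: msq_def sum_nonneg)

lemma cauchy_schwarz_sum:
  fixes a b :: "'i \<Rightarrow> real"
  shows "(\<Sum>i\<in>I. \<bar>a i * b i\<bar>) \<le> sqrt (\<Sum>i\<in>I. (a i)\<^sup>2) * sqrt (\<Sum>i\<in>I. (b i)\<^sup>2)"
  using L2_set_mult_ineq[of a b I] by (simp add: L2_set_def abs_mult)

lemma mean_norm_le_sqrt_msq:
  assumes "p > 0"
  shows "(\<Sum>x\<in>resid p. norm (f x)) / of_nat p \<le> sqrt (msq p f)"
proof -
  have "(\<Sum>x\<in>resid p. \<bar>norm (f x) * 1\<bar>) \<le> sqrt (\<Sum>x\<in>resid p. (norm (f x))\<^sup>2) * sqrt (\<Sum>x\<in>resid p. 1\<^sup>2)"
    by (rule cauchy_schwarz_sum)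
  then have "(\<Sum>x\<in>resid p. norm (f x)) \<le> sqrt (\<Sum>x\<in>resid p. (norm (f x))\<^sup>2) * sqrt (of_nat p)"
    by simp
  then have "(\<Sum>x\<in>resid p. norm (f x)) / of_nat p
      \<le> sqrt (\<Sum>x\<in>resid p. (norm (f x))\<^sup>2) * sqrt (of_nat p) / (sqrt (of_nat p) * sqrt (of_nat p))"
    by (simp add: divide_right_mono)
  also have "\<dots> = sqrt (msq p f)"
    unfolding msq_def real_sqrt_divide
    by (rule nonzero_mult_divide_mult_cancel_right) (use assms in simp)
  finally show ?thesis .
qed

text \<open>After expanding \<open>F0\<close> into characters, the sum at each frequency factors,
  since \<open>x + a1 * d\<close> and \<open>x + a2 * d\<close> are independent coordinates. The two
  coefficients obtained run over affine images of the frequency, so Cauchy-Schwarz and Parseval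
  apply. The phase in \<open>d\<close> merely translates these affine maps.\<close>

lemma trilinear_ft_bound:
  assumes p: "prime p"
    and F: "periodic p F0" "periodic p F1" "periodic p F2"
    and a: "\<not> int p dvd a0 - a1" "\<not> int p dvd a0 - a2" "\<not> int p dvd a2 - a1"
    and \<eta>: "\<And>\<xi>. norm (ft p F0 \<xi>) \<le> \<eta>"
  shows "norm (\<Sum>x\<in>resid p. \<Sum>d\<in>resid p. ee p (\<theta> * d) * F0 (x + a0 * d) * F1 (x + a1 * d) * F2 (x + a2 * d))
    \<le> (of_nat p)\<^sup>2 * \<eta> * sqrt (msq p F1) * sqrt (msq p F2)"
proof -
  have p0: "p > 0" using p by (rule prime_gt_0_nat)
  have cop: "coprime u (int p)" if "\<not> int p dvd u" for u
    using prime_imp_coprime[of "int p" u] p that by (simp add: coprime_commute)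
  obtain w where w: "[(a2 - a1) * w = 1] (mod int p)"
    using cong_solve_coprime_int[OF cop[OF a(3)]] by blast
  have w': "\<not> int p dvd w"
  proof
    assume "int p dvd w"
    then have "[0 = 1] (mod int p)" using w by (metis cong_0_iff cong_sym cong_trans dvd_mult)
    then show False using p prime_gt_1_nat[OF p] by (simp add: cong_def)
  qed
  \<comment> \<open>The phase has frequency \<open>\<alpha> \<xi>\<close> in the coordinate
    \<open>x + a1 * d\<close> and \<open>\<beta> \<xi>\<close> in \<open>x + a2 * d\<close>;
    \<open>w\<close> inverts the change of coordinates.\<close>
  define \<beta> where "\<beta> \<xi> = w * (\<xi> * (a0 - a1) + \<theta>)" for \<xi>
  define \<alpha> where "\<alpha> \<xi> = \<xi> - \<beta> \<xi>" for \<xi>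
  have inner: "(\<Sum>x\<in>resid p. \<Sum>d\<in>resid p. F1 (x + a1 * d) * F2 (x + a2 * d) * ee p (\<xi> * (x + a0 * d) + \<theta> * d))
      = (of_nat p)\<^sup>2 * (ft p F1 (- \<alpha> \<xi>) * ft p F2 (- \<beta> \<xi>))" (is "?L = _") for \<xi>
  proof -
    define G where "G x y d = F1 x * F2 y * ee p (\<xi> * x + (\<xi> * (a0 - a1) + \<theta>) * d)" for x y d
    have Gper: "G x y d = G x' y' d'"
      if "[x = x'] (mod int p)" "[y = y'] (mod int p)" "[d = d'] (mod int p)" for x x' y y' d d'
      unfolding G_def using that
      by (intro arg_cong2[of _ _ _ _ "(*)"] periodic_cong[OF F(2)] periodic_cong[OF F(3)] ee_cong
            cong_add cong_mult cong_refl)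
    have "?L = (\<Sum>d\<in>resid p. \<Sum>x\<in>resid p. G (x + a1 * d) (x + a1 * d + (a2 - a1) * d) d)"
      unfolding G_def by (subst sum.swap) (simp add: algebra_simps)
    also have "\<dots> = (\<Sum>d\<in>resid p. \<Sum>x\<in>resid p. G x (x + (a2 - a1) * d) d)"
    proof (rule sum.cong[OF refl])
      fix d
      have "periodic p (\<lambda>x. G x (x + (a2 - a1) * d) d)"
        by (intro periodicI Gper cong_add cong_refl)
      then show "(\<Sum>x\<in>resid p. G (x + a1 * d) (x + a1 * d + (a2 - a1) * d) d) = (\<Sum>x\<in>resid p. G x (x + (a2 - a1) * d) d)"
        using sum_shift[OF p0, of "\<lambda>x. G x (x + (a2 - a1) * d) d" "a1 * d"] by simp
    qed
    also have "\<dots> = (\<Sum>x\<in>resid p. \<Sum>d\<in>resid p. G x (x + (a2 - a1) * d) d)"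
      by (rule sum.swap)
    also have "\<dots> = (\<Sum>x\<in>resid p. \<Sum>d\<in>resid p. G x d (w * (d - x)))"
    proof (rule sum.cong[OF refl])
      fix x
      have "periodic p (\<lambda>d. G x (x + (a2 - a1) * d) d)"
        by (intro periodicI Gper cong_add cong_mult cong_refl)
      from sum_affine[OF p0 cop[OF w'] this, of "- (w * x)"]
      have "(\<Sum>d\<in>resid p. G x (x + (a2 - a1) * d) d)
          = (\<Sum>d\<in>resid p. G x (x + (a2 - a1) * (w * d + - (w * x))) (w * d + - (w * x)))" by simp
      also have "\<dots> = (\<Sum>d\<in>resid p. G x d (w * (d - x)))"
      proof (intro sum.cong refl Gper cong_refl)
        fix d
        have "[x + ((a2 - a1) * w) * (d - x) = x + 1 * (d - x)] (mod int p)"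
          by (intro cong_add cong_mult cong_refl w)
        then show "[x + (a2 - a1) * (w * d + - (w * x)) = d] (mod int p)"
          by (simp add: algebra_simps)
        show "[w * d + - (w * x) = w * (d - x)] (mod int p)" by (simp add: algebra_simps)
      qed
      finally show "(\<Sum>d\<in>resid p. G x (x + (a2 - a1) * d) d) = (\<Sum>d\<in>resid p. G x d (w * (d - x)))" .
    qed
    also have "\<dots> = (\<Sum>x\<in>resid p. \<Sum>d\<in>resid p. (F1 x * ee p (\<alpha> \<xi> * x)) * (F2 d * ee p (\<beta> \<xi> * d)))"
    proof -
      have "ee p (\<xi> * x + (\<xi> * (a0 - a1) + \<theta>) * (w * (d - x))) = ee p (\<alpha> \<xi> * x) * ee p (\<beta> \<xi> * d)" for x d
        unfolding ee_add[symmetric] by (simp add: \<alpha>_def \<beta>_def algebra_simps)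
      then show ?thesis unfolding G_def by (simp add: mult_ac)
    qed
    also have "\<dots> = (\<Sum>x\<in>resid p. F1 x * ee p (\<alpha> \<xi> * x)) * (\<Sum>d\<in>resid p. F2 d * ee p (\<beta> \<xi> * d))"
      by (simp add: sum_product)
    also have "\<dots> = (of_nat p)\<^sup>2 * (ft p F1 (- \<alpha> \<xi>) * ft p F2 (- \<beta> \<xi>))"
      using p0 by (simp add: ft_def power2_eq_square)
    finally show ?thesis .
  qed
  have "(\<Sum>x\<in>resid p. \<Sum>d\<in>resid p. ee p (\<theta> * d) * F0 (x + a0 * d) * F1 (x + a1 * d) * F2 (x + a2 * d))
      = (\<Sum>x\<in>resid p. \<Sum>d\<in>resid p. \<Sum>\<xi>\<in>resid p. ft p F0 \<xi> *
          (F1 (x + a1 * d) * F2 (x + a2 * d) * ee p (\<xi> * (x + a0 * d) + \<theta> * d)))"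
  proof (intro sum.cong refl)
    fix x d
    have "ee p (\<theta> * d) * F0 (x + a0 * d) * F1 (x + a1 * d) * F2 (x + a2 * d)
        = (\<Sum>\<xi>\<in>resid p. ft p F0 \<xi> * ee p (\<xi> * (x + a0 * d))) * (ee p (\<theta> * d) * F1 (x + a1 * d) * F2 (x + a2 * d))"
      using ft_inversion[OF p0 F(1), of "x + a0 * d"] by simp
    also have "\<dots> = (\<Sum>\<xi>\<in>resid p. ft p F0 \<xi> *
          (F1 (x + a1 * d) * F2 (x + a2 * d) * ee p (\<xi> * (x + a0 * d) + \<theta> * d)))"
      unfolding sum_distrib_right by (simp add: ee_add mult_ac)
    finally show "ee p (\<theta> * d) * F0 (x + a0 * d) * F1 (x + a1 * d) * F2 (x + a2 * d) = \<dots>" .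
  qed
  also have "\<dots> = (\<Sum>\<xi>\<in>resid p. ft p F0 \<xi> * (\<Sum>x\<in>resid p. \<Sum>d\<in>resid p.
          F1 (x + a1 * d) * F2 (x + a2 * d) * ee p (\<xi> * (x + a0 * d) + \<theta> * d)))"
    unfolding sum_distrib_left
    by (rule trans[OF sum.cong[OF refl sum.swap] sum.swap])
  also have "\<dots> = (\<Sum>\<xi>\<in>resid p. ft p F0 \<xi> * ((of_nat p)\<^sup>2 * (ft p F1 (- \<alpha> \<xi>) * ft p F2 (- \<beta> \<xi>))))"
    unfolding inner ..
  also have "norm \<dots> \<le> (\<Sum>\<xi>\<in>resid p. \<eta> * ((of_nat p)\<^sup>2 * \<bar>norm (ft p F1 (- \<alpha> \<xi>)) * norm (ft p F2 (- \<beta> \<xi>))\<bar>))"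
    by (intro sum_norm_le) (auto simp: norm_mult norm_power intro!: mult_right_mono \<eta>)
  also have "\<dots> = (of_nat p)\<^sup>2 * \<eta> * (\<Sum>\<xi>\<in>resid p. \<bar>norm (ft p F1 (- \<alpha> \<xi>)) * norm (ft p F2 (- \<beta> \<xi>))\<bar>)"
    by (simp add: sum_distrib_left mult_ac)
  also have "\<dots> \<le> (of_nat p)\<^sup>2 * \<eta> * (sqrt (\<Sum>\<xi>\<in>resid p. (norm (ft p F1 (- \<alpha> \<xi>)))\<^sup>2) * sqrt (\<Sum>\<xi>\<in>resid p. (norm (ft p F2 (- \<beta> \<xi>)))\<^sup>2))"
  proof -
    have "0 \<le> \<eta>" using \<eta>[of 0] norm_ge_zero order_trans by blast
    then show ?thesis by (intro mult_left_mono cauchy_schwarz_sum) simp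
  qed
  also have "(\<Sum>\<xi>\<in>resid p. (norm (ft p F1 (- \<alpha> \<xi>)))\<^sup>2) = msq p F1"
  proof -
    \<comment> \<open>The slope of \<open>- \<alpha>\<close>; it could vanish modulo
      \<open>p\<close> only if \<open>a0\<close> and \<open>a2\<close> were congruent.\<close>
    have "\<not> int p dvd w * (a0 - a1) - 1"
    proof
      assume "int p dvd w * (a0 - a1) - 1"
      then have "[w * (a0 - a1) = (a2 - a1) * w] (mod int p)"
        using w by (metis cong_iff_dvd_diff cong_sym cong_trans)
      then have "[w * (a0 - a1) = w * (a2 - a1)] (mod int p)" by (simp add: mult.commute)
      then have "[a0 - a1 = a2 - a1] (mod int p)" using cop[OF w'] by (simp add: cong_mult_lcancel)
      then show False using a(2) by (simp add: cong_iff_dvd_diff)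
    qed
    from sum_affine[OF p0 cop[OF this], of "\<lambda>\<xi>. (norm (ft p F1 \<xi>))\<^sup>2" "w * \<theta>"]
    have "(\<Sum>\<xi>\<in>resid p. (norm (ft p F1 ((w * (a0 - a1) - 1) * \<xi> + w * \<theta>)))\<^sup>2) = msq p F1"
      using periodic_ft[of p F1] parseval[OF p0 F(2)] by (simp add: periodic_def)
    moreover have "(w * (a0 - a1) - 1) * \<xi> + w * \<theta> = - \<alpha> \<xi>" for \<xi>
      by (simp add: \<alpha>_def \<beta>_def algebra_simps)
    ultimately show ?thesis by simp
  qed
  also have "(\<Sum>\<xi>\<in>resid p. (norm (ft p F2 (- \<beta> \<xi>)))\<^sup>2) = msq p F2"
  proof -
    have "\<not> int p dvd - (w * (a0 - a1))"
      using w' a(1) p by (simp add: prime_dvd_mult_iff)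
    from sum_affine[OF p0 cop[OF this], of "\<lambda>\<xi>. (norm (ft p F2 \<xi>))\<^sup>2" "- (w * \<theta>)"]
    have "(\<Sum>\<xi>\<in>resid p. (norm (ft p F2 (- (w * (a0 - a1)) * \<xi> + - (w * \<theta>))))\<^sup>2) = msq p F2"
      using periodic_ft[of p F2] parseval[OF p0 F(3)] by (simp add: periodic_def)
    moreover have "- (w * (a0 - a1)) * \<xi> + - (w * \<theta>) = - \<beta> \<xi>" for \<xi>
      by (simp add: \<beta>_def algebra_simps)
    ultimately show ?thesis by simp
  qed
  finally show ?thesis by (simp add: mult.assoc)
qed

section \<open>Bohr sets\<close>

definition bohr :: "nat \<Rightarrow> int set \<Rightarrow> real \<Rightarrow> int set" where
  "bohr p Q \<epsilon> = {x \<in> resid p. \<forall>\<xi>\<in>Q. norm (ee p (\<xi> * x) - 1) \<le> \<epsilon>}"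

lemma norm_cis_diff_1_le: "norm (cis a - 1) \<le> \<bar>a\<bar>"
proof -
  have "(norm (cis a - 1))\<^sup>2 = (cos a - 1)\<^sup>2 + (sin a)\<^sup>2"
    by (simp add: cmod_power2)
  also have "\<dots> = 2 - 2 * cos a"
    using sin_cos_squared_add[of a] by (simp add: power2_eq_square algebra_simps)
  also have "\<dots> = (2 * sin (a / 2))\<^sup>2"
    using cos_double_sin[of "a / 2"] by (simp add: power_mult_distrib)
  finally have "norm (cis a - 1) = \<bar>2 * sin (a / 2)\<bar>"
    by (metis abs_norm_cancel power2_eq_iff_nonneg abs_ge_zero norm_ge_zero power2_abs)
  then show ?thesis using abs_sin_x_le_abs_x[of "a / 2"] by simp
qed

text \<open>Each frequency cuts the circle into \<open>n\<close> arcs, and the indices of the arcs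
  are the digits of the cell number in base \<open>n\<close>. The cells serve to bound Bohr sets
  from below, as a colouring, and to localise the dense set.\<close>

lemma ex_bohr_cells:
  assumes "p > 0" "n > 0" "finite Q"
  obtains \<kappa> :: "int \<Rightarrow> nat" where "\<And>x. \<kappa> x < n ^ card Q"
    "\<And>x y \<xi>. \<kappa> x = \<kappa> y \<Longrightarrow> \<xi> \<in> Q \<Longrightarrow> norm (ee p (\<xi> * (x - y)) - 1) \<le> 2 * pi / n"
proof -
  have "\<exists>\<kappa> :: int \<Rightarrow> nat. (\<forall>x. \<kappa> x < n ^ card Q) \<and>
    (\<forall>x y. \<kappa> x = \<kappa> y \<longrightarrow> (\<forall>\<xi>\<in>Q. norm (ee p (\<xi> * (x - y)) - 1) \<le> 2 * pi / n))"
    using assms(3)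
  proof (induction Q)
    case empty
    then show ?case by (intro exI[of _ "\<lambda>_. 0"]) simp
  next
    case (insert \<xi> Q)
    then obtain \<kappa> :: "int \<Rightarrow> nat" where \<kappa>: "\<forall>x. \<kappa> x < n ^ card Q"
      "\<forall>x y. \<kappa> x = \<kappa> y \<longrightarrow> (\<forall>\<xi>\<in>Q. norm (ee p (\<xi> * (x - y)) - 1) \<le> 2 * pi / n)" by blast
    define c where "c x = nat ((int n * ((\<xi> * x) mod int p)) div int p)" for x
    have c_less: "c x < n" for x
    proof -
      have "int n * ((\<xi> * x) mod int p) < int n * int p" using assms by simp
      moreover have "(int n * ((\<xi> * x) mod int p)) div int p * int p \<le> int n * ((\<xi> * x) mod int p)"
        using div_mult_mod_eq[of "int n * ((\<xi> * x) mod int p)" "int p"]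
          pos_mod_sign[of "int p" "int n * ((\<xi> * x) mod int p)"] assms(1) by linarith
      ultimately have "(int n * ((\<xi> * x) mod int p)) div int p * int p < int n * int p" by linarith
      then have "(int n * ((\<xi> * x) mod int p)) div int p < int n"
        using assms(1) by simp
      then show ?thesis unfolding c_def using assms(2) by simp
    qed
    have c_eq: "norm (ee p (\<xi> * (x - y)) - 1) \<le> 2 * pi / n" if "c x = c y" for x y
    proof -
      define a b where "a = (\<xi> * x) mod int p" and "b = (\<xi> * y) mod int p"
      have "a \<ge> 0" "b \<ge> 0" using assms(1) by (auto simp: a_def b_def)
      then have eq: "(int n * a) div int p = (int n * b) div int p"
        using that assms unfolding c_def a_def[symmetric] b_def[symmetric]
        by (simp add: pos_imp_zdiv_nonneg_iff eq_nat_nat_iff)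
      have "int n * a = (int n * b) div int p * int p + (int n * a) mod int p"
        unfolding eq[symmetric] by (simp only: div_mult_mod_eq)
      moreover have "int n * b = (int n * b) div int p * int p + (int n * b) mod int p"
        by (simp only: div_mult_mod_eq)
      moreover have "0 \<le> (int n * a) mod int p" "(int n * a) mod int p < int p"
        "0 \<le> (int n * b) mod int p" "(int n * b) mod int p < int p" using assms(1) by auto
      ultimately have "\<bar>int n * a - int n * b\<bar> \<le> int p" by linarith
      then have "\<bar>int n * (a - b)\<bar> \<le> int p" by (simp add: right_diff_distrib)
      then have "real n * \<bar>real_of_int (a - b)\<bar> \<le> real p"
      proof -
        assume "\<bar>int n * (a - b)\<bar> \<le> int p"
        then have "real_of_int \<bar>int n * (a - b)\<bar> \<le> real_of_int (int p)" by (simp only: of_int_le_iff)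
        then show ?thesis by (simp add: abs_mult del: of_int_diff)
      qed
      then have le: "\<bar>real_of_int (a - b)\<bar> / p \<le> 1 / n"
      proof -
        assume "real n * \<bar>real_of_int (a - b)\<bar> \<le> real p"
        moreover have "real n > 0" "real p > 0" using assms by simp_all
        moreover have "n' * r \<le> p' \<Longrightarrow> n' > 0 \<Longrightarrow> p' > 0 \<Longrightarrow> r / p' \<le> 1 / n'" for n' r p' :: real
          by (simp add: field_simps)
        ultimately show ?thesis by blast
      qed
      have "[\<xi> * (x - y) = a - b] (mod int p)"
        unfolding a_def b_def right_diff_distrib by (intro cong_diff) (simp_all add: cong_def)
      then have "ee p (\<xi> * (x - y)) = cis (2 * pi * of_int (a - b) / p)"
        unfolding ee_def[symmetric] by (rule ee_cong)
      then have "norm (ee p (\<xi> * (x - y)) - 1) \<le> \<bar>2 * pi * of_int (a - b) / p\<bar>"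
        by (simp only: norm_cis_diff_1_le)
      also have "\<dots> = 2 * pi * (\<bar>real_of_int (a - b)\<bar> / p)" by (simp add: abs_mult)
      also have "\<dots> \<le> 2 * pi * (1 / n)" by (intro mult_left_mono le) simp
      finally show ?thesis by simp
    qed
    define \<kappa>' where "\<kappa>' x = \<kappa> x * n + c x" for x
    have "\<kappa>' x < n ^ card (insert \<xi> Q)" for x
    proof -
      have "\<kappa>' x < (\<kappa> x + 1) * n" unfolding \<kappa>'_def using c_less[of x] by simp
      also have "\<dots> \<le> n ^ card Q * n" using \<kappa>(1) by (intro mult_right_mono) (auto simp: Suc_le_eq)
      finally show ?thesis using insert by (simp add: mult.commute)
    qed
    moreover have "\<kappa> x = \<kappa> y \<and> c x = c y" if "\<kappa>' x = \<kappa>' y" for x y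
    proof -
      have "\<kappa>' x div n = \<kappa> x" "\<kappa>' x mod n = c x" "\<kappa>' y div n = \<kappa> y" "\<kappa>' y mod n = c y"
        unfolding \<kappa>'_def using c_less[of x] c_less[of y] assms(2) by simp_all
      then show ?thesis using that by simp
    qed
    ultimately show ?case
      using \<kappa>(2) c_eq by (intro exI[of _ \<kappa>']) (metis insert_iff)
  qed
  then show ?thesis using that by blast
qed

text \<open>Subtracting one element of a cell from the others embeds the cell into the Bohr
  set.\<close>

lemma card_bohr_ge:
  assumes "p > 0" "n > 0" "finite Q" "2 * pi / n \<le> \<epsilon>"
  shows "p \<le> n ^ card Q * card (bohr p Q \<epsilon>)"
proof -
  obtain \<kappa> where \<kappa>: "\<And>x. \<kappa> x < n ^ card Q"
    "\<And>x y \<xi>. \<kappa> x = \<kappa> y \<Longrightarrow> \<xi> \<in> Q \<Longrightarrow> norm (ee p (\<xi> * (x - y)) - 1) \<le> 2 * pi / n"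
    using ex_bohr_cells[OF assms(1-3)] by blast
  have "card {x \<in> resid p. \<kappa> x = c} \<le> card (bohr p Q \<epsilon>)" for c
  proof (cases "{x \<in> resid p. \<kappa> x = c} = {}")
    case False
    then obtain z where z: "z \<in> resid p" "\<kappa> z = c" by blast
    have "inj_on (\<lambda>x. (x - z) mod int p) {x \<in> resid p. \<kappa> x = c}"
    proof (rule inj_onI)
      fix x y assume "x \<in> {x \<in> resid p. \<kappa> x = c}" "y \<in> {x \<in> resid p. \<kappa> x = c}"
        "(x - z) mod int p = (y - z) mod int p"
      then have xy: "x \<in> resid p" "y \<in> resid p" "[x + - z = y + - z] (mod int p)" by (auto simp: cong_def)
      then have "[x = y] (mod int p)" by (simp only: cong_add_rcancel)
      then show "x = y" using xy by (simp add: cong_def)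
    qed
    moreover have "(\<lambda>x. (x - z) mod int p) ` {x \<in> resid p. \<kappa> x = c} \<subseteq> bohr p Q \<epsilon>"
    proof clarify
      fix x assume "x \<in> resid p" "c = \<kappa> x"
      have "norm (ee p (\<xi> * ((x - z) mod int p)) - 1) \<le> \<epsilon>" if "\<xi> \<in> Q" for \<xi>
      proof -
        have "ee p (\<xi> * ((x - z) mod int p)) = ee p (\<xi> * (x - z))"
          by (intro ee_cong cong_mult cong_refl) (simp add: cong_def)
        then show ?thesis using \<kappa>(2)[OF _ that, of x z] z \<open>c = \<kappa> x\<close> assms(4) by simp
      qed
      then show "(x - z) mod int p \<in> bohr p Q \<epsilon>" unfolding bohr_def using assms(1) by simp
    qed
    moreover have "finite (bohr p Q \<epsilon>)" by (rule finite_subset[of _ "resid p"]) (auto simp: bohr_def)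
    ultimately show ?thesis by (meson card_inj_on_le)
  qed (simp only: card.empty zero_le)
  then have "(\<Sum>c<n ^ card Q. card {x \<in> resid p. \<kappa> x = c}) \<le> (\<Sum>c<n ^ card Q. card (bohr p Q \<epsilon>))"
    by (rule sum_mono)
  moreover have "(\<Sum>c<n ^ card Q. card {x \<in> resid p. \<kappa> x = c}) = card (\<Union>c<n ^ card Q. {x \<in> resid p. \<kappa> x = c})"
    by (rule card_UN_disjoint[symmetric]) (auto intro: finite_subset[of _ "resid p"])
  moreover have "(\<Union>c<n ^ card Q. {x \<in> resid p. \<kappa> x = c}) = resid p" using \<kappa>(1) by auto
  ultimately show ?thesis by simp
qed

section \<open>Averages over a finite set and their Fourier multipliers\<close>

definition avg :: "int set \<Rightarrow> (int \<Rightarrow> complex) \<Rightarrow> int \<Rightarrow> complex" where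
  "avg B f x = (\<Sum>b\<in>B. f (x + b)) / of_nat (card B)"

definition avg_ft :: "nat \<Rightarrow> int set \<Rightarrow> int \<Rightarrow> complex" where
  "avg_ft p B \<xi> = (\<Sum>b\<in>B. ee p (\<xi> * b)) / of_nat (card B)"

lemma periodic_shift: "periodic p f \<Longrightarrow> periodic p (\<lambda>x. f (x + h))"
  by (intro periodicI) (erule periodic_cong, rule cong_add, assumption, rule cong_refl)

lemma periodic_avg: "periodic p f \<Longrightarrow> periodic p (avg B f)"
  unfolding avg_def
  by (intro periodicI arg_cong2[of _ _ _ _ "(/)"] sum.cong refl) (erule periodic_cong, rule cong_add, assumption, rule cong_refl)

lemma ft_shift:
  assumes "p > 0" "periodic p f"
  shows "ft p (\<lambda>x. f (x + h)) \<xi> = ee p (\<xi> * h) * ft p f \<xi>"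
proof -
  have "periodic p (\<lambda>x. f x * ee p (- (\<xi> * (x - h))))"
    by (intro periodicI arg_cong2[of _ _ _ _ "(*)"] periodic_cong[OF assms(2)] ee_cong
        iffD2[OF cong_minus_minus_iff] cong_mult cong_diff cong_refl)
  from sum_shift[OF assms(1) this, of h]
  have "(\<Sum>x\<in>resid p. f (x + h) * ee p (- (\<xi> * x))) = (\<Sum>x\<in>resid p. f x * ee p (- (\<xi> * (x - h))))"
    by simp
  also have "\<dots> = (\<Sum>x\<in>resid p. ee p (\<xi> * h) * (f x * ee p (- (\<xi> * x))))"
  proof -
    have "ee p (- (\<xi> * (x - h))) = ee p (\<xi> * h) * ee p (- (\<xi> * x))" for x
      unfolding ee_add[symmetric] by (simp add: algebra_simps)
    then show ?thesis by (simp add: mult_ac)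
  qed
  finally show ?thesis by (simp add: ft_def sum_distrib_left)
qed

lemma ft_diff: "ft p (\<lambda>x. f x - g x) \<xi> = ft p f \<xi> - ft p g \<xi>"
  by (simp add: ft_def left_diff_distrib sum_subtractf diff_divide_distrib)

lemma ft_avg:
  assumes "p > 0" "periodic p f"
  shows "ft p (avg B f) \<xi> = avg_ft p B \<xi> * ft p f \<xi>"
proof -
  have "ft p (avg B f) \<xi> = (\<Sum>x\<in>resid p. \<Sum>b\<in>B. f (x + b) * ee p (- (\<xi> * x))) / of_nat p / of_nat (card B)"
  proof -
    have "avg B f x * ee p (- (\<xi> * x)) = (\<Sum>b\<in>B. f (x + b) * ee p (- (\<xi> * x))) / of_nat (card B)" for x
      by (simp add: avg_def sum_distrib_right)
    then show ?thesis by (simp add: ft_def mult.commute flip: sum_divide_distrib)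
  qed
  also have "\<dots> = (\<Sum>b\<in>B. ft p (\<lambda>x. f (x + b)) \<xi>) / of_nat (card B)"
    by (subst sum.swap) (simp add: ft_def sum_divide_distrib)
  also have "\<dots> = avg_ft p B \<xi> * ft p f \<xi>"
    by (simp add: ft_shift[OF assms] avg_ft_def sum_distrib_right)
  finally show ?thesis .
qed

lemma norm_avg_ft_le_1: "norm (avg_ft p B \<xi>) \<le> 1"
proof -
  have "norm (\<Sum>b\<in>B. ee p (\<xi> * b)) \<le> (\<Sum>b\<in>B. 1)" by (rule sum_norm_le) simp
  then show ?thesis by (cases "card B = 0") (auto simp: avg_ft_def norm_divide)
qed

lemma norm_avg_ft_diff_1_le:
  assumes "finite B" "B \<noteq> {}" "\<And>b. b \<in> B \<Longrightarrow> norm (ee p (\<xi> * b) - 1) \<le> \<tau>"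
  shows "norm (1 - avg_ft p B \<xi>) \<le> \<tau>"
proof -
  have c: "card B > 0" using assms by (simp add: card_gt_0_iff)
  then have "1 - avg_ft p B \<xi> = - ((\<Sum>b\<in>B. ee p (\<xi> * b) - 1) / of_nat (card B))"
    by (simp add: avg_ft_def sum_subtractf diff_divide_distrib)
  then have "norm (1 - avg_ft p B \<xi>) = norm (\<Sum>b\<in>B. ee p (\<xi> * b) - 1) / of_nat (card B)"
    by (simp add: norm_divide del: minus_divide_left)
  also have "\<dots> \<le> (\<Sum>b\<in>B. \<tau>) / of_nat (card B)"
    by (intro divide_right_mono sum_norm_le assms) auto
  also have "\<dots> = \<tau>" using c by simp
  finally show ?thesis .
qed

lemma sum_norm_ee_sum:
  assumes "p > 0" "B \<subseteq> resid p"
  shows "(\<Sum>\<xi>\<in>resid p. (norm (\<Sum>b\<in>B. ee p (\<xi> * b)))\<^sup>2) = of_nat p * of_nat (card B)"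
proof -
  have "msq p (\<lambda>x. \<Sum>b\<in>B. 1 * ee p (b * x)) = (\<Sum>b\<in>B. (norm (1::complex))\<^sup>2)"
    by (rule msq_trig[OF assms])
  then show ?thesis using assms(1) by (simp add: msq_def mult.commute field_simps)
qed

lemma sum_norm_avg_ft:
  assumes "p > 0" "B \<subseteq> resid p" "B \<noteq> {}"
  shows "(\<Sum>\<xi>\<in>resid p. (norm (avg_ft p B \<xi>))\<^sup>2) = of_nat p / of_nat (card B)"
proof -
  have "finite B" using assms(2) finite_subset by blast
  then have "card B > 0" using assms(3) by (simp add: card_gt_0_iff)
  then show ?thesis
    using sum_norm_ee_sum[OF assms(1,2)]
    by (simp add: avg_ft_def norm_divide power_divide sum_divide_distrib[symmetric] power2_eq_square)
qed

lemma ft_trig: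
  assumes "p > 0" "W \<subseteq> resid p" "\<zeta> \<in> resid p"
  shows "ft p (\<lambda>x. \<Sum>\<xi>\<in>W. a \<xi> * ee p (\<xi> * x)) \<zeta> = (if \<zeta> \<in> W then a \<zeta> else 0)"
proof -
  have fin: "finite W" using assms(2) finite_subset by blast
  have "ft p (\<lambda>x. \<Sum>\<xi>\<in>W. a \<xi> * ee p (\<xi> * x)) \<zeta>
      = (\<Sum>x\<in>resid p. \<Sum>\<xi>\<in>W. a \<xi> * ee p ((\<xi> - \<zeta>) * x)) / of_nat p"
  proof -
    have "ee p ((\<xi> - \<zeta>) * x) = ee p (\<xi> * x) * ee p (- (\<zeta> * x))" for \<xi> x
      unfolding ee_add[symmetric] by (simp add: algebra_simps)
    then show ?thesis by (simp only: ft_def sum_distrib_right mult.assoc)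
  qed
  also have "\<dots> = (\<Sum>\<xi>\<in>W. a \<xi> * (\<Sum>x\<in>resid p. ee p ((\<xi> - \<zeta>) * x))) / of_nat p"
    by (subst sum.swap) (simp add: sum_distrib_left)
  also have "\<dots> = (\<Sum>\<xi>\<in>W. if \<zeta> = \<xi> then of_nat p * a \<xi> else 0) / of_nat p"
  proof -
    have "int p dvd \<xi> - \<zeta> \<longleftrightarrow> \<zeta> = \<xi>" if "\<xi> \<in> W" for \<xi>
      using that assms(2,3) by (metis atLeastLessThan_iff mod_eq_dvd_iff mod_pos_pos_trivial subsetD)
    then show ?thesis
      by (intro arg_cong2[of _ _ _ _ "(/)"] sum.cong refl) (use assms(1) in \<open>simp add: sum_ee\<close>)
  qed
  also have "\<dots> = (if \<zeta> \<in> W then a \<zeta> else 0)" using fin assms(1) by simp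
  finally show ?thesis .
qed

text \<open>A frequency with a large multiplier contributes a factor at most \<rho>. Any other one
  is damped by \<kappa> and moved by at most 2, whence the term
  \<open>4 * \<kappa>\<^sup>2\<close>.\<close>

lemma msq_avg_shift_le:
  assumes "p > 0" "periodic p f" "msq p f \<le> 1" "\<kappa> \<ge> 0" "\<rho> \<ge> 0"
    and h: "\<And>\<xi>. \<xi> \<in> resid p \<Longrightarrow> norm (avg_ft p B \<xi>) \<ge> \<kappa> \<Longrightarrow> norm (ee p (\<xi> * h) - 1) \<le> \<rho>"
  shows "msq p (\<lambda>x. avg B f (x + h) - avg B f x) \<le> \<rho>\<^sup>2 + 4 * \<kappa>\<^sup>2"
proof -
  let ?g = "\<lambda>x. avg B f (x + h) - avg B f x"
  have per: "periodic p ?g"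
    using periodic_avg[OF assms(2), of B] periodic_shift[OF periodic_avg[OF assms(2), of B], of h]
    by (simp add: periodic_def)
  have "msq p ?g = (\<Sum>\<xi>\<in>resid p. (norm (ft p ?g \<xi>))\<^sup>2)"
    by (rule parseval[OF assms(1) per, symmetric])
  also have "\<dots> \<le> (\<Sum>\<xi>\<in>resid p. (norm (ft p f \<xi>))\<^sup>2 * (\<rho>\<^sup>2 + 4 * \<kappa>\<^sup>2))"
  proof (rule sum_mono)
    fix \<xi> assume \<xi>: "\<xi> \<in> resid p"
    have "ft p ?g \<xi> = (ee p (\<xi> * h) - 1) * (avg_ft p B \<xi> * ft p f \<xi>)"
      using ft_shift[OF assms(1) periodic_avg[OF assms(2), of B], of h \<xi>]
      by (simp add: ft_diff ft_avg[OF assms(1,2)] algebra_simps)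
    then have eq: "(norm (ft p ?g \<xi>))\<^sup>2 = (norm (ft p f \<xi>))\<^sup>2 * (norm (ee p (\<xi> * h) - 1) * norm (avg_ft p B \<xi>))\<^sup>2"
      by (simp add: norm_mult power_mult_distrib)
    have "(norm (ee p (\<xi> * h) - 1) * norm (avg_ft p B \<xi>))\<^sup>2 \<le> \<rho>\<^sup>2 + 4 * \<kappa>\<^sup>2"
    proof (cases "norm (avg_ft p B \<xi>) \<ge> \<kappa>")
      case True
      have "norm (ee p (\<xi> * h) - 1) * norm (avg_ft p B \<xi>) \<le> \<rho> * 1"
        by (intro mult_mono h \<xi> True norm_avg_ft_le_1 assms) simp
      then have "(norm (ee p (\<xi> * h) - 1) * norm (avg_ft p B \<xi>))\<^sup>2 \<le> (\<rho> * 1)\<^sup>2"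
        by (intro power_mono) simp_all
      then show ?thesis by (simp add: add_increasing2)
    next
      case False
      have "norm (ee p (\<xi> * h) - 1) \<le> 2" using norm_triangle_ineq4[of "ee p (\<xi> * h)" 1] by simp
      then have "norm (ee p (\<xi> * h) - 1) * norm (avg_ft p B \<xi>) \<le> 2 * \<kappa>"
        using False by (intro mult_mono) auto
      then have "(norm (ee p (\<xi> * h) - 1) * norm (avg_ft p B \<xi>))\<^sup>2 \<le> (2 * \<kappa>)\<^sup>2"
        by (intro power_mono) simp_all
      then show ?thesis by (simp add: power_mult_distrib add_increasing)
    qed
    then show "(norm (ft p ?g \<xi>))\<^sup>2 \<le> (norm (ft p f \<xi>))\<^sup>2 * (\<rho>\<^sup>2 + 4 * \<kappa>\<^sup>2)"
      unfolding eq by (intro mult_left_mono) simp_all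
  qed
  also have "\<dots> = msq p f * (\<rho>\<^sup>2 + 4 * \<kappa>\<^sup>2)"
    by (simp add: sum_distrib_right[symmetric] parseval[OF assms(1,2)])
  also have "\<dots> \<le> 1 * (\<rho>\<^sup>2 + 4 * \<kappa>\<^sup>2)"
    by (intro mult_right_mono assms) simp
  finally show ?thesis by simp
qed

text \<open>The steps are differences of two elements of \<open>B\<close>, because their
  distribution has a nonnegative Fourier transform whose total mass is given by Parseval; for steps
  from \<open>B\<close> itself the corresponding absolute sum would be out of control.\<close>

definition tri :: "nat \<Rightarrow> int set \<Rightarrow> int \<Rightarrow> (int \<Rightarrow> complex) \<Rightarrow> int \<Rightarrow> (int \<Rightarrow> complex) \<Rightarrow> int \<Rightarrow> (int \<Rightarrow> complex) \<Rightarrow> complex" where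
  "tri p B a0 F0 a1 F1 a2 F2 = (\<Sum>x\<in>resid p. \<Sum>b\<in>B. \<Sum>b'\<in>B.
     F0 (x + a0 * (b - b')) * F1 (x + a1 * (b - b')) * F2 (x + a2 * (b - b')))"

lemma tri_swap: "tri p B a0 F0 a1 F1 a2 F2 = tri p B a1 F1 a0 F0 a2 F2"
  by (simp add: tri_def mult_ac)

lemma tri_rotate: "tri p B a0 F0 a1 F1 a2 F2 = tri p B a2 F2 a0 F0 a1 F1"
  by (simp add: tri_def mult_ac)

lemma tri_diff: "tri p B a0 (\<lambda>x. F x - G x) a1 F1 a2 F2 = tri p B a0 F a1 F1 a2 F2 - tri p B a0 G a1 F1 a2 F2"
  by (simp add: tri_def left_diff_distrib sum_subtractf)

lemma tri_add: "tri p B a0 (\<lambda>x. F x + G x) a1 F1 a2 F2 = tri p B a0 F a1 F1 a2 F2 + tri p B a0 G a1 F1 a2 F2"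
  by (simp add: tri_def distrib_right sum.distrib)

lemma norm_tri_le_msq:
  assumes p: "p > 0" and F0: "periodic p F0"
    and F1: "\<And>x. norm (F1 x) \<le> 1" and F2: "\<And>x. norm (F2 x) \<le> 1"
  shows "norm (tri p B a0 F0 a1 F1 a2 F2) \<le> (card B)\<^sup>2 * p * sqrt (msq p F0)"
proof -
  have "norm (tri p B a0 F0 a1 F1 a2 F2) \<le> (\<Sum>x\<in>resid p. \<Sum>b\<in>B. \<Sum>b'\<in>B. norm (F0 (x + a0 * (b - b'))))"
    unfolding tri_def
  proof (intro sum_norm_le)
    fix x b b'
    have "norm (F0 (x + a0 * (b - b')) * F1 (x + a1 * (b - b')) * F2 (x + a2 * (b - b')))
        \<le> norm (F0 (x + a0 * (b - b'))) * 1 * 1"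
      unfolding norm_mult by (intro mult_mono F1 F2) auto
    then show "norm (F0 (x + a0 * (b - b')) * F1 (x + a1 * (b - b')) * F2 (x + a2 * (b - b')))
        \<le> norm (F0 (x + a0 * (b - b')))" by simp
  qed
  also have "\<dots> = (\<Sum>b\<in>B. \<Sum>b'\<in>B. \<Sum>x\<in>resid p. norm (F0 (x + a0 * (b - b'))))"
    by (subst sum.swap, rule sum.cong[OF refl], rule sum.swap)
  also have "\<dots> = (\<Sum>b\<in>B. \<Sum>b'\<in>B. \<Sum>x\<in>resid p. norm (F0 x))"
  proof (rule sum.cong[OF refl], rule sum.cong[OF refl])
    fix b b'
    have "periodic p (\<lambda>x. norm (F0 x))" using F0 by (simp add: periodic_def)
    then show "(\<Sum>x\<in>resid p. norm (F0 (x + a0 * (b - b')))) = (\<Sum>x\<in>resid p. norm (F0 x))"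
      by (rule sum_shift[OF p])
  qed
  also have "\<dots> = (card B)\<^sup>2 * p * ((\<Sum>x\<in>resid p. norm (F0 x)) / p)"
    using p by (simp add: power2_eq_square)
  also have "\<dots> \<le> (card B)\<^sup>2 * p * sqrt (msq p F0)"
    by (intro mult_left_mono mean_norm_le_sqrt_msq p) simp
  finally show ?thesis .
qed

lemma sum_differences:
  fixes \<Phi> :: "int \<Rightarrow> complex"
  assumes "p > 0" "periodic p \<Phi>"
  shows "(\<Sum>b\<in>B. \<Sum>b'\<in>B. \<Phi> (b - b'))
    = (\<Sum>\<theta>\<in>resid p. of_real ((norm (\<Sum>b\<in>B. ee p (\<theta> * b)))\<^sup>2) * (\<Sum>d\<in>resid p. ee p (\<theta> * d) * \<Phi> d)) / of_nat p"
proof -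
  have "(\<Sum>b'\<in>B. \<Sum>b\<in>B. \<Phi> (b' - b)) = (\<Sum>b'\<in>B. \<Sum>b\<in>B. \<Sum>\<theta>\<in>resid p. ft p \<Phi> \<theta> * ee p (\<theta> * (b' - b)))"
    using ft_inversion[OF assms] by simp
  also have "\<dots> = (\<Sum>\<theta>\<in>resid p. ft p \<Phi> \<theta> * ((\<Sum>b'\<in>B. ee p (\<theta> * b')) * cnj (\<Sum>b\<in>B. ee p (\<theta> * b))))"
  proof -
    have "ee p (\<theta> * (b' - b)) = ee p (\<theta> * b') * cnj (ee p (\<theta> * b))" for \<theta> b' b
      by (simp add: ee_diff right_diff_distrib)
    then have "(\<Sum>b'\<in>B. \<Sum>b\<in>B. \<Sum>\<theta>\<in>resid p. ft p \<Phi> \<theta> * ee p (\<theta> * (b' - b)))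
       = (\<Sum>b'\<in>B. \<Sum>b\<in>B. \<Sum>\<theta>\<in>resid p. ft p \<Phi> \<theta> * (ee p (\<theta> * b') * cnj (ee p (\<theta> * b))))"
      by simp
    also have "\<dots> = (\<Sum>\<theta>\<in>resid p. \<Sum>b'\<in>B. \<Sum>b\<in>B. ft p \<Phi> \<theta> * (ee p (\<theta> * b') * cnj (ee p (\<theta> * b))))"
      by (rule trans[OF sum.cong[OF refl sum.swap] sum.swap])
    finally show ?thesis
      by (simp only: sum_product cnj_sum) (simp only: sum_distrib_left)
  qed
  also have "\<dots> = (\<Sum>\<theta>\<in>resid p. ft p \<Phi> \<theta> * of_real ((norm (\<Sum>b\<in>B. ee p (\<theta> * b)))\<^sup>2))"
    by (simp only: complex_norm_square)
  also have "\<dots> = (\<Sum>\<theta>\<in>resid p. ft p \<Phi> (- \<theta>) * of_real ((norm (\<Sum>b\<in>B. ee p (- \<theta> * b)))\<^sup>2))"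
  proof -
    have "periodic p (\<lambda>\<theta>. ft p \<Phi> \<theta> * of_real ((norm (\<Sum>b\<in>B. ee p (\<theta> * b)))\<^sup>2))"
    proof (rule periodicI)
      fix x y assume "[x = y] (mod int p)"
      then have "ft p \<Phi> x = ft p \<Phi> y" "ee p (x * b) = ee p (y * b)" for b
        by (auto intro!: periodic_cong[OF periodic_ft] ee_cong cong_scalar_right)
      then show "ft p \<Phi> x * of_real ((norm (\<Sum>b\<in>B. ee p (x * b)))\<^sup>2) = ft p \<Phi> y * of_real ((norm (\<Sum>b\<in>B. ee p (y * b)))\<^sup>2)"
        by simp
    qed
    from sum_affine[OF assms(1) _ this, of "- 1" 0] show ?thesis by simp
  qed
  also have "\<dots> = (\<Sum>\<theta>\<in>resid p. of_real ((norm (\<Sum>b\<in>B. ee p (\<theta> * b)))\<^sup>2) * (\<Sum>d\<in>resid p. ee p (\<theta> * d) * \<Phi> d)) / of_nat p"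
  proof -
    have "norm (\<Sum>b\<in>B. ee p (- \<theta> * b)) = norm (\<Sum>b\<in>B. ee p (\<theta> * b))" for \<theta>
      by (simp add: ee_minus flip: cnj_sum)
    then show ?thesis by (simp add: ft_def mult_ac flip: sum_divide_distrib)
  qed
  finally show ?thesis .
qed

lemma msq_le_1: "(\<And>x. norm (F x) \<le> 1) \<Longrightarrow> msq p F \<le> 1"
proof -
  assume F: "\<And>x. norm (F x) \<le> 1"
  have "(\<Sum>x\<in>resid p. (norm (F x))\<^sup>2) \<le> (\<Sum>x\<in>resid p. 1)"
    by (intro sum_mono power_le_one F) simp
  then show ?thesis by (cases "p = 0") (simp_all add: msq_def)
qed

text \<open>Fourier expansion in the step reduces this to \<open>trilinear_ft_bound\<close> at each
  phase \<theta>. Compared with the trivial bound \<open>card B ^ 2 * p\<close>, the gain is \<eta>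
  and the loss is the inverse density of \<open>B\<close>.\<close>

lemma norm_tri_le_ft:
  assumes p: "prime p" and B: "B \<subseteq> resid p"
    and F: "periodic p F0" "periodic p F1" "periodic p F2"
    and F1: "\<And>x. norm (F1 x) \<le> 1" and F2: "\<And>x. norm (F2 x) \<le> 1"
    and a: "\<not> int p dvd a0 - a1" "\<not> int p dvd a0 - a2" "\<not> int p dvd a2 - a1"
    and \<eta>: "\<And>\<xi>. norm (ft p F0 \<xi>) \<le> \<eta>"
  shows "norm (tri p B a0 F0 a1 F1 a2 F2) \<le> real (card B) * (real p)\<^sup>2 * \<eta>"
proof -
  have p0: "p > 0" using p by (rule prime_gt_0_nat)
  have \<eta>0: "\<eta> \<ge> 0" using \<eta>[of 0] norm_ge_zero order_trans by blast
  define \<Phi> where "\<Phi> d = (\<Sum>x\<in>resid p. F0 (x + a0 * d) * F1 (x + a1 * d) * F2 (x + a2 * d))" for d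
  have per: "periodic p \<Phi>"
    unfolding \<Phi>_def
    by (intro periodicI sum.cong refl arg_cong2[of _ _ _ _ "(*)"] periodic_cong[OF F(1)]
        periodic_cong[OF F(2)] periodic_cong[OF F(3)] cong_add cong_mult cong_refl)
  have bound: "norm (\<Sum>d\<in>resid p. ee p (\<theta> * d) * \<Phi> d) \<le> (real p)\<^sup>2 * \<eta>" for \<theta>
  proof -
    have "(\<Sum>d\<in>resid p. ee p (\<theta> * d) * \<Phi> d)
        = (\<Sum>x\<in>resid p. \<Sum>d\<in>resid p. ee p (\<theta> * d) * F0 (x + a0 * d) * F1 (x + a1 * d) * F2 (x + a2 * d))"
      unfolding \<Phi>_def sum_distrib_left by (subst sum.swap) (simp add: mult.assoc)
    also have "norm \<dots> \<le> (real p)\<^sup>2 * \<eta> * sqrt (msq p F1) * sqrt (msq p F2)"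
      by (rule trilinear_ft_bound[OF p F a \<eta>])
    also have "\<dots> \<le> (real p)\<^sup>2 * \<eta> * 1 * 1"
      using \<eta>0 msq_le_1[OF F1] msq_le_1[OF F2] msq_nonneg by (intro mult_mono) auto
    finally show ?thesis by simp
  qed
  have "tri p B a0 F0 a1 F1 a2 F2 = (\<Sum>b\<in>B. \<Sum>b'\<in>B. \<Phi> (b - b'))"
    unfolding tri_def \<Phi>_def by (subst sum.swap, rule sum.cong[OF refl], rule sum.swap)
  also have "\<dots> = (\<Sum>\<theta>\<in>resid p. of_real ((norm (\<Sum>b\<in>B. ee p (\<theta> * b)))\<^sup>2) * (\<Sum>d\<in>resid p. ee p (\<theta> * d) * \<Phi> d)) / of_nat p"
    by (rule sum_differences[OF p0 per])
  also have "norm \<dots> \<le> (\<Sum>\<theta>\<in>resid p. (norm (\<Sum>b\<in>B. ee p (\<theta> * b)))\<^sup>2 * ((real p)\<^sup>2 * \<eta>)) / of_nat p"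
    unfolding norm_divide norm_of_nat
    by (intro divide_right_mono sum_norm_le) (simp_all add: norm_mult bound mult_left_mono norm_power)
  also have "\<dots> = real (card B) * (real p)\<^sup>2 * \<eta>"
    using sum_norm_ee_sum[OF p0 B] p0 by (simp add: sum_distrib_right[symmetric])
  finally show ?thesis .
qed

section \<open>Counting patterns in dense sets\<close>

text \<open>Let \<open>u\<close> be the third coefficient and \<open>v\<close> minus the second one
  of a three-variable equation with zero coefficient sum. Then \<open>d\<close> cancels, and the
  value of the form is the first coefficient times \<open>t\<close>. So \<open>t\<close> prescribes
  the right-hand side.\<close>

definition pattern_pairs :: "nat \<Rightarrow> int set \<Rightarrow> int \<Rightarrow> int \<Rightarrow> int \<Rightarrow> (int \<times> int) set" where
  "pattern_pairs p A t u v = {(x, d). x \<in> resid p \<and> d \<in> resid p \<and>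
     (x + t) mod int p \<in> A \<and> (x + u * d) mod int p \<in> A \<and> (x + v * d) mod int p \<in> A}"

lemma finite_bohr: "finite (bohr p Q \<epsilon>)"
  by (rule finite_subset[of _ "resid p"]) (auto simp: bohr_def)

lemma zero_in_bohr: "p > 0 \<Longrightarrow> \<epsilon> \<ge> 0 \<Longrightarrow> 0 \<in> bohr p Q \<epsilon>"
  by (simp add: bohr_def)

text \<open>On the nonnegative reals the cube lies above its tangent at \<open>m\<close>.\<close>

lemma sum_cube_ge:
  fixes g :: "'i \<Rightarrow> real" and m :: real
  assumes "finite I" "I \<noteq> {}" "\<And>i. i \<in> I \<Longrightarrow> g i \<ge> 0" "m \<ge> 0" "(\<Sum>i\<in>I. g i) \<ge> m * card I"
  shows "(\<Sum>i\<in>I. (g i) ^ 3) \<ge> m ^ 3 * card I"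
proof -
  have "(\<Sum>i\<in>I. (g i) ^ 3) \<ge> (\<Sum>i\<in>I. 3 * m\<^sup>2 * g i - 2 * m ^ 3)"
  proof (rule sum_mono)
    fix i assume "i \<in> I"
    then have "0 \<le> (g i - m)\<^sup>2 * (g i + 2 * m)" using assms by simp
    also have "\<dots> = g i ^ 3 - (3 * m\<^sup>2 * g i - 2 * m ^ 3)"
      by (simp add: power2_eq_square power3_eq_cube algebra_simps)
    finally show "3 * m\<^sup>2 * g i - 2 * m ^ 3 \<le> g i ^ 3" by simp
  qed
  moreover have "(\<Sum>i\<in>I. 3 * m\<^sup>2 * g i - 2 * m ^ 3) = 3 * m\<^sup>2 * (\<Sum>i\<in>I. g i) - 2 * m ^ 3 * card I"
    by (simp add: sum_subtractf sum_distrib_left)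
  moreover have "3 * m\<^sup>2 * (\<Sum>i\<in>I. g i) \<ge> 3 * m\<^sup>2 * (m * card I)"
    by (intro mult_left_mono assms) simp
  moreover have "3 * m\<^sup>2 * (m * card I) - 2 * m ^ 3 * card I = m ^ 3 * card I"
    by (simp add: power2_eq_square power3_eq_cube algebra_simps)
  ultimately show ?thesis by linarith
qed

lemma abs_mult3_diff_le:
  fixes a b c x :: real
  assumes "a \<in> {0..1}" "b \<in> {0..1}" "c \<in> {0..1}" "x \<in> {0..1}"
  shows "x ^ 3 - \<bar>a - x\<bar> - \<bar>b - x\<bar> - \<bar>c - x\<bar> \<le> a * b * c"
proof -
  have eq: "x ^ 3 - a * b * c = (x - a) * (x * x) + a * ((x - b) * x) + a * b * (x - c)"
    by (simp add: power3_eq_cube algebra_simps)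
  have "(x - a) * (x * x) \<le> \<bar>a - x\<bar> * 1"
    using assms by (intro mult_mono) (auto simp: mult_le_one)
  moreover have "a * ((x - b) * x) \<le> 1 * (\<bar>b - x\<bar> * 1)"
  proof -
    have "a * ((x - b) * x) \<le> \<bar>a * ((x - b) * x)\<bar>" by simp
    also have "\<dots> = a * (\<bar>b - x\<bar> * x)" using assms by (simp add: abs_mult abs_minus_commute)
    also have "\<dots> \<le> 1 * (\<bar>b - x\<bar> * 1)" using assms by (intro mult_mono) auto
    finally show ?thesis .
  qed
  moreover have "a * b * (x - c) \<le> 1 * \<bar>c - x\<bar>"
  proof -
    have "a * b * (x - c) \<le> \<bar>a * b * (x - c)\<bar>" by simp
    also have "\<dots> = a * b * \<bar>c - x\<bar>" using assms by (simp add: abs_mult abs_minus_commute)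
    also have "\<dots> \<le> 1 * \<bar>c - x\<bar>" using assms by (intro mult_right_mono mult_le_one) auto
    finally show ?thesis .
  qed
  ultimately have "x ^ 3 - a * b * c \<le> \<bar>a - x\<bar> * 1 + 1 * (\<bar>b - x\<bar> * 1) + 1 * \<bar>c - x\<bar>"
    unfolding eq by (intro add_mono)
  then show ?thesis by simp
qed

text \<open>The structured part of \<open>f\<close> is \<open>avg B0 f\<close>, where \<open>B0\<close> is the Bohr set of the \<open>\<eta>\<close>-large spectrum; the rest splits
  into a part that is small in mean square and a part with Fourier coefficients below \<open>2 \<eta>'\<close>. The latter is
  negligible only because \<open>\<eta>'\<close> is much smaller than the density of the Bohr set \<open>B\<close>, which is chosen after \<open>\<eta>\<close>.\<close>

lemma card_pattern_pairs_ge_aux: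
  fixes A :: "int set" and u v t :: int and \<alpha> \<tau> \<kappa> \<rho> \<eta> \<eta>' :: real
  assumes p: "prime p"
    and uv: "\<not> int p dvd u" "\<not> int p dvd v" "\<not> int p dvd u - v"
    and A: "A \<subseteq> resid p" "card A \<ge> \<alpha> * real p" and "\<alpha> > 0"
    and pos: "\<tau> > 0" "\<kappa> > 0" "\<rho> > 0" "\<eta>' \<ge> 0"
  defines "f \<equiv> (\<lambda>x. if x mod int p \<in> A then 1 else 0 :: complex)"
  defines "S \<equiv> {\<xi> \<in> resid p. \<eta> \<le> norm (ft p f \<xi>)}"
    and "S' \<equiv> {\<xi> \<in> resid p. \<eta>' \<le> norm (ft p f \<xi>)}"
  assumes energy: "(\<Sum>\<xi>\<in>S' - S. (norm (ft p f \<xi>))\<^sup>2) \<le> \<tau>\<^sup>2"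
  defines "B0 \<equiv> bohr p S \<tau>"
  defines "Q \<equiv> {\<xi> \<in> resid p. \<kappa> \<le> norm (avg_ft p B0 \<xi>)}"
  defines "B \<equiv> bohr p Q (\<rho> / (2 * real_of_int (max \<bar>u\<bar> \<bar>v\<bar>)))"
  assumes t: "\<And>\<xi>. \<xi> \<in> Q \<Longrightarrow> norm (ee p (\<xi> * t) - 1) \<le> \<rho>"
  shows "card (pattern_pairs p A t u v) \<ge> real (card B) * real p *
    (\<alpha> ^ 3 - 3 * sqrt (\<rho>\<^sup>2 + 4 * \<kappa>\<^sup>2) - 3 * (sqrt (5 * \<tau>\<^sup>2) + 2 * \<eta>' * real p / real (card B)))"
proof -
  have p0: "p > 0" using p by (rule prime_gt_0_nat)
  have u0: "u \<noteq> 0" using uv by auto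
  define M where "M = real_of_int (max \<bar>u\<bar> \<bar>v\<bar>)"
  have M0: "M > 0" unfolding M_def using u0 by simp
  have per_f: "periodic p f" by (simp add: periodic_def f_def)
  have f_le: "norm (f x) \<le> 1" for x by (simp add: f_def)
  have msq_f: "msq p f \<le> 1" using f_le by (rule msq_le_1)
  have B0: "B0 \<subseteq> resid p" "finite B0" "0 \<in> B0"
    unfolding B0_def using finite_bohr zero_in_bohr[OF p0] pos by (auto simp: bohr_def)
  have B: "B \<subseteq> resid p" "finite B" "0 \<in> B"
    unfolding B_def using finite_bohr zero_in_bohr[OF p0] pos M0 by (auto simp: bohr_def M_def)
  have cB0: "card B0 > 0" and cB: "card B > 0" using B0 B by (auto simp: card_gt_0_iff)
  define f1 where "f1 = avg B0 f"
  define g where "g x = Re (f1 x)" for x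
  have f1_g: "f1 x = of_real (g x)" and g01: "g x \<in> {0..1}" for x
  proof -
    have "f1 x = of_real ((\<Sum>b\<in>B0. if (x + b) mod int p \<in> A then 1 else 0) / card B0)"
      by (simp add: f1_def avg_def f_def if_distrib of_real_sum cong: if_cong)
    moreover from this have "g x = (\<Sum>b\<in>B0. if (x + b) mod int p \<in> A then 1 else 0) / card B0"
      by (simp add: g_def)
    moreover have "(\<Sum>b\<in>B0. if (x + b) mod int p \<in> A then 1 else 0) \<le> (\<Sum>b\<in>B0. 1::real)"
      by (rule sum_mono) simp
    moreover have "(\<Sum>b\<in>B0. if (x + b) mod int p \<in> A then 1 else 0) \<ge> (0::real)"
      by (rule sum_nonneg) simp
    ultimately show "f1 x = of_real (g x)" "g x \<in> {0..1}" using cB0 by simp_all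
  qed
  have f1_le: "norm (f1 x) \<le> 1" for x using g01[of x] by (simp add: f1_g)
  have per_f1: "periodic p f1" unfolding f1_def by (rule periodic_avg[OF per_f])
  have per_g: "periodic p g" using per_f1 by (simp add: periodic_def g_def)

  \<comment> \<open>Bounds the mean change of \<open>g\<close> under any shift that is almost
    trivial on \<open>Q\<close>, the frequencies that averaging over \<open>B0\<close> does not
    damp.\<close>
  define w where "w = sqrt (\<rho>\<^sup>2 + 4 * \<kappa>\<^sup>2)"
  have shift: "(\<Sum>x\<in>resid p. \<bar>g (x + h) - g x\<bar>) \<le> p * w"
    if h: "\<And>\<xi>. \<xi> \<in> Q \<Longrightarrow> norm (ee p (\<xi> * h) - 1) \<le> \<rho>" for h
  proof -
    have "(\<Sum>x\<in>resid p. norm (f1 (x + h) - f1 x)) / p \<le> sqrt (msq p (\<lambda>x. f1 (x + h) - f1 x))"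
      by (rule mean_norm_le_sqrt_msq[OF p0])
    also have "\<dots> \<le> w"
      unfolding w_def f1_def using h pos
      by (intro real_sqrt_le_mono msq_avg_shift_le p0 per_f msq_f) (auto simp: Q_def)
    finally have "(\<Sum>x\<in>resid p. norm (f1 (x + h) - f1 x)) \<le> p * w"
      using p0 by (simp add: divide_le_eq mult.commute)
    then show ?thesis by (simp add: f1_g flip: of_real_diff)
  qed
  \<comment> \<open>In the radius of \<open>B\<close>, the factor 2 pays for a difference of two
    elements and \<open>M\<close> for the multiplier \<open>u\<close> or \<open>v\<close>.\<close>
  have shiftB: "norm (ee p (\<xi> * (c * (b - b'))) - 1) \<le> \<rho>"
    if "b \<in> B" "b' \<in> B" "\<bar>real_of_int c\<bar> \<le> M" "\<xi> \<in> Q" for b b' c \<xi>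
  proof -
    have "norm (ee p (\<xi> * (b - b')) - 1) \<le> norm (ee p (\<xi> * b) - 1) + norm (ee p (- (\<xi> * b')) - 1)"
      using norm_ee_add_diff_1_le[of p "\<xi> * b" "- (\<xi> * b')"] by (simp add: right_diff_distrib)
    also have "\<dots> \<le> \<rho> / (2 * M) + \<rho> / (2 * M)"
      unfolding norm_ee_minus_diff_1 using that by (intro add_mono) (auto simp: B_def bohr_def M_def)
    finally have le: "norm (ee p (\<xi> * (b - b')) - 1) \<le> \<rho> / M" using M0 by (simp add: field_simps)
    have "norm (ee p (\<xi> * (c * (b - b'))) - 1) = norm (ee p (c * (\<xi> * (b - b'))) - 1)"
      by (simp add: mult_ac)
    also have "\<dots> \<le> \<bar>real_of_int c\<bar> * norm (ee p (\<xi> * (b - b')) - 1)"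
      by (rule norm_ee_mult_diff_1_le)
    also have "\<dots> \<le> M * (\<rho> / M)" using that le M0 by (intro mult_mono) auto
    finally show ?thesis using M0 by simp
  qed
  have uM: "\<bar>real_of_int u\<bar> \<le> M" "\<bar>real_of_int v\<bar> \<le> M" by (auto simp: M_def)

  have main: "Re (tri p B 0 (\<lambda>x. f1 (x + t)) u f1 v f1) \<ge> (card B)\<^sup>2 * p * (\<alpha> ^ 3 - 3 * w)"
  proof -
    have mean: "(\<Sum>x\<in>resid p. g x) \<ge> \<alpha> * card (resid p)"
    proof -
      have "(\<Sum>x\<in>resid p. f1 x) = (\<Sum>b\<in>B0. \<Sum>x\<in>resid p. f (x + b)) / card B0"
        unfolding f1_def avg_def sum_divide_distrib[symmetric] by (simp add: sum.swap[of _ B0])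
      also have "\<dots> = (\<Sum>x\<in>resid p. f x)"
        using sum_shift[OF p0 per_f] cB0 by simp
      also have "\<dots> = (\<Sum>x\<in>resid p. if x \<in> A then 1 else 0)"
        by (rule sum.cong) (auto simp: f_def)
      also have "\<dots> = of_nat (card (resid p \<inter> A))" by (simp add: sum.If_cases)
      also have "resid p \<inter> A = A" using A by blast
      finally have "complex_of_real (\<Sum>x\<in>resid p. g x) = of_real (card A)" by (simp add: f1_g)
      then have "(\<Sum>x\<in>resid p. g x) = card A" by (simp only: of_real_eq_iff)
      then show ?thesis using A by simp
    qed
    have cube: "(\<Sum>x\<in>resid p. g x ^ 3) \<ge> \<alpha> ^ 3 * p"
      using sum_cube_ge[OF _ _ _ _ mean] g01 p0 \<open>\<alpha> > 0\<close> by (auto simp: less_imp_le)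
    have "(\<Sum>x\<in>resid p. g (x + t) * g (x + u * (b - b')) * g (x + v * (b - b'))) \<ge> p * (\<alpha> ^ 3 - 3 * w)"
      if b: "b \<in> B" "b' \<in> B" for b b'
    proof -
      have "(\<Sum>x\<in>resid p. g (x + t) * g (x + u * (b - b')) * g (x + v * (b - b')))
          \<ge> (\<Sum>x\<in>resid p. g x ^ 3 - \<bar>g (x + t) - g x\<bar> - \<bar>g (x + u * (b - b')) - g x\<bar> - \<bar>g (x + v * (b - b')) - g x\<bar>)"
        by (intro sum_mono abs_mult3_diff_le g01)
      moreover have "(\<Sum>x\<in>resid p. \<bar>g (x + t) - g x\<bar>) \<le> p * w"
        by (rule shift) (rule t)
      moreover have "(\<Sum>x\<in>resid p. \<bar>g (x + u * (b - b')) - g x\<bar>) \<le> p * w"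
        by (rule shift) (rule shiftB[OF b uM(1)])
      moreover have "(\<Sum>x\<in>resid p. \<bar>g (x + v * (b - b')) - g x\<bar>) \<le> p * w"
        by (rule shift) (rule shiftB[OF b uM(2)])
      moreover have "p * (\<alpha> ^ 3 - 3 * w) = \<alpha> ^ 3 * p - p * w - p * w - p * w"
        by (simp add: algebra_simps)
      ultimately show ?thesis
        using cube unfolding sum_subtractf by linarith
    qed
    then have "(\<Sum>b\<in>B. \<Sum>b'\<in>B. \<Sum>x\<in>resid p. g (x + t) * g (x + u * (b - b')) * g (x + v * (b - b')))
        \<ge> (\<Sum>b\<in>B. \<Sum>b'\<in>B. p * (\<alpha> ^ 3 - 3 * w))" by (intro sum_mono)
    moreover have "tri p B 0 (\<lambda>x. f1 (x + t)) u f1 v f1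
        = of_real (\<Sum>b\<in>B. \<Sum>b'\<in>B. \<Sum>x\<in>resid p. g (x + t) * g (x + u * (b - b')) * g (x + v * (b - b')))"
      unfolding tri_def f1_g by (subst sum.swap, simp, rule sum.cong[OF refl], rule sum.swap)
    ultimately show ?thesis by (simp add: power2_eq_square mult_ac)
  qed

  \<comment> \<open>The Fourier coefficients of \<open>f - f1\<close>. They are split at size
    \<eta>' of the transform of \<open>f\<close> into \<open>G\<close> and \<open>H\<close>.\<close>
  define a where "a \<xi> = ft p f \<xi> * (1 - avg_ft p B0 \<xi>)" for \<xi>
  define G where "G x = (\<Sum>\<xi>\<in>S'. a \<xi> * ee p (\<xi> * x))" for x
  define H where "H x = (\<Sum>\<xi>\<in>resid p - S'. a \<xi> * ee p (\<xi> * x))" for x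
  have S'_sub: "S' \<subseteq> resid p" "finite S'"
    unfolding S'_def by (auto intro: finite_subset[of _ "resid p"])
  have split: "f x - f1 x = G x + H x" for x
  proof -
    have per: "periodic p (\<lambda>x. f x - f1 x)" using per_f per_f1 by (simp add: periodic_def)
    have "f x - f1 x = (\<Sum>\<xi>\<in>resid p. ft p (\<lambda>x. f x - f1 x) \<xi> * ee p (\<xi> * x))"
      by (rule ft_inversion[OF p0 per])
    also have "\<dots> = (\<Sum>\<xi>\<in>resid p. a \<xi> * ee p (\<xi> * x))"
      by (simp add: ft_diff a_def f1_def ft_avg[OF p0 per_f] algebra_simps)
    also have "\<dots> = G x + H x"
      unfolding G_def H_def using S'_sub by (subst sum.subset_diff[of S']) auto
    finally show ?thesis .
  qed
  have per_trig: "periodic p (\<lambda>x. \<Sum>\<xi>\<in>W. a \<xi> * ee p (\<xi> * x))" for W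
    by (intro periodicI sum.cong refl arg_cong2[of _ _ _ _ "(*)"] ee_cong cong_mult cong_refl)
  have per_G: "periodic p G" and per_H: "periodic p H"
    unfolding G_def H_def by (rule per_trig)+
  \<comment> \<open>At frequencies in \<open>S\<close> the multiplier of \<open>B0\<close> is within
    \<tau> of 1, so little is left after subtracting the average; the frequencies in
    \<open>S' - S\<close> carry little energy.\<close>
  have msq_G: "msq p G \<le> 5 * \<tau>\<^sup>2"
  proof -
    have "msq p G = (\<Sum>\<xi>\<in>S'. (norm (a \<xi>))\<^sup>2)"
      unfolding G_def by (rule msq_trig[OF p0 S'_sub(1)])
    also have "\<dots> \<le> (\<Sum>\<xi>\<in>S' \<inter> S. (norm (a \<xi>))\<^sup>2) + (\<Sum>\<xi>\<in>S' - S. (norm (a \<xi>))\<^sup>2)"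
      using S'_sub by (simp add: sum.Int_Diff[of S' _ S])
    also have "(\<Sum>\<xi>\<in>S' - S. (norm (a \<xi>))\<^sup>2) \<le> (\<Sum>\<xi>\<in>S' - S. 4 * (norm (ft p f \<xi>))\<^sup>2)"
    proof (rule sum_mono)
      fix \<xi>
      have "norm (1 - avg_ft p B0 \<xi>) \<le> 2"
        using norm_triangle_ineq4[of 1 "avg_ft p B0 \<xi>"] norm_avg_ft_le_1[of p B0 \<xi>] by simp
      then have "norm (a \<xi>) \<le> norm (ft p f \<xi>) * 2"
        unfolding a_def norm_mult by (intro mult_left_mono) auto
      then have "(norm (a \<xi>))\<^sup>2 \<le> (norm (ft p f \<xi>) * 2)\<^sup>2" by (intro power_mono) auto
      then show "(norm (a \<xi>))\<^sup>2 \<le> 4 * (norm (ft p f \<xi>))\<^sup>2" by (simp add: power_mult_distrib)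
    qed
    also have "\<dots> \<le> 4 * \<tau>\<^sup>2" using energy by (simp add: sum_distrib_left[symmetric])
    also have "(\<Sum>\<xi>\<in>S' \<inter> S. (norm (a \<xi>))\<^sup>2) \<le> (\<Sum>\<xi>\<in>resid p. \<tau>\<^sup>2 * (norm (ft p f \<xi>))\<^sup>2)"
    proof -
      have "(norm (a \<xi>))\<^sup>2 \<le> \<tau>\<^sup>2 * (norm (ft p f \<xi>))\<^sup>2" if "\<xi> \<in> S" for \<xi>
      proof -
        have "norm (1 - avg_ft p B0 \<xi>) \<le> \<tau>"
        proof (rule norm_avg_ft_diff_1_le)
          show "finite B0" "B0 \<noteq> {}" using B0 by auto
          show "norm (ee p (\<xi> * b) - 1) \<le> \<tau>" if "b \<in> B0" for b
            using that \<open>\<xi> \<in> S\<close> unfolding B0_def bohr_def by blast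
        qed
        then have "norm (a \<xi>) \<le> norm (ft p f \<xi>) * \<tau>"
          unfolding a_def norm_mult by (intro mult_left_mono) auto
        then have "(norm (a \<xi>))\<^sup>2 \<le> (norm (ft p f \<xi>) * \<tau>)\<^sup>2" by (intro power_mono) auto
        then show ?thesis by (simp add: power_mult_distrib mult.commute)
      qed
      then have "(\<Sum>\<xi>\<in>S' \<inter> S. (norm (a \<xi>))\<^sup>2) \<le> (\<Sum>\<xi>\<in>S' \<inter> S. \<tau>\<^sup>2 * (norm (ft p f \<xi>))\<^sup>2)"
        by (intro sum_mono) auto
      also have "\<dots> \<le> (\<Sum>\<xi>\<in>resid p. \<tau>\<^sup>2 * (norm (ft p f \<xi>))\<^sup>2)"
        using S'_sub by (intro sum_mono2) auto
      finally show ?thesis .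
    qed
    also have "\<dots> \<le> \<tau>\<^sup>2 * 1"
      unfolding sum_distrib_left[symmetric] parseval[OF p0 per_f] by (intro mult_left_mono msq_f) simp
    finally show ?thesis by simp
  qed
  have ft_H: "norm (ft p H \<xi>) \<le> 2 * \<eta>'" for \<xi>
  proof -
    have "norm (ft p H \<zeta>) \<le> 2 * \<eta>'" if "\<zeta> \<in> resid p" for \<zeta>
    proof (cases "\<zeta> \<in> S'")
      case True
      then show ?thesis
        unfolding H_def using ft_trig[OF p0 _ that, of "resid p - S'" a] pos by simp
    next
      case False
      then have "ft p H \<zeta> = a \<zeta>"
        unfolding H_def using ft_trig[OF p0 _ that, of "resid p - S'" a] that by simp
      moreover have "norm (ft p f \<zeta>) \<le> \<eta>'" using False that by (simp add: S'_def)
      moreover have "norm (1 - avg_ft p B0 \<zeta>) \<le> 2"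
        using norm_triangle_ineq4[of 1 "avg_ft p B0 \<zeta>"] norm_avg_ft_le_1[of p B0 \<zeta>] by simp
      ultimately have "norm (ft p H \<zeta>) \<le> \<eta>' * 2"
        unfolding a_def by (simp only: norm_mult) (intro mult_mono, auto simp: pos)
      then show ?thesis by simp
    qed
    from this[of "\<xi> mod int p"] show ?thesis
      using p0 periodic_ft[of p H] by (simp add: periodic_def)
  qed

  define E where "E = (card B)\<^sup>2 * p * sqrt (5 * \<tau>\<^sup>2) + card B * (real p)\<^sup>2 * (2 * \<eta>')"
  have err: "norm (tri p B a0 (\<lambda>x. f (x + h) - f1 (x + h)) a1 F1 a2 F2) \<le> E"
    if F: "periodic p F1" "periodic p F2" "\<And>x. norm (F1 x) \<le> 1" "\<And>x. norm (F2 x) \<le> 1"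
      and a: "\<not> int p dvd a0 - a1" "\<not> int p dvd a0 - a2" "\<not> int p dvd a2 - a1"
    for a0 a1 a2 h F1 F2
  proof -
    have "tri p B a0 (\<lambda>x. f (x + h) - f1 (x + h)) a1 F1 a2 F2
        = tri p B a0 (\<lambda>x. G (x + h)) a1 F1 a2 F2 + tri p B a0 (\<lambda>x. H (x + h)) a1 F1 a2 F2"
      unfolding split by (rule tri_add)
    also have "norm \<dots> \<le> norm (tri p B a0 (\<lambda>x. G (x + h)) a1 F1 a2 F2) + norm (tri p B a0 (\<lambda>x. H (x + h)) a1 F1 a2 F2)"
      by (rule norm_triangle_ineq)
    also have "norm (tri p B a0 (\<lambda>x. G (x + h)) a1 F1 a2 F2) \<le> (card B)\<^sup>2 * p * sqrt (5 * \<tau>\<^sup>2)"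
    proof -
      have "msq p (\<lambda>x. G (x + h)) = msq p G"
        unfolding msq_def using sum_shift[OF p0, of "\<lambda>x. (norm (G x))\<^sup>2" h] per_G by (simp add: periodic_def)
      moreover have "norm (tri p B a0 (\<lambda>x. G (x + h)) a1 F1 a2 F2)
          \<le> (card B)\<^sup>2 * p * sqrt (msq p (\<lambda>x. G (x + h)))"
        by (rule norm_tri_le_msq[OF p0 periodic_shift[OF per_G] F(3,4)])
      ultimately have "norm (tri p B a0 (\<lambda>x. G (x + h)) a1 F1 a2 F2) \<le> (card B)\<^sup>2 * p * sqrt (msq p G)"
        by simp
      also have "\<dots> \<le> (card B)\<^sup>2 * p * sqrt (5 * \<tau>\<^sup>2)"
        by (intro mult_left_mono real_sqrt_le_mono msq_G) simp
      finally show ?thesis .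
    qed
    also have "norm (tri p B a0 (\<lambda>x. H (x + h)) a1 F1 a2 F2) \<le> card B * (real p)\<^sup>2 * (2 * \<eta>')"
      by (rule norm_tri_le_ft[OF p B(1) periodic_shift[OF per_H] F a])
        (simp add: ft_shift[OF p0 per_H] norm_mult ft_H)
    finally show ?thesis unfolding E_def by simp
  qed

  let ?T = "tri p B 0 (\<lambda>x. f (x + t)) u f v f"
  have total: "Re ?T \<ge> (card B)\<^sup>2 * p * (\<alpha> ^ 3 - 3 * w) - 3 * E"
  proof -
    have uv': "\<not> int p dvd v - u" "\<not> int p dvd - u" "\<not> int p dvd - v"
      using uv by (simp_all add: dvd_diff_commute)
    have per: "periodic p (\<lambda>x. f1 (x + t))" "periodic p (\<lambda>x. f (x + t))"
      by (rule periodic_shift, fact)+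
    have e1: "norm (tri p B 0 (\<lambda>x. f (x + t) - f1 (x + t)) u f1 v f1) \<le> E"
      by (rule err) (use per_f1 f1_le uv uv' in auto)
    have e2: "norm (tri p B u (\<lambda>x. f (x + 0) - f1 (x + 0)) 0 (\<lambda>x. f (x + t)) v f1) \<le> E"
      by (rule err) (use per per_f1 f1_le f_le uv uv' in auto)
    have e3: "norm (tri p B v (\<lambda>x. f (x + 0) - f1 (x + 0)) 0 (\<lambda>x. f (x + t)) u f) \<le> E"
      by (rule err) (use per per_f f_le uv uv' in auto)
    \<comment> \<open>The factors are replaced by their averages one at a time, which leaves three
      error terms with \<open>f - f1\<close> in different places.\<close>
    have "?T = tri p B 0 (\<lambda>x. f1 (x + t)) u f1 v f1 + tri p B 0 (\<lambda>x. f (x + t) - f1 (x + t)) u f1 v f1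
        + tri p B u (\<lambda>x. f x - f1 x) 0 (\<lambda>x. f (x + t)) v f1
        + tri p B v (\<lambda>x. f x - f1 x) 0 (\<lambda>x. f (x + t)) u f"
      unfolding tri_diff
      by (simp add: tri_swap[of p B u] tri_rotate[of p B 0 _ u _ v])
    then have "Re ?T = Re (tri p B 0 (\<lambda>x. f1 (x + t)) u f1 v f1)
        + Re (tri p B 0 (\<lambda>x. f (x + t) - f1 (x + t)) u f1 v f1)
        + Re (tri p B u (\<lambda>x. f x - f1 x) 0 (\<lambda>x. f (x + t)) v f1)
        + Re (tri p B v (\<lambda>x. f x - f1 x) 0 (\<lambda>x. f (x + t)) u f)" by simp
    moreover have "- E \<le> Re z" if "norm z \<le> E" for z
      using that abs_Re_le_cmod[of z] by linarith
    note this[OF e1] this[OF e2[unfolded add_0_right]] this[OF e3[unfolded add_0_right]]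
    ultimately show ?thesis
      using main by linarith
  qed
  \<comment> \<open>For fixed \<open>b'\<close> the differences \<open>b - b'\<close> are distinct
    modulo \<open>p\<close>. So each pattern is counted at most once per \<open>b'\<close>, hence at
    most \<open>card B\<close> times.\<close>
  have count: "Re ?T \<le> real (card B) * card (pattern_pairs p A t u v)"
  proof -
    define X where "X d = {x \<in> resid p. (x + t) mod int p \<in> A \<and> (x + u * d) mod int p \<in> A \<and> (x + v * d) mod int p \<in> A}" for d
    have X_mod: "X (d mod int p) = X d" for d
    proof -
      have "(x + c * (d mod int p)) mod int p = (x + c * d) mod int p" for x c
        by (metis mod_add_right_eq mod_mult_right_eq)
      then show ?thesis unfolding X_def by simp
    qed
    have "?T = (\<Sum>b'\<in>B. \<Sum>b\<in>B. \<Sum>x\<in>resid p. f (x + 0 * (b - b') + t) * f (x + u * (b - b')) * f (x + v * (b - b')))"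
      unfolding tri_def
      by (rule trans[OF trans[OF sum.cong[OF refl sum.swap] sum.swap] sum.cong[OF refl sum.swap]])
    also have "\<dots> = (\<Sum>b'\<in>B. \<Sum>b\<in>B. of_nat (card (X (b - b'))))"
    proof (rule sum.cong[OF refl], rule sum.cong[OF refl])
      fix b b'
      have "(\<Sum>x\<in>resid p. f (x + 0 * (b - b') + t) * f (x + u * (b - b')) * f (x + v * (b - b')))
          = (\<Sum>x\<in>resid p. if x \<in> X (b - b') then 1 else 0)"
        by (rule sum.cong) (auto simp: f_def X_def)
      also have "\<dots> = of_nat (card (resid p \<inter> X (b - b')))" by (simp add: sum.If_cases)
      also have "resid p \<inter> X (b - b') = X (b - b')" by (auto simp: X_def)
      finally show "(\<Sum>x\<in>resid p. f (x + 0 * (b - b') + t) * f (x + u * (b - b')) * f (x + v * (b - b'))) = of_nat (card (X (b - b')))" .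
    qed
    finally have "?T = of_nat (\<Sum>b'\<in>B. \<Sum>b\<in>B. card (X (b - b')))" by simp
    then have "Re ?T = real (\<Sum>b'\<in>B. \<Sum>b\<in>B. card (X (b - b')))" by simp
    also have "(\<Sum>b'\<in>B. \<Sum>b\<in>B. card (X (b - b'))) \<le> (\<Sum>b'\<in>B. card (pattern_pairs p A t u v))"
    proof (rule sum_mono)
      fix b'
      have inj: "inj_on (\<lambda>b. (b - b') mod int p) B"
      proof (rule inj_onI)
        fix x y assume "x \<in> B" "y \<in> B" "(x - b') mod int p = (y - b') mod int p"
        then have "x \<in> resid p" "y \<in> resid p" "[x + - b' = y + - b'] (mod int p)" using B by (auto simp: cong_def)
        then have "[x = y] (mod int p)" by (simp only: cong_add_rcancel)
        then show "x = y" using \<open>x \<in> resid p\<close> \<open>y \<in> resid p\<close> by (simp add: cong_def)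
      qed
      have "(\<Sum>b\<in>B. card (X (b - b'))) = (\<Sum>b\<in>B. card (X ((b - b') mod int p)))" by (simp add: X_mod)
      also have "\<dots> = (\<Sum>d\<in>(\<lambda>b. (b - b') mod int p) ` B. card (X d))"
        by (simp add: sum.reindex[OF inj])
      also have "\<dots> \<le> (\<Sum>d\<in>resid p. card (X d))"
        using p0 by (intro sum_mono2) auto
      also have "\<dots> = card (SIGMA d:resid p. X d)" by (rule card_SigmaI[symmetric]) (auto simp: X_def intro: finite_subset[of _ "resid p"])
      also have "(SIGMA d:resid p. X d) = prod.swap ` pattern_pairs p A t u v"
        by (auto simp: X_def pattern_pairs_def)
      also have "card \<dots> = card (pattern_pairs p A t u v)" by (rule card_image) simp
      finally show "(\<Sum>b\<in>B. card (X (b - b'))) \<le> card (pattern_pairs p A t u v)" .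
    qed
    finally show ?thesis by simp
  qed
  have "real (card B) * (real (card B) * real p *
      (\<alpha> ^ 3 - 3 * w - 3 * (sqrt (5 * \<tau>\<^sup>2) + 2 * \<eta>' * real p / real (card B))))
      = (card B)\<^sup>2 * p * (\<alpha> ^ 3 - 3 * w) - 3 * E"
    using cB unfolding E_def by (simp add: power2_eq_square field_simps)
  also have "\<dots> \<le> real (card B) * card (pattern_pairs p A t u v)" using total count by linarith
  finally show ?thesis
    unfolding w_def using cB by (simp only: mult_le_cancel_left_pos of_nat_0_less_iff)
qed

lemma ex_nat_ge_two_pi_div:
  assumes "\<tau> > (0::real)"
  obtains n :: nat where "n > 0" "2 * pi / n \<le> \<tau>"
proof -
  obtain n :: nat where n: "2 * pi / \<tau> \<le> n" using real_arch_simple by blast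
  have "n > 0" using n assms by (metis divide_pos_pos gr0I mult_pos_pos not_le of_nat_0 pi_gt_zero zero_less_numeral)
  moreover from this have "2 * pi / n \<le> \<tau>" using n assms by (simp add: divide_le_eq mult.commute)
  ultimately show ?thesis using that by blast
qed

text \<open>The layers between consecutive sets are disjoint, so they cannot all carry more than
  \<delta>.\<close>

lemma ex_small_energy_step:
  fixes w :: "'i \<Rightarrow> real" and S :: "nat \<Rightarrow> 'i set" and J :: nat and \<delta> :: real
  assumes S: "\<And>j. S j \<subseteq> S (Suc j)" "\<And>j. S j \<subseteq> I" "finite I"
    and w: "\<And>i. w i \<ge> 0" "sum w I \<le> 1" and J: "J * \<delta> \<ge> 1" "\<delta> > 0"
  obtains j where "j < J" "sum w (S (Suc j) - S j) \<le> \<delta>"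
proof (rule ccontr)
  assume contra: "\<not> thesis"
  note thesisI = that
  \<comment> \<open>Strictness is tracked because \<open>J * \<delta>\<close> may be exactly
    1.\<close>
  have "sum w (S j) \<ge> j * \<delta> \<and> (j > 0 \<longrightarrow> sum w (S j) > j * \<delta>)" if "j \<le> J" for j
    using that
  proof (induction j)
    case 0
    then show ?case using w by (simp add: sum_nonneg)
  next
    case (Suc j)
    have "sum w (S (Suc j) - S j) > \<delta>"
      using contra thesisI[of j] Suc.prems by (meson Suc_le_eq not_le)
    moreover have "sum w (S (Suc j)) = sum w (S (Suc j) - S j) + sum w (S j)"
      using S(1) finite_subset[OF S(2) S(3)] by (intro sum.subset_diff)
    ultimately show ?case using Suc by (simp add: distrib_right)
  qed
  moreover have "J > 0" using J by (cases J) auto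
  ultimately have "sum w (S J) > J * \<delta>" by blast
  moreover have "sum w (S J) \<le> sum w I" using S w by (intro sum_mono2) auto
  ultimately show False using w J by linarith
qed

text \<open>The thresholds \<eta> form one decreasing sequence independent of \<open>p\<close> and
  \<open>A\<close>. Which consecutive pair has a gap of small energy depends on \<open>p\<close> and
  \<open>A\<close>, but it lies among the first \<open>J\<close> pairs, so extremes over these give
  uniform constants.\<close>

theorem ex_bohr_pattern_count:
  fixes u v :: int and \<alpha> :: real
  assumes uv: "u \<noteq> 0" "v \<noteq> 0" "u \<noteq> v" and \<alpha>: "\<alpha> > 0"
  obtains \<kappa> \<epsilon> :: real and K :: nat where "\<kappa> > 0" "\<epsilon> > 0"
    "\<And>p A. prime p \<Longrightarrow> int p > \<bar>u\<bar> + \<bar>v\<bar> \<Longrightarrow> A \<subseteq> resid p \<Longrightarrow> real (card A) \<ge> \<alpha> * real p \<Longrightarrow>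
      \<exists>Q. Q \<subseteq> resid p \<and> card Q \<le> K \<and> (\<forall>t. (\<forall>\<xi>\<in>Q. norm (ee p (\<xi> * t) - 1) \<le> \<epsilon>) \<longrightarrow>
        \<kappa> * (real p)\<^sup>2 \<le> real (card (pattern_pairs p A t u v)))"
proof -
  \<comment> \<open>Since \<open>sqrt 5 \<le> 5 / 2\<close>, these choices and the 48 below make the
    three errors at most 5/24, 5/48 and 1/8 of \<open>\<alpha> ^ 3\<close>, together less than half.
    The number \<open>r\<close> serves both as \<rho> and as \<kappa> of
    \<open>card_pattern_pairs_ge_aux\<close>.\<close>
  define r where "r = \<alpha> ^ 3 / 36"
  define \<tau> where "\<tau> = \<alpha> ^ 3 / 72"
  define M where "M = real_of_int (max \<bar>u\<bar> \<bar>v\<bar>)"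
  have pos: "r > 0" "\<tau> > 0" "M > 0" using \<alpha> uv by (auto simp: r_def \<tau>_def M_def)
  obtain n :: nat where n: "n > 0" "2 * pi / n \<le> \<tau>" using ex_nat_ge_two_pi_div pos by blast
  have "r / (2 * M) > 0" using pos by simp
  then obtain n1 :: nat where n1: "n1 > 0" "2 * pi / n1 \<le> r / (2 * M)" using ex_nat_ge_two_pi_div by blast
  \<comment> \<open>In terms of the threshold \<eta>: \<open>K0\<close> bounds the large spectrum of
    \<open>A\<close>, \<open>K1\<close> the large spectrum of its Bohr set, and \<open>b1\<close> is
    a lower bound for the density of the second Bohr set. The next threshold has to be small against
    this density.\<close>
  define K0 where "K0 \<eta> = nat \<lceil>1 / \<eta>\<^sup>2\<rceil>" for \<eta> :: real
  define K1 where "K1 \<eta> = nat \<lceil>real n ^ K0 \<eta> / r\<^sup>2\<rceil>" for \<eta>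
  define b1 where "b1 \<eta> = 1 / real n1 ^ K1 \<eta>" for \<eta>
  have b1_pos: "b1 \<eta> > 0" for \<eta> unfolding b1_def using n1 by simp
  define next_\<eta> where "next_\<eta> \<eta> = min \<eta> (\<alpha> ^ 3 / 48 * b1 \<eta>)" for \<eta>
  define \<eta> where "\<eta> j = (next_\<eta> ^^ j) 1" for j
  have \<eta>_Suc: "\<eta> (Suc j) \<le> \<eta> j" "\<eta> (Suc j) \<le> \<alpha> ^ 3 / 48 * b1 (\<eta> j)" for j
    by (simp_all add: \<eta>_def next_\<eta>_def)
  have \<eta>_pos: "\<eta> j > 0" for j
    by (induction j) (use \<alpha> b1_pos in \<open>simp_all add: \<eta>_def next_\<eta>_def\<close>)
  obtain J :: nat where J: "1 / \<tau>\<^sup>2 \<le> J" using real_arch_simple by blast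
  have J_pos: "J > 0" using J pos by (metis divide_pos_pos gr0I not_le of_nat_0 zero_less_one zero_less_power)
  have J1: "real J * \<tau>\<^sup>2 \<ge> 1" using J pos by (simp add: divide_le_eq)
  define \<kappa> where "\<kappa> = Min ((\<lambda>j. b1 (\<eta> j)) ` {..<J}) * (\<alpha> ^ 3 / 2)"
  define K where "K = Max ((\<lambda>j. K1 (\<eta> j)) ` {..<J})"
  have "Min ((\<lambda>j. b1 (\<eta> j)) ` {..<J}) \<in> (\<lambda>j. b1 (\<eta> j)) ` {..<J}"
    using J_pos by (intro Min_in) (auto simp: lessThan_empty_iff)
  then have "Min ((\<lambda>j. b1 (\<eta> j)) ` {..<J}) > 0" using b1_pos by auto
  then have "\<kappa> > 0" unfolding \<kappa>_def using \<alpha> by (intro mult_pos_pos) auto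
  moreover have "\<exists>Q. Q \<subseteq> resid p \<and> card Q \<le> K \<and> (\<forall>t. (\<forall>\<xi>\<in>Q. norm (ee p (\<xi> * t) - 1) \<le> r) \<longrightarrow>
        \<kappa> * (real p)\<^sup>2 \<le> real (card (pattern_pairs p A t u v)))"
    if p: "prime p" and p_large: "int p > \<bar>u\<bar> + \<bar>v\<bar>" and A: "A \<subseteq> resid p" "real (card A) \<ge> \<alpha> * real p" for p A
  proof -
    have p0: "p > 0" using p by (rule prime_gt_0_nat)
    have ndvd: "\<not> int p dvd c" if "c \<noteq> 0" "\<bar>c\<bar> \<le> \<bar>u\<bar> + \<bar>v\<bar>" for c
      using that p_large zdvd_not_zless[of "\<bar>c\<bar>" "int p"] by auto
    have uv': "\<not> int p dvd u" "\<not> int p dvd v" "\<not> int p dvd u - v"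
      using uv by (intro ndvd; simp)+
    let ?f = "\<lambda>x. if x mod int p \<in> A then 1 else 0 :: complex"
    have per: "periodic p ?f" by (simp add: periodic_def)
    define S where "S j = {\<xi> \<in> resid p. \<eta> j \<le> norm (ft p ?f \<xi>)}" for j
    have total: "(\<Sum>\<xi>\<in>resid p. (norm (ft p ?f \<xi>))\<^sup>2) \<le> 1"
      unfolding parseval[OF p0 per] by (rule msq_le_1) simp
    obtain j where j: "j < J" "(\<Sum>\<xi>\<in>S (Suc j) - S j. (norm (ft p ?f \<xi>))\<^sup>2) \<le> \<tau>\<^sup>2"
    proof (rule ex_small_energy_step[of S "resid p" "\<lambda>\<xi>. (norm (ft p ?f \<xi>))\<^sup>2" J "\<tau>\<^sup>2"])
      show "S j \<subseteq> S (Suc j)" for j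
        unfolding S_def using \<eta>_Suc(1)[of j] by auto
      show "S j \<subseteq> resid p" for j unfolding S_def by blast
    qed (use total J1 pos in auto)
    define B0 where "B0 = bohr p (S j) \<tau>"
    define Q where "Q = {\<xi> \<in> resid p. r \<le> norm (avg_ft p B0 \<xi>)}"
    define B where "B = bohr p Q (r / (2 * M))"
    have fin: "finite (S j)" "finite Q" unfolding S_def Q_def by (auto intro: finite_subset[of _ "resid p"])
    have "0 \<in> B0" unfolding B0_def using zero_in_bohr[OF p0, of \<tau> "S j"] pos by simp
    moreover have "finite B0" unfolding B0_def by (rule finite_bohr)
    ultimately have B0: "B0 \<noteq> {}" "card B0 > 0" by (auto simp: card_gt_0_iff)
    have B0_sub: "B0 \<subseteq> resid p" unfolding B0_def bohr_def by blast
    have "card (S j) * (\<eta> j)\<^sup>2 \<le> 1"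
    proof -
      have "card (S j) * (\<eta> j)\<^sup>2 = (\<Sum>\<xi>\<in>S j. (\<eta> j)\<^sup>2)" by simp
      also have "\<dots> \<le> (\<Sum>\<xi>\<in>S j. (norm (ft p ?f \<xi>))\<^sup>2)"
        using \<eta>_pos[of j] by (intro sum_mono power_mono) (auto simp: S_def)
      also have "\<dots> \<le> (\<Sum>\<xi>\<in>resid p. (norm (ft p ?f \<xi>))\<^sup>2)"
        by (intro sum_mono2) (auto simp: S_def)
      finally show ?thesis using total by linarith
    qed
    then have "real (card (S j)) \<le> 1 / (\<eta> j)\<^sup>2" using \<eta>_pos[of j] by (simp add: le_divide_eq)
    then have card_S: "card (S j) \<le> K0 (\<eta> j)" unfolding K0_def by linarith
    have "p \<le> n ^ card (S j) * card B0"
      unfolding B0_def by (rule card_bohr_ge[OF p0 n(1) fin(1) n(2)])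
    also have "\<dots> \<le> n ^ K0 (\<eta> j) * card B0"
      using n(1) card_S by (intro mult_right_mono power_increasing) auto
    finally have "real p \<le> real n ^ K0 (\<eta> j) * real (card B0)"
      by (metis of_nat_le_iff of_nat_mult of_nat_power)
    then have p_B0: "real p / real (card B0) \<le> real n ^ K0 (\<eta> j)"
      using B0(2) by (simp add: divide_le_eq)
    have "card Q * r\<^sup>2 \<le> real p / real (card B0)"
    proof -
      have "card Q * r\<^sup>2 = (\<Sum>\<xi>\<in>Q. r\<^sup>2)" by simp
      also have "\<dots> \<le> (\<Sum>\<xi>\<in>Q. (norm (avg_ft p B0 \<xi>))\<^sup>2)"
        using pos by (intro sum_mono power_mono) (auto simp: Q_def)
      also have "\<dots> \<le> (\<Sum>\<xi>\<in>resid p. (norm (avg_ft p B0 \<xi>))\<^sup>2)"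
        by (intro sum_mono2) (auto simp: Q_def)
      also have "\<dots> = real p / real (card B0)" by (rule sum_norm_avg_ft[OF p0 B0_sub B0(1)])
      finally show ?thesis .
    qed
    then have "card Q * r\<^sup>2 \<le> real n ^ K0 (\<eta> j)" using p_B0 by linarith
    then have "real (card Q) \<le> real n ^ K0 (\<eta> j) / r\<^sup>2" using pos by (simp add: le_divide_eq)
    then have card_Q: "card Q \<le> K1 (\<eta> j)" unfolding K1_def by linarith
    have "p \<le> n1 ^ card Q * card B"
      unfolding B_def by (rule card_bohr_ge[OF p0 n1(1) fin(2) n1(2)])
    also have "\<dots> \<le> n1 ^ K1 (\<eta> j) * card B"
      using n1(1) card_Q by (intro mult_right_mono power_increasing) auto
    finally have p_le: "real p \<le> real n1 ^ K1 (\<eta> j) * real (card B)"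
      by (metis of_nat_le_iff of_nat_mult of_nat_power)
    then have card_B: "b1 (\<eta> j) * real p \<le> real (card B)"
      unfolding b1_def using n1(1) by (simp add: divide_le_eq mult.commute)
    have B_pos: "real (card B) > 0" using card_B b1_pos[of "\<eta> j"] p0
      by (meson less_le_trans mult_pos_pos of_nat_0_less_iff)
    have frac: "\<eta> (Suc j) * real p / real (card B) \<le> \<alpha> ^ 3 / 48"
    proof -
      have "\<eta> (Suc j) * real p \<le> \<alpha> ^ 3 / 48 * b1 (\<eta> j) * real p"
        using \<eta>_Suc(2)[of j] by (intro mult_right_mono) auto
      also have "\<dots> = \<alpha> ^ 3 / 48 * (b1 (\<eta> j) * real p)" by simp
      also have "\<dots> \<le> \<alpha> ^ 3 / 48 * real (card B)"
        using card_B \<alpha> by (intro mult_left_mono) auto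
      finally show ?thesis using B_pos by (simp add: divide_le_eq)
    qed
    have sqrt5: "sqrt 5 \<le> 5 / 2" by (rule real_le_lsqrt) (simp_all add: power2_eq_square)
    have s1: "sqrt (r\<^sup>2 + 4 * r\<^sup>2) \<le> 5 / 2 * r" and s2: "sqrt (5 * \<tau>\<^sup>2) \<le> 5 / 2 * \<tau>"
    proof -
      have "sqrt (r\<^sup>2 + 4 * r\<^sup>2) = sqrt 5 * r" using pos by (simp add: real_sqrt_mult)
      then show "sqrt (r\<^sup>2 + 4 * r\<^sup>2) \<le> 5 / 2 * r" using sqrt5 pos by simp
      have "sqrt (5 * \<tau>\<^sup>2) = sqrt 5 * \<tau>" using pos by (simp add: real_sqrt_mult)
      then show "sqrt (5 * \<tau>\<^sup>2) \<le> 5 / 2 * \<tau>" using sqrt5 pos by simp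
    qed
    have "\<kappa> * (real p)\<^sup>2 \<le> real (card (pattern_pairs p A t u v))"
      if t: "\<forall>\<xi>\<in>Q. norm (ee p (\<xi> * t) - 1) \<le> r" for t
    proof -
      have "real (card B) * real p * (\<alpha> ^ 3 - 3 * sqrt (r\<^sup>2 + 4 * r\<^sup>2)
          - 3 * (sqrt (5 * \<tau>\<^sup>2) + 2 * \<eta> (Suc j) * real p / real (card B))) \<le> real (card (pattern_pairs p A t u v))"
        unfolding B_def Q_def B0_def S_def M_def
        by (rule card_pattern_pairs_ge_aux[OF p uv' A \<alpha> pos(2) pos(1) pos(1)])
          (use \<eta>_pos j(2) t in \<open>auto simp: S_def Q_def B0_def less_imp_le\<close>)
      moreover have "\<alpha> ^ 3 / 2 \<le> \<alpha> ^ 3 - 3 * sqrt (r\<^sup>2 + 4 * r\<^sup>2)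
          - 3 * (sqrt (5 * \<tau>\<^sup>2) + 2 * \<eta> (Suc j) * real p / real (card B))"
      proof -
        have "2 * \<eta> (Suc j) * real p / real (card B) = 2 * (\<eta> (Suc j) * real p / real (card B))" by simp
        moreover have "\<alpha> ^ 3 = 36 * r" "\<alpha> ^ 3 = 72 * \<tau>" by (simp_all add: r_def \<tau>_def)
        moreover have "a / 2 \<le> a - 3 * x - 3 * (y + 2 * z)"
          if "a = 36 * b" "a = 72 * c" "x \<le> 5 / 2 * b" "y \<le> 5 / 2 * c" "z \<le> a / 48" "b > 0" for a b c x y z :: real
          using that by argo
        ultimately show ?thesis using s1 s2 frac pos by metis
      qed
      moreover have "\<kappa> * (real p)\<^sup>2 \<le> real (card B) * real p * (\<alpha> ^ 3 / 2)"
      proof -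
        have "Min ((\<lambda>j. b1 (\<eta> j)) ` {..<J}) \<le> b1 (\<eta> j)" using j by (intro Min_le) auto
        then have "\<kappa> * (real p)\<^sup>2 \<le> b1 (\<eta> j) * (\<alpha> ^ 3 / 2) * (real p)\<^sup>2"
          unfolding \<kappa>_def using \<alpha> by (intro mult_right_mono) auto
        also have "\<dots> = b1 (\<eta> j) * real p * (real p * (\<alpha> ^ 3 / 2))" by (simp add: power2_eq_square)
        also have "\<dots> \<le> real (card B) * (real p * (\<alpha> ^ 3 / 2))"
          using card_B \<alpha> by (intro mult_right_mono) auto
        finally show ?thesis by (simp add: mult.assoc)
      qed
      moreover have "real (card B) * real p > 0" using B_pos p0 by simp
      ultimately show ?thesis
        by (meson mult_le_cancel_left_pos order_trans)
    qed
    moreover have "K1 (\<eta> j) \<le> K" unfolding K_def using j by (intro Max_ge) auto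
    ultimately show ?thesis
      using card_Q by (intro exI[of _ Q]) (auto simp: Q_def)
  qed
  ultimately show ?thesis using that pos(1) by blast
qed

section \<open>Robust solvability\<close>

lemma coprime_int_primeI: "prime p \<Longrightarrow> \<not> int p dvd u \<Longrightarrow> coprime u (int p)"
  using prime_imp_coprime[of "int p" u] by (simp add: coprime_commute)

lemma card_affine_preimage_le:
  assumes "p > 0" "coprime u (int p)" "finite D"
  shows "card {x \<in> resid p. (u * x + h) mod int p \<in> D} \<le> card D"
proof (rule card_inj_on_le)
  show "inj_on (\<lambda>x. (u * x + h) mod int p) {x \<in> resid p. (u * x + h) mod int p \<in> D}"
    using bij_betw_affine_mod[OF assms(1,2), of h] by (auto simp: bij_betw_def intro: inj_on_subset)
qed (use assms in auto)

lemma card_linear_form_le: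
  assumes p: "prime p" and "finite D" and ab: "\<not> int p dvd a \<or> \<not> int p dvd b"
  shows "card {(x, d). x \<in> resid p \<and> d \<in> resid p \<and> (a * x + b * d + h) mod int p \<in> D} \<le> card D * p"
proof -
  have p0: "p > 0" using p by (rule prime_gt_0_nat)
  have *: "card {(x, d). x \<in> resid p \<and> d \<in> resid p \<and> (b * x + a * d + h) mod int p \<in> D} \<le> card D * p"
    if "\<not> int p dvd a" for a b
  proof -
    have "{(x, d). x \<in> resid p \<and> d \<in> resid p \<and> (b * x + a * d + h) mod int p \<in> D}
        = (SIGMA x:resid p. {d \<in> resid p. (a * d + (b * x + h)) mod int p \<in> D})"
      by (auto simp: algebra_simps)
    also have "card \<dots> = (\<Sum>x\<in>resid p. card {d \<in> resid p. (a * d + (b * x + h)) mod int p \<in> D})"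
      by (rule card_SigmaI) (auto intro: finite_subset[of _ "resid p"])
    also have "\<dots> \<le> (\<Sum>x\<in>resid p. card D)"
      by (intro sum_mono card_affine_preimage_le p0 coprime_int_primeI p that assms)
    finally show ?thesis by (simp add: mult.commute)
  qed
  show ?thesis
  proof (cases "int p dvd b")
    case False
    then show ?thesis by (rule *)
  next
    case True
    then have "\<not> int p dvd a" using ab by blast
    have "{(x, d). x \<in> resid p \<and> d \<in> resid p \<and> (a * x + b * d + h) mod int p \<in> D}
        = prod.swap ` {(x, d). x \<in> resid p \<and> d \<in> resid p \<and> (b * x + a * d + h) mod int p \<in> D}"
      by (auto simp: algebra_simps image_iff)
    then show ?thesis
      using *[OF \<open>\<not> int p dvd a\<close>, of b] by (simp add: card_image)
  qed
qed

text \<open>The forbidden differences \<open>D\<close> are fixed before \<open>Q\<close>, the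
  forbidden elements \<open>E\<close> only after it. Indeed \<open>E\<close> will consist of
  elements of the Bohr set of \<open>Q\<close>, while \<open>D\<close> ensures distinctness and
  grows when variables are merged.\<close>

definition solvable_near :: "nat set \<Rightarrow> (nat \<Rightarrow> int) \<Rightarrow> nat \<Rightarrow> int set \<Rightarrow> int set \<Rightarrow> nat \<Rightarrow> int set \<Rightarrow> real \<Rightarrow> bool" where
  "solvable_near I c p A D M Q \<epsilon> \<longleftrightarrow>
     (\<forall>t E. (\<forall>\<xi>\<in>Q. norm (ee p (\<xi> * t) - 1) \<le> \<epsilon>) \<longrightarrow> finite E \<longrightarrow> card E \<le> M \<longrightarrow>
        (\<exists>x. (\<forall>i\<in>I. x i \<in> A \<and> x i \<notin> E) \<and> [(\<Sum>i\<in>I. c i * x i) = t] (mod int p) \<and>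
           (\<forall>i\<in>I. \<forall>j\<in>I. i \<noteq> j \<longrightarrow> (x i - x j) mod int p \<notin> D)))"

definition robustly_solvable :: "nat set \<Rightarrow> (nat \<Rightarrow> int) \<Rightarrow> bool" where
  "robustly_solvable I c \<longleftrightarrow> (\<forall>\<alpha>>0. \<forall>M. \<exists>K \<epsilon> p0. \<epsilon> > 0 \<and>
     (\<forall>p A D. prime p \<longrightarrow> p \<ge> p0 \<longrightarrow> A \<subseteq> resid p \<longrightarrow> real (card A) \<ge> \<alpha> * real p \<longrightarrow>
        finite D \<longrightarrow> card D \<le> M \<longrightarrow>
        (\<exists>Q. Q \<subseteq> resid p \<and> card Q \<le> K \<and> solvable_near I c p A D M Q \<epsilon>)))"

text \<open>The variables are \<open>x + t'\<close>, \<open>x + u * d\<close>,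
  \<open>x + v * d\<close> with \<open>u = c k\<close> and \<open>v = - c j\<close>, so that
  \<open>d\<close> cancels. The degenerate choices lie on at most \<open>9 * M\<close> lines,
  against quadratically many patterns.\<close>

lemma robustly_solvable_3:
  assumes I: "I = {i, j, k}" "i \<noteq> j" "i \<noteq> k" "j \<noteq> k"
    and c: "c i \<noteq> 0" "c j \<noteq> 0" "c k \<noteq> 0" "c i + c j + c k = 0"
  shows "robustly_solvable I c"
  unfolding robustly_solvable_def
proof (intro allI impI)
  fix \<alpha> :: real and M :: nat assume \<alpha>: "\<alpha> > 0"
  define u where "u = c k"
  define v where "v = - c j"
  have uv: "u \<noteq> 0" "v \<noteq> 0" "u \<noteq> v" "\<bar>u - v\<bar> \<le> \<bar>u\<bar> + \<bar>v\<bar> + \<bar>c i\<bar>"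
    "\<bar>v - u\<bar> \<le> \<bar>u\<bar> + \<bar>v\<bar> + \<bar>c i\<bar>"
    using c by (auto simp: u_def v_def)
  obtain \<kappa> \<epsilon> K where \<kappa>: "\<kappa> > 0" "\<epsilon> > 0" and count:
    "\<And>p A. prime p \<Longrightarrow> int p > \<bar>u\<bar> + \<bar>v\<bar> \<Longrightarrow> A \<subseteq> resid p \<Longrightarrow> real (card A) \<ge> \<alpha> * real p \<Longrightarrow>
      \<exists>Q. Q \<subseteq> resid p \<and> card Q \<le> K \<and> (\<forall>t. (\<forall>\<xi>\<in>Q. norm (ee p (\<xi> * t) - 1) \<le> \<epsilon>) \<longrightarrow>
        \<kappa> * (real p)\<^sup>2 \<le> real (card (pattern_pairs p A t u v)))"
    using ex_bohr_pattern_count[OF uv(1-3) \<alpha>] by metis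
  define p0 where "p0 = max (nat (\<bar>u\<bar> + \<bar>v\<bar> + \<bar>c i\<bar> + 1)) (nat \<lceil>9 * real M / \<kappa>\<rceil> + 1)"
  show "\<exists>K \<epsilon> p0. \<epsilon> > 0 \<and>
     (\<forall>p A D. prime p \<longrightarrow> p \<ge> p0 \<longrightarrow> A \<subseteq> resid p \<longrightarrow> real (card A) \<ge> \<alpha> * real p \<longrightarrow>
        finite D \<longrightarrow> card D \<le> M \<longrightarrow>
        (\<exists>Q. Q \<subseteq> resid p \<and> card Q \<le> K \<and> solvable_near I c p A D M Q \<epsilon>))"
  proof (rule exI[of _ K], rule exI[of _ \<epsilon>], rule exI[of _ p0], intro conjI allI impI \<kappa>(2))
    fix p :: nat and A D :: "int set"
    assume p: "prime p" "p0 \<le> p" and A: "A \<subseteq> resid p" "\<alpha> * real p \<le> real (card A)"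
      and D: "finite D" "card D \<le> M"
    have p_pos: "p > 0" using p prime_gt_0_nat by blast
    have p_large: "int p > \<bar>u\<bar> + \<bar>v\<bar> + \<bar>c i\<bar>" and p_\<kappa>: "9 * real M < \<kappa> * real p"
    proof -
      show "int p > \<bar>u\<bar> + \<bar>v\<bar> + \<bar>c i\<bar>" using p(2) unfolding p0_def by linarith
      have "9 * real M / \<kappa> < real p" using p(2) unfolding p0_def by linarith
      then show "9 * real M < \<kappa> * real p" using \<kappa>(1) by (simp add: divide_less_eq mult.commute)
    qed
    have ndvd: "\<not> int p dvd a" if "a \<noteq> 0" "\<bar>a\<bar> \<le> \<bar>u\<bar> + \<bar>v\<bar> + \<bar>c i\<bar>" for a
      using that p_large zdvd_not_zless[of "\<bar>a\<bar>" "int p"] by auto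
    have "coprime (c i) (int p)"
      by (rule coprime_int_primeI[OF p(1) ndvd]) (use c in auto)
    then obtain w where w: "[c i * w = 1] (mod int p)" using cong_solve_coprime_int by blast
    obtain Q where Q: "Q \<subseteq> resid p" "card Q \<le> K" and
      Qt: "\<And>t. (\<forall>\<xi>\<in>Q. norm (ee p (\<xi> * t) - 1) \<le> \<epsilon>) \<Longrightarrow> \<kappa> * (real p)\<^sup>2 \<le> real (card (pattern_pairs p A t u v))"
    proof -
      have "int p > \<bar>u\<bar> + \<bar>v\<bar>" using p_large by linarith
      then show ?thesis using count[OF p(1) _ A] that by blast
    qed
    \<comment> \<open>The shift in the pattern is \<open>w * t\<close>, with \<open>w\<close>
      inverse to \<open>c i\<close>; dilating the frequencies by \<open>w\<close> turns the
      condition on it into one on \<open>t\<close>.\<close>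
    define Q' where "Q' = (\<lambda>\<xi>. (\<xi> * w) mod int p) ` Q"
    have fin_Q: "finite Q" using Q(1) finite_subset by blast
    show "\<exists>Q. Q \<subseteq> resid p \<and> card Q \<le> K \<and> solvable_near I c p A D M Q \<epsilon>"
      unfolding solvable_near_def
    proof (intro exI[of _ Q'] conjI allI impI)
      show "Q' \<subseteq> resid p" unfolding Q'_def using p_pos by auto
      show "card Q' \<le> K" unfolding Q'_def using card_image_le[OF fin_Q] Q(2) by (meson order_trans)
      fix t :: int and E :: "int set" assume t: "\<forall>\<xi>\<in>Q'. norm (ee p (\<xi> * t) - 1) \<le> \<epsilon>" and E: "finite E" "card E \<le> M"
      define t' where "t' = w * t"
      have "norm (ee p (\<xi> * t') - 1) \<le> \<epsilon>" if "\<xi> \<in> Q" for \<xi>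
      proof -
        have "[(\<xi> * w) mod int p * t = \<xi> * w * t] (mod int p)" by (intro cong_mult cong_refl) (simp add: cong_def)
        then have "ee p ((\<xi> * w) mod int p * t) = ee p (\<xi> * t')" unfolding t'_def mult.assoc by (rule ee_cong)
        then show ?thesis using t that unfolding Q'_def by auto
      qed
      then have big: "\<kappa> * (real p)\<^sup>2 \<le> real (card (pattern_pairs p A t' u v))" using Qt by blast
      define L where "L a b h F = {(x, d). x \<in> resid p \<and> d \<in> resid p \<and> (a * x + b * d + h) mod int p \<in> F}" for a b h :: int and F
      have fin_L: "finite (L a b h F)" for a b h F
        by (rule finite_subset[of _ "resid p \<times> resid p"]) (auto simp: L_def)
      have L_D: "card (L 0 b h D) \<le> M * p" if "b \<noteq> 0" "\<bar>b\<bar> \<le> \<bar>u\<bar> + \<bar>v\<bar> + \<bar>c i\<bar>" for b h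
        using card_linear_form_le[OF p(1) D(1), of 0 b h] ndvd[OF that] D(2)
        by (simp add: L_def) (meson mult_le_mono1 order_trans)
      have L_E: "card (L 1 b h E) \<le> M * p" for b h
      proof -
        have "\<not> int p dvd 1" using p(1) prime_gt_1_nat[OF p(1)] by simp
        then show ?thesis
          using card_linear_form_le[OF p(1) E(1), of 1 b h] E(2)
          by (simp add: L_def) (meson mult_le_mono1 order_trans)
      qed
      \<comment> \<open>The six ordered differences of the three variables, none of which may fall
        into \<open>D\<close>, and the three variables themselves, which must avoid
        \<open>E\<close>.\<close>
      define \<B> where "\<B> = [L 0 (- u) t' D, L 0 u (- t') D, L 0 (- v) t' D, L 0 v (- t') D, L 0 (u - v) 0 D, L 0 (v - u) 0 D,
        L 1 0 t' E, L 1 u 0 E, L 1 v 0 E]"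
      have card_B: "card X \<le> M * p" if "X \<in> set \<B>" for X
        using that uv L_E unfolding \<B>_def by (auto intro!: L_D)
      have "card (\<Union>(set \<B>)) \<le> (\<Sum>X\<in>set \<B>. card X)" by (rule card_Union_le_sum_card)
      also have "\<dots> \<le> (\<Sum>X\<in>set \<B>. M * p)" by (intro sum_mono card_B)
      also have "\<dots> \<le> 9 * (M * p)"
      proof -
        have "card (set \<B>) \<le> length \<B>" by (rule card_length)
        also have "length \<B> = 9" by (simp add: \<B>_def)
        finally show ?thesis by simp
      qed
      finally have "real (card (\<Union>(set \<B>))) \<le> 9 * real M * real p"
        by (metis mult.assoc of_nat_le_iff of_nat_mult of_nat_numeral)
      also have "\<dots> < \<kappa> * real p * real p" using p_\<kappa> p_pos by simp
      also have "\<dots> \<le> real (card (pattern_pairs p A t' u v))" using big by (simp add: power2_eq_square)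
      finally have "\<not> pattern_pairs p A t' u v \<subseteq> \<Union>(set \<B>)"
        using card_mono[of "\<Union>(set \<B>)" "pattern_pairs p A t' u v"] fin_L
        unfolding \<B>_def by (auto simp: not_le)
      then obtain z where z: "z \<in> pattern_pairs p A t' u v" "z \<notin> \<Union>(set \<B>)" by blast
      obtain x d where "z = (x, d)" by (cases z)
      then have xd: "(x, d) \<in> pattern_pairs p A t' u v" "\<And>X. X \<in> set \<B> \<Longrightarrow> (x, d) \<notin> X"
        using z by auto
      have resid: "x \<in> resid p" "d \<in> resid p"
        and inA: "(x + t') mod int p \<in> A" "(x + u * d) mod int p \<in> A" "(x + v * d) mod int p \<in> A"
        using xd(1) by (auto simp: pattern_pairs_def)
      have avoid: "(a * x + b * d + h) mod int p \<notin> F" if "L a b h F \<in> set \<B>" for a b h F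
        using xd(2)[OF that] resid by (auto simp: L_def)
      define y where "y l = (if l = i then (x + t') mod int p else if l = j then (x + u * d) mod int p else (x + v * d) mod int p)" for l
      have y: "y i = (x + t') mod int p" "y j = (x + u * d) mod int p" "y k = (x + v * d) mod int p"
        using I by (auto simp: y_def)
      have "[(\<Sum>l\<in>I. c l * y l) = c i * (x + t') + c j * (x + u * d) + c k * (x + v * d)] (mod int p)"
      proof -
        have "(\<Sum>l\<in>I. c l * y l) = c i * y i + c j * y j + c k * y k" using I by simp
        also have "[\<dots> = c i * (x + t') + c j * (x + u * d) + c k * (x + v * d)] (mod int p)"
          unfolding y by (intro cong_add cong_mult cong_refl) (simp_all add: cong_def)
        finally show ?thesis .
      qed
      also have "c i * (x + t') + c j * (x + u * d) + c k * (x + v * d) = (c i + c j + c k) * x + (c i * w) * t"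
        by (simp add: u_def v_def t'_def algebra_simps)
      also have "[\<dots> = 0 * x + 1 * t] (mod int p)"
        unfolding c(4) by (intro cong_add cong_mult cong_refl w)
      finally have sum: "[(\<Sum>l\<in>I. c l * y l) = t] (mod int p)" by simp
      have diffs: "(y i - y j) mod int p \<notin> D" "(y j - y i) mod int p \<notin> D" "(y i - y k) mod int p \<notin> D"
        "(y k - y i) mod int p \<notin> D" "(y j - y k) mod int p \<notin> D" "(y k - y j) mod int p \<notin> D"
        using avoid[of 0 "- u" t' D] avoid[of 0 u "- t'" D] avoid[of 0 "- v" t' D] avoid[of 0 v "- t'" D]
          avoid[of 0 "u - v" 0 D] avoid[of 0 "v - u" 0 D]
        unfolding y \<B>_def by (simp_all add: mod_diff_eq left_diff_distrib)
      have "y i \<notin> E" "y j \<notin> E" "y k \<notin> E"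
        using avoid[of 1 0 t' E] avoid[of 1 u 0 E] avoid[of 1 v 0 E] unfolding y \<B>_def by simp_all
      then show "\<exists>x. (\<forall>i\<in>I. x i \<in> A \<and> x i \<notin> E) \<and> [(\<Sum>i\<in>I. c i * x i) = t] (mod int p) \<and>
               (\<forall>i\<in>I. \<forall>j\<in>I. i \<noteq> j \<longrightarrow> (x i - x j) mod int p \<notin> D)"
        using sum diffs inA I by (intro exI[of _ y]) (auto simp: y)
    qed
  qed
qed

text \<open>Fibres over \<open>N\<close> and fibres below the threshold together are too small to
  account for the whole set.\<close>

lemma ex_dense_fibre_outside:
  fixes X :: "int \<Rightarrow> int set"
  assumes "p > 0" "\<And>s. X s \<subseteq> resid p" "finite N" "real (card N) < \<kappa> / 2 * real p"
    and big: "real (card (SIGMA s:resid p. X s)) \<ge> \<kappa> * (real p)\<^sup>2"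
  obtains s where "s \<in> resid p" "s \<notin> N" "real (card (X s)) \<ge> \<kappa> / 2 * real p"
proof (rule ccontr)
  assume contra: "\<not> thesis"
  have small: "real (card (X s)) < \<kappa> / 2 * real p" if "s \<in> resid p - N" for s
    using contra that \<open>\<And>s. s \<in> resid p \<Longrightarrow> s \<notin> N \<Longrightarrow> \<kappa> / 2 * real p \<le> real (card (X s)) \<Longrightarrow> thesis\<close>
    by (meson DiffE not_le)
  have fin: "finite (X s)" for s using assms(2) finite_subset by blast
  have "card (X s) \<le> card (resid p)" for s by (rule card_mono) (simp_all add: assms(2))
  then have le_p: "card (X s) \<le> p" for s by simp
  have "real (card (SIGMA s:resid p. X s)) = (\<Sum>s\<in>resid p. real (card (X s)))"
    using fin by (subst card_SigmaI) auto
  also have "\<dots> = (\<Sum>s\<in>resid p \<inter> N. real (card (X s))) + (\<Sum>s\<in>resid p - N. real (card (X s)))"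
    by (simp add: sum.Int_Diff)
  also have "(\<Sum>s\<in>resid p \<inter> N. real (card (X s))) \<le> (\<Sum>s\<in>resid p \<inter> N. real p)"
    by (intro sum_mono) (simp add: le_p)
  also have "\<dots> \<le> real (card N) * real p"
    using assms(3) by (simp add: card_mono mult_right_mono)
  also have "\<dots> < \<kappa> / 2 * real p * real p"
    using assms(1,4) by simp
  also have "(\<Sum>s\<in>resid p - N. real (card (X s))) \<le> (\<Sum>s\<in>resid p - N. \<kappa> / 2 * real p)"
    by (intro sum_mono less_imp_le small)
  also have "\<dots> \<le> (\<Sum>s\<in>resid p. \<kappa> / 2 * real p)"
  proof (rule sum_mono2)
    have "0 \<le> real (card N)" by simp
    then have "0 \<le> \<kappa> / 2 * real p" using assms(4) by linarith
    then show "\<And>b. b \<in> resid p - (resid p - N) \<Longrightarrow> 0 \<le> \<kappa> / 2 * real p" by simp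
  qed auto
  finally have "real (card (SIGMA s:resid p. X s)) < \<kappa> * (real p)\<^sup>2"
    by (simp add: power2_eq_square)
  then show False using big by linarith
qed

text \<open>A variable \<open>y\<close> with coefficient \<open>c i + c j\<close> splits into
  \<open>y + c j * s\<close> and \<open>y - c i * s\<close>, without changing the sum. By the
  pattern count some \<open>s\<close> leaves a dense set \<open>X s\<close> of admissible
  \<open>y\<close>, and the hypothesis is applied to \<open>X s\<close> in place of
  \<open>A\<close>. The right-hand side is then handled by the hypothesis alone.\<close>

lemma robustly_solvable_merge:
  assumes I: "finite I" "i \<in> I" "j \<in> I" "i \<noteq> j"
    and c: "c i \<noteq> 0" "c j \<noteq> 0" "c i + c j \<noteq> 0"
    and IH: "robustly_solvable (I - {j}) (c(i := c i + c j))"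
  shows "robustly_solvable I c"
  unfolding robustly_solvable_def
proof (intro allI impI)
  fix \<alpha> :: real and M :: nat assume \<alpha>: "\<alpha> > 0"
  define u where "u = c j"
  define v where "v = - c i"
  have uv: "u \<noteq> 0" "v \<noteq> 0" "u \<noteq> v" using c by (auto simp: u_def v_def)
  obtain \<kappa> \<epsilon>0 K0 where \<kappa>: "\<kappa> > 0" "\<epsilon>0 > 0" and count:
    "\<And>p A. prime p \<Longrightarrow> int p > \<bar>u\<bar> + \<bar>v\<bar> \<Longrightarrow> A \<subseteq> resid p \<Longrightarrow> real (card A) \<ge> \<alpha> * real p \<Longrightarrow>
      \<exists>Q. Q \<subseteq> resid p \<and> card Q \<le> K0 \<and> (\<forall>t. (\<forall>\<xi>\<in>Q. norm (ee p (\<xi> * t) - 1) \<le> \<epsilon>0) \<longrightarrow>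
        \<kappa> * (real p)\<^sup>2 \<le> real (card (pattern_pairs p A t u v)))"
    using ex_bohr_pattern_count[OF uv \<alpha>] by metis
  have "\<kappa> / 2 > 0" using \<kappa> by simp
  \<comment> \<open>The exceptional sets are thickened below by the at most five elements of
    \<open>S\<close>.\<close>
  from IH[unfolded robustly_solvable_def, rule_format, OF this, of "5 * M"]
  obtain K \<epsilon> p1 where \<epsilon>: "\<epsilon> > 0" and step: "\<And>p A D. prime p \<Longrightarrow> p \<ge> p1 \<Longrightarrow> A \<subseteq> resid p \<Longrightarrow>
      real (card A) \<ge> \<kappa> / 2 * real p \<Longrightarrow> finite D \<Longrightarrow> card D \<le> 5 * M \<Longrightarrow>
      \<exists>Q. Q \<subseteq> resid p \<and> card Q \<le> K \<and> solvable_near (I - {j}) (c(i := c i + c j)) p A D (5 * M) Q \<epsilon>"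
    by blast
  define p0 where "p0 = max p1 (max (nat (\<bar>u\<bar> + \<bar>v\<bar> + 1)) (nat \<lceil>4 * real M / \<kappa>\<rceil> + 1))"
  show "\<exists>K \<epsilon> p0. \<epsilon> > 0 \<and>
     (\<forall>p A D. prime p \<longrightarrow> p \<ge> p0 \<longrightarrow> A \<subseteq> resid p \<longrightarrow> real (card A) \<ge> \<alpha> * real p \<longrightarrow>
        finite D \<longrightarrow> card D \<le> M \<longrightarrow>
        (\<exists>Q. Q \<subseteq> resid p \<and> card Q \<le> K \<and> solvable_near I c p A D M Q \<epsilon>))"
  proof (rule exI[of _ K], rule exI[of _ \<epsilon>], rule exI[of _ p0], intro conjI allI impI \<epsilon>)
    fix p :: nat and A D :: "int set"
    assume p: "prime p" "p0 \<le> p" and A: "A \<subseteq> resid p" "\<alpha> * real p \<le> real (card A)"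
      and D: "finite D" "card D \<le> M"
    have p_pos: "p > 0" using p prime_gt_0_nat by blast
    have p_large: "int p > \<bar>u\<bar> + \<bar>v\<bar>" "p \<ge> p1" using p(2) unfolding p0_def by linarith+
    have p_\<kappa>: "2 * real M < \<kappa> / 2 * real p"
    proof -
      have "4 * real M / \<kappa> < real p" using p(2) unfolding p0_def by linarith
      then show ?thesis using \<kappa>(1) by (simp add: divide_less_eq mult.commute)
    qed
    have ndvd: "\<not> int p dvd c i + c j"
      using c p_large zdvd_not_zless[of "\<bar>c i + c j\<bar>" "int p"] by (auto simp: u_def v_def)
    have big: "\<kappa> * (real p)\<^sup>2 \<le> real (card (pattern_pairs p A 0 u v))"
    proof -
      obtain Q where "\<And>t. (\<forall>\<xi>\<in>Q. norm (ee p (\<xi> * t) - 1) \<le> \<epsilon>0) \<Longrightarrow>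
          \<kappa> * (real p)\<^sup>2 \<le> real (card (pattern_pairs p A t u v))"
        using count[OF p(1) p_large(1) A] by blast
      from this[of 0] show ?thesis using \<kappa>(2) by simp
    qed
    \<comment> \<open>The first condition serves the variables that are not split, the other two the
      pair obtained by splitting.\<close>
    define X where "X s = {x \<in> resid p. (x + 0) mod int p \<in> A \<and> (x + u * s) mod int p \<in> A \<and> (x + v * s) mod int p \<in> A}" for s
    \<comment> \<open>The two halves of the split variable differ by \<open>(c i + c j) * s\<close>,
      which must avoid \<open>D\<close> in both orders.\<close>
    define N where "N = {s \<in> resid p. ((c i + c j) * s + 0) mod int p \<in> D} \<union> {s \<in> resid p. (- (c i + c j) * s + 0) mod int p \<in> D}"
    have "card N \<le> card D + card D"
    proof -
      have "\<not> int p dvd - (c i + c j)" using ndvd by (simp only: dvd_minus_iff not_False_eq_True)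
      then show ?thesis
        unfolding N_def using ndvd
        by (intro order_trans[OF card_Un_le] add_mono card_affine_preimage_le p_pos D coprime_int_primeI p)
    qed
    then have N_card: "real (card N) < \<kappa> / 2 * real p" using D(2) p_\<kappa> by linarith
    have N_fin: "finite N" unfolding N_def by (auto intro: finite_subset[of _ "resid p"])
    have "(SIGMA s:resid p. X s) = prod.swap ` pattern_pairs p A 0 u v"
      by (auto simp: X_def pattern_pairs_def)
    then have "card (SIGMA s:resid p. X s) = card (pattern_pairs p A 0 u v)" by (simp add: card_image)
    with big have big': "\<kappa> * (real p)\<^sup>2 \<le> real (card (SIGMA s:resid p. X s))" by simp
    have X_sub: "X s \<subseteq> resid p" for s unfolding X_def by blast
    obtain s where s: "s \<in> resid p" "s \<notin> N" "\<kappa> / 2 * real p \<le> real (card (X s))"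
      using ex_dense_fibre_outside[OF p_pos X_sub N_fin N_card big'] by blast
    define S where "S = {0, u * s, - (u * s), v * s, - (v * s)}"
    have fin_S: "finite S" and card_S: "card S \<le> 5"
    proof -
      show "finite S" by (simp add: S_def)
      have "S = set [0, u * s, - (u * s), v * s, - (v * s)]" by (simp add: S_def)
      then show "card S \<le> 5" using card_length[of "[0, u * s, - (u * s), v * s, - (v * s)]"] by simp
    qed
    define thicken where "thicken F = (\<Union>h\<in>S. (\<lambda>d. (d + h) mod int p) ` F)" for F
    have thicken: "finite (thicken F)" "card (thicken F) \<le> 5 * M" if F: "finite F" "card F \<le> M" for F
    proof -
      show "finite (thicken F)" unfolding thicken_def using fin_S F by blast
      have "card (thicken F) \<le> (\<Sum>h\<in>S. card ((\<lambda>d. (d + h) mod int p) ` F))"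
        unfolding thicken_def by (rule card_UN_le[OF fin_S])
      also have "\<dots> \<le> (\<Sum>h\<in>S. M)"
        by (intro sum_mono order_trans[OF card_image_le F(2)] F(1))
      also have "\<dots> \<le> 5 * M" using card_S by simp
      finally show "card (thicken F) \<le> 5 * M" .
    qed
    obtain Q where Q: "Q \<subseteq> resid p" "card Q \<le> K"
      and solve: "solvable_near (I - {j}) (c(i := c i + c j)) p (X s) (thicken D) (5 * M) Q \<epsilon>"
      using step[OF p(1) p_large(2) X_sub s(3) thicken[OF D]] by blast
    show "\<exists>Q. Q \<subseteq> resid p \<and> card Q \<le> K \<and> solvable_near I c p A D M Q \<epsilon>"
      unfolding solvable_near_def
    proof (intro exI[of _ Q] conjI allI impI Q)
      fix t :: int and E :: "int set"
      assume t: "\<forall>\<xi>\<in>Q. norm (ee p (\<xi> * t) - 1) \<le> \<epsilon>" and E: "finite E" "card E \<le> M"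
      obtain y where y: "\<And>l. l \<in> I - {j} \<Longrightarrow> y l \<in> X s" "\<And>l. l \<in> I - {j} \<Longrightarrow> y l \<notin> thicken E"
        and y_sum: "[(\<Sum>l\<in>I - {j}. (c(i := c i + c j)) l * y l) = t] (mod int p)"
        and y_diff: "\<And>l m. l \<in> I - {j} \<Longrightarrow> m \<in> I - {j} \<Longrightarrow> l \<noteq> m \<Longrightarrow> (y l - y m) mod int p \<notin> thicken D"
        using solve[unfolded solvable_near_def, rule_format, OF t[rule_format] thicken[OF E]] by blast
      define \<pi> where "\<pi> l = (if l = j then i else l)" for l
      define h where "h l = (if l = i then u * s else if l = j then v * s else 0)" for l
      define x where "x l = (y (\<pi> l) + h l) mod int p" for l
      have \<pi>: "\<pi> l \<in> I - {j}" if "l \<in> I" for l using that I by (simp add: \<pi>_def)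
      have thickenI: "(d + a) mod int p \<in> thicken F" if "d \<in> F" "a \<in> S" for d a F
        using that unfolding thicken_def by blast
      have x_A: "x l \<in> A" if "l \<in> I" for l
        using y(1)[OF \<pi>[OF that]] that unfolding x_def h_def X_def \<pi>_def by auto
      have x_E: "x l \<notin> E" if "l \<in> I" for l
      proof
        assume "x l \<in> E"
        moreover have "- h l \<in> S" unfolding S_def h_def by simp
        ultimately have "(x l + - h l) mod int p \<in> thicken E" by (rule thickenI)
        moreover have "(x l + - h l) mod int p = y (\<pi> l)"
        proof -
          have "[x l + - h l = y (\<pi> l) + h l + - h l] (mod int p)"
            unfolding x_def by (intro cong_add cong_refl) (simp add: cong_def)
          moreover have "y (\<pi> l) \<in> resid p" using y(1)[OF \<pi>[OF that]] X_sub by blast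
          ultimately show ?thesis by (simp add: cong_def)
        qed
        ultimately show False using y(2)[OF \<pi>[OF that]] by simp
      qed
      have x_diff: "(x l - x m) mod int p \<notin> D" if lm: "l \<in> I" "m \<in> I" "l \<noteq> m" for l m
      proof
        assume D_mem: "(x l - x m) mod int p \<in> D"
        have eq: "(x l - x m) mod int p = (y (\<pi> l) - y (\<pi> m) + (h l - h m)) mod int p"
        proof -
          have "[x l - x m = (y (\<pi> l) + h l) - (y (\<pi> m) + h m)] (mod int p)"
            unfolding x_def by (intro cong_diff) (simp_all add: cong_def)
          then show ?thesis by (simp add: cong_def algebra_simps)
        qed
        show False
        proof (cases "\<pi> l = \<pi> m")
          case False
          \<comment> \<open>Two variables with different origin cannot be \<open>i\<close> and
            \<open>j\<close>, so at most one of the two offsets is nonzero.\<close>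
          have "h m - h l \<in> S" using False unfolding S_def h_def \<pi>_def by auto
          with D_mem have "((x l - x m) mod int p + (h m - h l)) mod int p \<in> thicken D" by (rule thickenI)
          also have "((x l - x m) mod int p + (h m - h l)) mod int p = (y (\<pi> l) - y (\<pi> m)) mod int p"
            unfolding eq by (simp add: mod_simps)
          finally show False using y_diff[OF \<pi>[OF lm(1)] \<pi>[OF lm(2)] False] by simp
        next
          case True
          then have "l = i \<and> m = j \<or> l = j \<and> m = i" using lm(3) unfolding \<pi>_def by (auto split: if_splits)
          then have "(x l - x m) mod int p = ((c i + c j) * s + 0) mod int p
              \<or> (x l - x m) mod int p = (- (c i + c j) * s + 0) mod int p"
            unfolding eq using I(4) True by (auto simp: h_def u_def v_def algebra_simps)
          then show False using s D_mem unfolding N_def by auto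
        qed
      qed
      have x_sum: "[(\<Sum>l\<in>I. c l * x l) = t] (mod int p)"
      proof -
        have "[(\<Sum>l\<in>I. c l * x l) = (\<Sum>l\<in>I. c l * (y (\<pi> l) + h l))] (mod int p)"
          unfolding x_def by (intro cong_sum cong_mult cong_refl) (simp add: cong_def)
        also have "(\<Sum>l\<in>I. c l * (y (\<pi> l) + h l)) = (\<Sum>l\<in>I - {j}. (c(i := c i + c j)) l * y l)"
        proof -
          have "(\<Sum>l\<in>I. c l * (y (\<pi> l) + h l))
              = c j * (y i + v * s) + (c i * (y i + u * s) + (\<Sum>l\<in>I - {j} - {i}. c l * y l))"
          proof -
            have "(\<Sum>l\<in>I - {j} - {i}. c l * (y (\<pi> l) + h l)) = (\<Sum>l\<in>I - {j} - {i}. c l * y l)"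
              by (rule sum.cong) (auto simp: \<pi>_def h_def)
            then show ?thesis
              using I by (subst sum.remove[of I j], simp, simp, subst sum.remove[of "I - {j}" i]) (auto simp: \<pi>_def h_def)
          qed
          also have "c j * (y i + v * s) + (c i * (y i + u * s) + (\<Sum>l\<in>I - {j} - {i}. c l * y l))
              = (c i + c j) * y i + (\<Sum>l\<in>I - {j} - {i}. c l * y l)"
            by (simp add: u_def v_def algebra_simps)
          also have "\<dots> = (\<Sum>l\<in>I - {j}. (c(i := c i + c j)) l * y l)"
          proof -
            have "(\<Sum>l\<in>I - {j}. (c(i := c i + c j)) l * y l)
                = (c(i := c i + c j)) i * y i + (\<Sum>l\<in>I - {j} - {i}. (c(i := c i + c j)) l * y l)"
              by (rule sum.remove) (use I in auto)
            moreover have "(\<Sum>l\<in>I - {j} - {i}. (c(i := c i + c j)) l * y l) = (\<Sum>l\<in>I - {j} - {i}. c l * y l)"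
              by (rule sum.cong) auto
            ultimately show ?thesis by simp
          qed
          finally show ?thesis .
        qed
        finally show ?thesis using y_sum cong_trans by blast
      qed
      show "\<exists>x. (\<forall>i\<in>I. x i \<in> A \<and> x i \<notin> E) \<and> [(\<Sum>i\<in>I. c i * x i) = t] (mod int p) \<and>
               (\<forall>i\<in>I. \<forall>j\<in>I. i \<noteq> j \<longrightarrow> (x i - x j) mod int p \<notin> D)"
        using x_A x_E x_sum x_diff by blast
    qed
  qed
qed

text \<open>Merging needs two coefficients with nonzero sum. They exist among any three, since
  vanishing of all pairwise sums would make a coefficient zero. At size three no merge is made, as
  two variables would remain.\<close>

theorem robustly_solvable_zero_sum:
  assumes "card I \<ge> 3" "\<And>i. i \<in> I \<Longrightarrow> c i \<noteq> 0" "(\<Sum>i\<in>I. c i) = 0"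
  shows "robustly_solvable I c"
  using assms
proof (induction "card I" arbitrary: I c rule: less_induct)
  case less
  have fin: "finite I" using less.prems(1) by (metis card.infinite not_numeral_le_zero)
  obtain i j k where ijk: "i \<in> I" "j \<in> I" "k \<in> I" "i \<noteq> j" "i \<noteq> k" "j \<noteq> k"
  proof -
    obtain T where T: "T \<subseteq> I" "card T = 3" using obtain_subset_with_card_n[OF less.prems(1)] by metis
    from T(2) obtain a b d where "T = {a, b, d}" "a \<noteq> b" "a \<noteq> d" "b \<noteq> d"
      unfolding card_3_iff by metis
    then show ?thesis using T(1) by (intro that[of a b d]) auto
  qed
  show ?case
  proof (cases "card I = 3")
    case True
    have I: "I = {i, j, k}"
      using ijk True fin by (intro card_subset_eq[symmetric]) auto
    have "c i + c j + c k = 0" using less.prems(3) ijk unfolding I by simp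
    then show ?thesis
      by (intro robustly_solvable_3[OF I] less.prems(2) ijk)
  next
    case False
    have "\<exists>i\<in>I. \<exists>j\<in>I. i \<noteq> j \<and> c i + c j \<noteq> 0"
    proof (rule ccontr)
      assume "\<not> ?thesis"
      then have "c i + c j = 0" "c i + c k = 0" "c j + c k = 0" using ijk by blast+
      then have "c i = 0" by linarith
      then show False using less.prems(2) ijk by blast
    qed
    then obtain a b where ab: "a \<in> I" "b \<in> I" "a \<noteq> b" "c a + c b \<noteq> 0" by blast
    have "robustly_solvable (I - {b}) (c(a := c a + c b))"
    proof (rule less.hyps)
      show "card (I - {b}) < card I" using fin ab by (intro psubset_card_mono) auto
      show "3 \<le> card (I - {b})" using False less.prems(1) fin ab by simp
      show "(c(a := c a + c b)) l \<noteq> 0" if "l \<in> I - {b}" for l using that less.prems(2) ab by simp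
      have "(\<Sum>l\<in>I - {b}. (c(a := c a + c b)) l) = (c a + c b) + (\<Sum>l\<in>I - {b} - {a}. c l)"
      proof -
        have "(\<Sum>l\<in>I - {b}. (c(a := c a + c b)) l)
            = (c(a := c a + c b)) a + (\<Sum>l\<in>I - {b} - {a}. (c(a := c a + c b)) l)"
          by (rule sum.remove) (use fin ab in auto)
        moreover have "(\<Sum>l\<in>I - {b} - {a}. (c(a := c a + c b)) l) = (\<Sum>l\<in>I - {b} - {a}. c l)"
          by (rule sum.cong) auto
        ultimately show ?thesis by simp
      qed
      also have "\<dots> = (\<Sum>l\<in>I. c l)"
        using sum.remove[of I b c] sum.remove[of "I - {b}" a c] fin ab by simp
      finally show "(\<Sum>l\<in>I - {b}. (c(a := c a + c b)) l) = 0" using less.prems(3) by simp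
    qed
    then show ?thesis
      by (intro robustly_solvable_merge[OF fin ab(1-3)] less.prems(2) ab)
  qed
qed

section \<open>Bounded chromatic number\<close>

lemma cayley_chromatic_le: "cayley_colorable p A C \<Longrightarrow> cayley_chromatic p A \<le> C"
  unfolding cayley_chromatic_def by (rule Least_le)

lemma cayley_colorable_trivial: "cayley_colorable p A p"
  unfolding cayley_colorable_def by (intro exI[of _ nat]) auto

lemma cayley_colorable_bohr:
  assumes "p > 0" "n > 0" "finite Q" "A \<inter> bohr p Q (2 * pi / n) \<subseteq> {0}"
  shows "cayley_colorable p A (n ^ card Q)"
proof -
  obtain \<kappa> where \<kappa>: "\<And>x. \<kappa> x < n ^ card Q"
    "\<And>x y \<xi>. \<kappa> x = \<kappa> y \<Longrightarrow> \<xi> \<in> Q \<Longrightarrow> norm (ee p (\<xi> * (x - y)) - 1) \<le> 2 * pi / n"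
    using ex_bohr_cells[OF assms(1-3)] by blast
  have "\<kappa> u \<noteq> \<kappa> v" if uv: "u \<in> resid p" "v \<in> resid p" "u \<noteq> v" "(v - u) mod int p \<in> A" for u v
  proof
    assume eq: "\<kappa> u = \<kappa> v"
    have "norm (ee p (\<xi> * ((v - u) mod int p)) - 1) \<le> 2 * pi / n" if "\<xi> \<in> Q" for \<xi>
    proof -
      have "ee p (\<xi> * ((v - u) mod int p)) = ee p (\<xi> * (v - u))"
        by (intro ee_cong cong_mult cong_refl) (simp add: cong_def)
      then show ?thesis using \<kappa>(2)[OF eq[symmetric] that] by simp
    qed
    then have "(v - u) mod int p \<in> bohr p Q (2 * pi / n)" using assms(1) by (simp add: bohr_def)
    then have "(v - u) mod int p = 0" using assms(4) uv by blast
    then have "[v = u] (mod int p)" by (simp add: cong_iff_dvd_diff dvd_eq_mod_eq_0)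
    then show False using uv by (simp add: cong_def)
  qed
  then show ?thesis unfolding cayley_colorable_def using \<kappa>(1) by (intro exI[of _ \<kappa>]) auto
qed

text \<open>The frequency is chosen with \<open>\<xi> * a\<close> congruent to
  \<open>p div 2\<close>, which puts the character at an angle between \<open>pi / 2\<close> and
  \<open>pi\<close>. Adding it to a Bohr set of radius at most 1 expels \<open>a\<close>.\<close>

lemma ex_frequency_far_from_1:
  assumes p: "prime p" and "\<not> int p dvd a"
  obtains \<xi> where "norm (ee p (\<xi> * a) - 1) > 1"
proof -
  have p2: "p \<ge> 2" using p by (rule prime_ge_2_nat)
  obtain w where w: "[a * w = 1] (mod int p)"
    using cong_solve_coprime_int[OF coprime_int_primeI[OF p assms(2)]] by blast
  define h where "h = int p div 2"
  have h: "4 * h \<ge> int p" "2 * h \<le> int p" using p2 by (auto simp: h_def)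
  have "[(w * h) * a = 1 * h] (mod int p)"
    using cong_scalar_right[OF w, of h] by (simp add: mult_ac)
  then have "ee p ((w * h) * a) = ee p h" using ee_cong by fastforce
  moreover have "norm (ee p h - 1) > 1"
  proof -
    define \<phi> where "\<phi> = 2 * pi * of_int h / of_nat p"
    have "\<phi> \<ge> pi / 2"
    proof -
      have "real p \<le> 4 * real_of_int h" using h(1) by linarith
      then have "pi * real p \<le> pi * (4 * real_of_int h)" by (intro mult_left_mono) auto
      then show ?thesis using p2 by (simp add: \<phi>_def field_simps)
    qed
    moreover have "\<phi> \<le> pi"
    proof -
      have "2 * real_of_int h \<le> real p" using h(2) by linarith
      then have "pi * (2 * real_of_int h) \<le> pi * real p" by (intro mult_left_mono) auto
      then show ?thesis using p2 by (simp add: \<phi>_def field_simps)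
    qed
    ultimately have "cos \<phi> \<le> cos (pi / 2)" by (intro cos_monotone_0_pi_le) auto
    then have "cos \<phi> \<le> 0" by simp
    have "(norm (cis \<phi> - 1))\<^sup>2 = (cos \<phi> - 1)\<^sup>2 + (sin \<phi>)\<^sup>2" by (simp add: cmod_power2)
    also have "\<dots> = 2 - 2 * cos \<phi>"
      using sin_cos_squared_add[of \<phi>] by (simp add: power2_eq_square algebra_simps)
    finally have "(norm (cis \<phi> - 1))\<^sup>2 > 1\<^sup>2" using \<open>cos \<phi> \<le> 0\<close> by simp
    then have "norm (cis \<phi> - 1) > 1" by (rule power2_less_imp_less) simp
    then show ?thesis by (simp add: ee_def \<phi>_def)
  qed
  ultimately show ?thesis using that by metis
qed

text \<open>As long as few elements have been found, one extra frequency for each expels them all.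
  The enlarged frequency set is still too small for its cells to colour the graph, so a further
  element of \<open>A\<close> lies in the smaller Bohr set.\<close>

lemma ex_many_in_bohr:
  assumes p: "prime p" and A: "A \<subseteq> resid p" and n: "n > 0" "2 * pi / n \<le> 1"
    and Q: "finite Q" "card Q \<le> K" and large: "cayley_chromatic p A > n ^ (K + r)"
  shows "\<exists>F. finite F \<and> card F = Suc r \<and> F \<subseteq> A \<inter> bohr p Q (2 * pi / n)"
proof -
  have p0: "p > 0" using p by (rule prime_gt_0_nat)
  \<comment> \<open>The element 0 lies in every Bohr set and cannot be expelled, so the induction
    collects nonzero elements.\<close>
  have "\<exists>F. finite F \<and> card F = m \<and> F \<subseteq> (A \<inter> bohr p Q (2 * pi / n)) - {0}" if "m \<le> Suc r" for m
    using that
  proof (induction m)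
    case 0
    then show ?case by (intro exI[of _ "{}"]) simp
  next
    case (Suc m)
    then obtain F where F: "finite F" "card F = m" "F \<subseteq> (A \<inter> bohr p Q (2 * pi / n)) - {0}" by auto
    have "\<exists>\<xi>. norm (ee p (\<xi> * a) - 1) > 1" if "a \<in> F" for a
    proof -
      have "0 < a" "a < int p" using that F(3) A by force+
      then have "\<not> int p dvd a" by (simp add: zdvd_not_zless)
      then show ?thesis using ex_frequency_far_from_1[OF p] by blast
    qed
    then obtain \<xi> where \<xi>: "\<And>a. a \<in> F \<Longrightarrow> norm (ee p (\<xi> a * a) - 1) > 1" by metis
    define Q' where "Q' = Q \<union> \<xi> ` F"
    have fin: "finite Q'" using Q F by (simp add: Q'_def)
    have "card Q' \<le> card Q + card F"
      unfolding Q'_def by (intro order_trans[OF card_Un_le] add_left_mono card_image_le F)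
    then have "card Q' \<le> K + r" using Q F Suc.prems by simp
    have "\<not> (A \<inter> bohr p Q' (2 * pi / n) \<subseteq> {0})"
    proof
      assume "A \<inter> bohr p Q' (2 * pi / n) \<subseteq> {0}"
      then have "cayley_chromatic p A \<le> n ^ card Q'"
        by (intro cayley_chromatic_le cayley_colorable_bohr p0 n fin)
      also have "\<dots> \<le> n ^ (K + r)" using n \<open>card Q' \<le> K + r\<close> by (intro power_increasing) auto
      finally show False using large by simp
    qed
    then obtain a where a: "a \<in> A" "a \<in> bohr p Q' (2 * pi / n)" "a \<noteq> 0" by blast
    have "a \<notin> F"
    proof
      assume "a \<in> F"
      then have "norm (ee p (\<xi> a * a) - 1) \<le> 2 * pi / n" using a by (auto simp: bohr_def Q'_def)
      then show False using \<xi>[OF \<open>a \<in> F\<close>] n by linarith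
    qed
    moreover have "a \<in> bohr p Q (2 * pi / n)" using a by (simp add: bohr_def Q'_def)
    ultimately show ?case
      using a F by (intro exI[of _ "insert a F"]) auto
  qed
  from this[of "Suc r"] show ?thesis by blast
qed

theorem bounded_chromatic_if_zero_sum:
  fixes c :: "nat \<Rightarrow> int" and d :: real
  assumes k: "k \<ge> 3" and c: "\<forall>i\<in>{1..k}. c i \<noteq> 0"
    and I: "I \<subseteq> {1..k}" "card I \<ge> 3" "(\<Sum>i\<in>I. c i) = 0" and d: "d > 0"
  shows "\<exists>C :: nat. \<forall>p A. prime p \<longrightarrow> A \<subseteq> {0..<int p} \<longrightarrow> solution_free k c p A \<longrightarrow>
    real (card A) \<ge> d * real p \<longrightarrow> cayley_chromatic p A \<le> C"
proof -
  have finI: "finite I" using I(1) finite_subset by blast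
  have "robustly_solvable I c"
    by (rule robustly_solvable_zero_sum) (use c I in auto)
  from this[unfolded robustly_solvable_def, rule_format, OF d, of k]
  obtain K \<epsilon> p0 where \<epsilon>: "\<epsilon> > 0" and solve: "\<And>p A D. prime p \<Longrightarrow> p \<ge> p0 \<Longrightarrow> A \<subseteq> resid p \<Longrightarrow>
      real (card A) \<ge> d * real p \<Longrightarrow> finite D \<Longrightarrow> card D \<le> k \<Longrightarrow>
      \<exists>Q. Q \<subseteq> resid p \<and> card Q \<le> K \<and> solvable_near I c p A D k Q \<epsilon>"
    by blast
  define J where "J = {1..k} - I"
  \<comment> \<open>The total weight of the variables outside \<open>I\<close>, by which the radius
    is divided; the added 1 keeps it positive if there are none.\<close>
  define s where "s = 1 + (\<Sum>l\<in>J. \<bar>real_of_int (c l)\<bar>)"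
  have s: "s \<ge> 1" unfolding s_def by (simp add: sum_nonneg)
  have "min 1 (\<epsilon> / s) > 0" using \<epsilon> s by simp
  then obtain n :: nat where n: "n > 0" "2 * pi / n \<le> min 1 (\<epsilon> / s)"
    using ex_nat_ge_two_pi_div by blast
  \<comment> \<open>For primes below \<open>p0\<close> the trivial colouring by \<open>p\<close>
    colours suffices.\<close>
  define C where "C = max p0 (n ^ (K + k))"
  show ?thesis
  proof (rule exI[of _ C], intro allI impI, rule ccontr)
    fix p :: nat and A :: "int set"
    assume p: "prime p" and A: "A \<subseteq> {0..<int p}" and free: "solution_free k c p A"
      and dense: "d * real p \<le> real (card A)" and large: "\<not> cayley_chromatic p A \<le> C"
    have p_pos: "p > 0" using p by (rule prime_gt_0_nat)
    have "cayley_chromatic p A \<le> p" by (intro cayley_chromatic_le cayley_colorable_trivial)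
    then have "p0 \<le> p" using large unfolding C_def by linarith
    from solve[OF p this A dense, of "{0}"] k
    obtain Q where Q: "Q \<subseteq> resid p" "card Q \<le> K" and near: "solvable_near I c p A {0} k Q \<epsilon>" by auto
    have "finite Q" using Q finite_subset by blast
    have "cayley_chromatic p A > n ^ (K + k)" using large unfolding C_def by linarith
    moreover have "2 * pi / n \<le> 1" using n by simp
    ultimately obtain F where F: "finite F" "card F = Suc k" "F \<subseteq> A \<inter> bohr p Q (2 * pi / n)"
      using ex_many_in_bohr[OF p A n(1) _ \<open>finite Q\<close> Q(2), of k] by blast
    have "card J \<le> card F" unfolding J_def F(2) using card_Diff_subset[OF finI I(1)] by simp
    then obtain F' where F': "F' \<subseteq> F" "card F' = card J" using obtain_subset_with_card_n by metis
    have finF': "finite F'" using F' F finite_subset by blast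
    obtain a where a: "bij_betw a J F'"
      using finite_same_card_bij[OF _ finF' F'(2)[symmetric]] unfolding J_def by auto
    have aF: "a l \<in> A" "a l \<in> bohr p Q (2 * pi / n)" if "l \<in> J" for l
      using bij_betwE[OF a] that F F' by auto
    define t where "t = - (\<Sum>l\<in>J. c l * a l)"
    have t: "norm (ee p (\<xi> * t) - 1) \<le> \<epsilon>" if \<xi>: "\<xi> \<in> Q" for \<xi>
    proof -
      have "norm (ee p (\<xi> * t) - 1) = norm (ee p (\<Sum>l\<in>J. c l * (\<xi> * a l)) - 1)"
        using norm_ee_minus_diff_1[of p "\<Sum>l\<in>J. c l * (\<xi> * a l)"]
        by (simp add: t_def sum_distrib_left mult_ac)
      also have "\<dots> \<le> (\<Sum>l\<in>J. \<bar>real_of_int (c l)\<bar> * norm (ee p (\<xi> * a l) - 1))"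
        using norm_ee_sum_diff_le[of J p c "\<lambda>l. \<xi> * a l" "\<lambda>_. 0"] by (simp add: J_def)
      also have "\<dots> \<le> (\<Sum>l\<in>J. \<bar>real_of_int (c l)\<bar> * (\<epsilon> / s))"
      proof (intro sum_mono mult_left_mono)
        fix l assume "l \<in> J"
        then have "norm (ee p (\<xi> * a l) - 1) \<le> 2 * pi / n" using aF \<xi> by (auto simp: bohr_def)
        then show "norm (ee p (\<xi> * a l) - 1) \<le> \<epsilon> / s" using n by simp
      qed simp
      also have "\<dots> = (s - 1) * (\<epsilon> / s)" unfolding sum_distrib_right[symmetric] by (simp add: s_def)
      also have "\<dots> \<le> s * (\<epsilon> / s)" using s \<epsilon> by (intro mult_right_mono) auto
      finally show ?thesis using s by simp
    qed
    have "card F' \<le> k" unfolding F'(2) J_def using card_Diff_subset[OF finI I(1)] by simp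
    \<comment> \<open>Forbidding the difference 0 makes the variables in \<open>I\<close> distinct;
      forbidding \<open>F'\<close> separates them from those already placed.\<close>
    from near[unfolded solvable_near_def, rule_format, OF t finF' this]
    obtain x where x1: "\<forall>i\<in>I. x i \<in> A \<and> x i \<notin> F'"
      and x3: "[(\<Sum>i\<in>I. c i * x i) = t] (mod int p)"
      and x2: "\<forall>i\<in>I. \<forall>j\<in>I. i \<noteq> j \<longrightarrow> (x i - x j) mod int p \<notin> {0}"
      by blast
    define z where "z l = (if l \<in> I then x l else a l)" for l
    have "\<forall>l\<in>{1..k}. z l \<in> A" using x1 aF(1) by (auto simp: z_def J_def)
    moreover have "inj_on z {1..k}"
    proof (rule inj_onI)
      fix i j assume ij: "i \<in> {1..k}" "j \<in> {1..k}" "z i = z j"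
      have inF: "a l \<in> F'" if "l \<in> {1..k}" "l \<notin> I" for l
        using bij_betwE[OF a] that by (auto simp: J_def)
      show "i = j"
      proof (cases "i \<in> I"; cases "j \<in> I")
        assume "i \<in> I" "j \<in> I"
        then show ?thesis using x2[rule_format, of i j] ij by (cases "i = j") (auto simp: z_def)
      next
        assume "i \<in> I" "j \<notin> I"
        then show ?thesis using x1 inF[of j] ij by (auto simp: z_def)
      next
        assume "i \<notin> I" "j \<in> I"
        then show ?thesis using x1 inF[of i] ij by (auto simp: z_def)
      next
        assume "i \<notin> I" "j \<notin> I"
        then show ?thesis
          using bij_betw_imp_inj_on[OF a] ij by (auto simp: z_def J_def inj_on_def)
      qed
    qed
    moreover have "(\<Sum>i=1..k. c i * z i) mod int p = 0"
    proof -
      have "(\<Sum>i=1..k. c i * z i) = (\<Sum>i\<in>J. c i * z i) + (\<Sum>i\<in>I. c i * z i)"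
        unfolding J_def by (rule sum.subset_diff[OF I(1)]) simp
      also have "\<dots> = - t + (\<Sum>i\<in>I. c i * x i)"
        unfolding t_def by (simp add: z_def J_def)
      also have "[\<dots> = - t + t] (mod int p)" by (intro cong_add cong_refl x3)
      finally show ?thesis by (simp add: cong_def)
    qed
    ultimately have "\<not> solution_free k c p A"
      unfolding solution_free_def not_not by (intro exI[of _ z] conjI)
    then show False using free by contradiction
  qed
qed

section \<open>Exponential sums\<close>

lemma norm_cis_diff_le: "norm (cis a - cis b) \<le> \<bar>a - b\<bar>"
proof -
  have "cis a - cis b = cis b * (cis (a - b) - 1)" by (simp add: cis_mult right_diff_distrib)
  then have "norm (cis a - cis b) = norm (cis (a - b) - 1)" by (simp add: norm_mult)
  then show ?thesis using norm_cis_diff_1_le by simp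
qed

lemma norm_ee_diff_cis_le: "norm (ee p x - cis (2 * pi * a)) \<le> 2 * pi * \<bar>real_of_int x / real p - a\<bar>"
proof -
  have "norm (ee p x - cis (2 * pi * a)) \<le> \<bar>2 * pi * real_of_int x / real p - 2 * pi * a\<bar>"
    unfolding ee_def by (rule norm_cis_diff_le)
  also have "\<dots> = \<bar>2 * pi * (real_of_int x / real p - a)\<bar>" by (simp add: right_diff_distrib)
  also have "\<dots> = 2 * pi * \<bar>real_of_int x / real p - a\<bar>" by (simp add: abs_mult)
  finally show ?thesis .
qed

text \<open>The elements \<open>p div (P * R ^ i)\<close> are approximately dual to the frequencies \<open>R ^ j\<close>.\<close>

lemma norm_ee_dual_system:
  fixes P R :: nat
  assumes "P > 0" "R > 0" "P dvd R" "p > 0" "1 \<le> i" "i \<le> D" "j \<le> D"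
  shows "norm (ee p (int R ^ j * (int p div (int P * int R ^ i))) - (if i = j then ee P 1 else 1))
    \<le> 2 * pi / R + 2 * pi * real R ^ D / p"
proof -
  define q where "q = int P * int R ^ i"
  define b where "b = int p div q"
  define m where "m = int p mod q"
  have q0: "q > 0" using assms by (simp add: q_def)
  have m: "0 \<le> m" "m < q" "int p = q * b + m" using q0 by (simp_all add: m_def b_def)
  have b0: "b \<ge> 0" using q0 by (simp add: b_def pos_imp_zdiv_nonneg_iff)
  have R1: "real R \<ge> 1" using assms by simp
  have m_le: "real_of_int m \<le> real P * real R ^ i"
  proof -
    have "real_of_int m \<le> real_of_int q" using m by simp
    then show ?thesis by (simp add: q_def)
  qed
  have pos: "2 * pi / R \<ge> 0" "2 * pi * real R ^ D / p \<ge> 0" by simp_all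
  \<comment> \<open>The number \<open>R ^ j * b / p\<close> is about \<open>R ^ (j - i) / P\<close>:
    at most \<open>1 / R\<close> for smaller \<open>j\<close>, about \<open>1 / P\<close> for equal
    exponents, and near an integer for larger \<open>j\<close>, because \<open>P\<close> divides
    \<open>R\<close>.\<close>
  consider "j < i" | "j = i" | "i < j" by linarith
  then show ?thesis
  proof cases
    case 1
    have "norm (ee p (int R ^ j * b) - cis (2 * pi * 0)) \<le> 2 * pi * \<bar>real_of_int (int R ^ j * b) / real p - 0\<bar>"
      by (rule norm_ee_diff_cis_le)
    also have "\<bar>real_of_int (int R ^ j * b) / real p - 0\<bar> = real R ^ j * real_of_int b / real p"
      using b0 by simp
    also have "\<dots> \<le> 1 / real R"
    proof -
      have "real R ^ j * real R \<le> real R ^ i"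
        using power_increasing[of "Suc j" i "real R"] 1 R1 by (simp add: mult.commute)
      also have "\<dots> \<le> real P * real R ^ i" using assms by simp
      finally have "real R ^ j * real R * real_of_int b \<le> real P * real R ^ i * real_of_int b"
        using b0 by (intro mult_right_mono) auto
      also have "\<dots> = real_of_int (q * b)" by (simp add: q_def)
      also have "\<dots> \<le> real_of_int (int p)" using m by (subst of_int_le_iff) linarith
      finally have "real R ^ j * real R * real_of_int b \<le> real p" by simp
      then show ?thesis using assms by (simp add: field_simps)
    qed
    finally have "norm (ee p (int R ^ j * b) - 1) \<le> 2 * pi / real R" by simp
    then have "norm (ee p (int R ^ j * b) - 1) \<le> 2 * pi / R + 2 * pi * real R ^ D / p" using pos by linarith
    then show ?thesis using 1 by (simp add: b_def q_def)
  next
    case 2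
    have "norm (ee p (int R ^ j * b) - cis (2 * pi * (1 / real P)))
        \<le> 2 * pi * \<bar>real_of_int (int R ^ j * b) / real p - 1 / real P\<bar>"
      by (rule norm_ee_diff_cis_le)
    also have "real_of_int (int R ^ j * b) / real p - 1 / real P = - (real_of_int m / (real P * real p))"
    proof -
      have "int P * (int R ^ j * b) = int p - m" using m 2 by (simp add: q_def)
      then have "real P * real_of_int (int R ^ j * b) = real p - real_of_int m"
        by (metis of_int_diff of_int_mult of_int_of_nat_eq)
      then have eq: "real_of_int (int R ^ j * b) = (real p - real_of_int m) / real P"
        using assms by (simp add: field_simps)
      show ?thesis unfolding eq using assms by (simp add: diff_divide_distrib)
    qed
    also have "\<bar>- (real_of_int m / (real P * real p))\<bar> \<le> real R ^ D / p"
    proof -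
      have "real_of_int m \<le> real P * real R ^ D"
        using m_le power_increasing[OF assms(6) R1] assms(1)
        by (meson mult_left_mono of_nat_0_le_iff order_trans)
      then show ?thesis using m assms by (simp add: field_simps)
    qed
    finally have "norm (ee p (int R ^ j * b) - cis (2 * pi * (1 / real P))) \<le> 2 * pi * real R ^ D / p" by simp
    then have "norm (ee p (int R ^ j * b) - cis (2 * pi * (1 / real P))) \<le> 2 * pi / R + 2 * pi * real R ^ D / p"
      using pos by linarith
    then show ?thesis using 2 by (simp add: b_def q_def ee_def)
  next
    case 3
    obtain w where w: "R = P * w" using assms(3) by blast
    define W where "W = int w * int R ^ (j - i - 1)"
    have PW: "int P * W = int R ^ (j - i)"
      using 3 by (simp add: W_def w power_Suc[symmetric] mult_ac flip: of_nat_power of_nat_mult) (metis Suc_diff_Suc power_Suc mult.assoc)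
    have W0: "W \<ge> 0" by (simp add: W_def)
    have "int R ^ j * b = W * (q * b)"
    proof -
      have "int R ^ j = int R ^ (j - i) * int R ^ i" using 3 by (simp flip: power_add)
      then show ?thesis unfolding PW[symmetric] q_def by (simp add: mult_ac)
    qed
    also have "\<dots> = int p * W + - (W * m)" using m(3) by (simp add: algebra_simps)
    finally have "ee p (int R ^ j * b) = ee p (- (W * m))"
      by (intro ee_cong) (simp add: cong_iff_dvd_diff)
    then have "norm (ee p (int R ^ j * b) - 1) = norm (ee p (W * m) - cis (2 * pi * 0))"
      by (simp add: norm_ee_minus_diff_1)
    also have "\<dots> \<le> 2 * pi * \<bar>real_of_int (W * m) / real p - 0\<bar>" by (rule norm_ee_diff_cis_le)
    also have "\<bar>real_of_int (W * m) / real p - 0\<bar> = real_of_int W * real_of_int m / real p"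
      using W0 m by simp
    also have "\<dots> \<le> real R ^ D / p"
    proof -
      have "real_of_int W * real_of_int m \<le> real_of_int W * (real P * real R ^ i)"
        using m_le W0 by (intro mult_left_mono) auto
      also have "\<dots> = real_of_int (int P * W) * real R ^ i" by simp
      also have "\<dots> = real R ^ j" unfolding PW using 3 by (simp flip: power_add)
      also have "\<dots> \<le> real R ^ D" using assms R1 by (intro power_increasing) auto
      finally show ?thesis by (intro divide_right_mono) auto
    qed
    finally have "norm (ee p (int R ^ j * b) - 1) \<le> 2 * pi * real R ^ D / p" by simp
    then have "norm (ee p (int R ^ j * b) - 1) \<le> 2 * pi / R + 2 * pi * real R ^ D / p" using pos by linarith
    then show ?thesis using 3 by (simp add: b_def q_def)
  qed
qed

text \<open>As \<open>2 * R ^ m < R ^ (m + 1)\<close> for \<open>R\<close> at least 3, the larger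
  exponents on both sides agree and can be cancelled.\<close>

lemma sum_two_powers_eq:
  fixes R :: nat
  assumes R: "R \<ge> 3" and eq: "R ^ a + R ^ b = R ^ c + R ^ d"
  shows "a = c \<and> b = d \<or> a = d \<and> b = c"
proof -
  have max_le: "max a b \<le> max c d" if "R ^ a + R ^ b = R ^ c + R ^ d" for a b c d
  proof (rule ccontr)
    assume "\<not> max a b \<le> max c d"
    then have "Suc (max c d) \<le> max a b" by (simp only: not_le Suc_le_eq)
    then have "R ^ Suc (max c d) \<le> R ^ max a b" using R by (intro power_increasing) auto
    also have "\<dots> \<le> R ^ a + R ^ b" by (simp add: max_def)
    also have "\<dots> \<le> R ^ max c d + R ^ max c d"
      unfolding that using R by (intro add_mono power_increasing) auto
    finally have "R * R ^ max c d \<le> 2 * R ^ max c d" by (simp only: power_Suc mult_2)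
    moreover have "R ^ max c d > 0" using R by simp
    ultimately have "R \<le> 2" using mult_le_cancel2[of R "R ^ max c d" 2] by blast
    then show False using R by simp
  qed
  have mx: "max a b = max c d" by (intro antisym max_le eq eq[symmetric])
  have inj: "x = y" if "R ^ x = R ^ y" for x y
    by (rule power_inject_exp[THEN iffD1, OF _ that]) (use R in simp)
  from mx consider "a = c" | "a = d" | "b = c" | "b = d" by (auto simp: max_def split: if_splits)
  then show ?thesis
  proof cases
    case 1
    then show ?thesis using inj[of b d] eq by simp
  next
    case 2
    then show ?thesis using inj[of b c] eq by simp
  next
    case 3
    then show ?thesis using inj[of a d] eq by simp
  next
    case 4
    then show ?thesis using inj[of a c] eq by simp
  qed
qed

text \<open>Second and fourth moments: since sums of two powers of \<open>R\<close> determine the powers, the random variable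
  \<open>Z\<close> has typical size \<open>sqrt D\<close> (Paley--Zygmund).\<close>

lemma card_moderate_exponential_sum:
  fixes p R D :: nat and M :: int
  assumes p: "prime p" and R: "R \<ge> 3" and M: "\<not> int p dvd M" and p_large: "2 * R ^ D < p" and D: "D > 0"
  defines "Z \<equiv> (\<lambda>x. \<Sum>i\<in>{1..D}. ee p (M * int R ^ i * x))"
  shows "real (card {x \<in> resid p. D / 2 \<le> (norm (Z x))\<^sup>2 \<and> (norm (Z x))\<^sup>2 \<le> 16 * real D}) \<ge> 3 / 128 * real p"
proof -
  have p0: "p > 0" using p by (rule prime_gt_0_nat)
  define Y where "Y x = (norm (Z x))\<^sup>2" for x
  define r where "r i = int R ^ i" for i
  have Y_complex: "complex_of_real (Y x) = (\<Sum>a\<in>{1..D}. \<Sum>b\<in>{1..D}. ee p (M * (r a - r b) * x))" for x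
  proof -
    have "ee p (M * (r a - r b) * x) = ee p (M * r a * x) * cnj (ee p (M * r b * x))" for a b
      by (simp add: ee_diff[symmetric] algebra_simps)
    then show ?thesis
      unfolding Y_def Z_def complex_norm_square cnj_sum sum_product r_def by simp
  qed
  have dvd_iff: "int p dvd M * y \<longleftrightarrow> int p dvd y" for y
    using p M by (simp add: prime_dvd_mult_iff)
  have "complex_of_real (\<Sum>x\<in>resid p. Y x)
      = (\<Sum>a\<in>{1..D}. \<Sum>b\<in>{1..D}. \<Sum>x\<in>resid p. ee p (M * (r a - r b) * x))"
    unfolding of_real_sum Y_complex
    by (rule trans[OF sum.swap sum.cong[OF refl sum.swap]])
  also have "\<dots> = (\<Sum>a\<in>{1..D}. \<Sum>b\<in>{1..D}. of_real (if int p dvd r a - r b then real p else 0))"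
    by (intro sum.cong refl) (simp add: sum_ee[OF p0] dvd_iff)
  finally have "complex_of_real (\<Sum>x\<in>resid p. Y x)
      = of_real (\<Sum>a\<in>{1..D}. \<Sum>b\<in>{1..D}. if int p dvd r a - r b then real p else 0)"
    by (simp only: of_real_sum)
  then have "(\<Sum>x\<in>resid p. Y x) = (\<Sum>a\<in>{1..D}. \<Sum>b\<in>{1..D}. if int p dvd r a - r b then real p else 0)"
    by (simp only: of_real_eq_iff)
  also have "\<dots> \<ge> (\<Sum>a\<in>{1..D}. real p)"
  proof (rule sum_mono)
    fix a assume a: "a \<in> {1..D}"
    have "(\<Sum>b\<in>{a}. if int p dvd r a - r b then real p else 0) \<le> (\<Sum>b\<in>{1..D}. if int p dvd r a - r b then real p else 0)"
      using a by (intro sum_mono2) auto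
    then show "real p \<le> (\<Sum>b\<in>{1..D}. if int p dvd r a - r b then real p else 0)" by simp
  qed
  finally have second: "(\<Sum>x\<in>resid p. Y x) \<ge> real D * real p" by simp

  define I4 where "I4 = {1..D} \<times> {1..D} \<times> {1..D} \<times> {1..D}"
  define T where "T = {(a, b, c, d) \<in> I4. int p dvd (r a - r b) + (r c - r d)}"
  have "complex_of_real (\<Sum>x\<in>resid p. (Y x)\<^sup>2)
      = (\<Sum>x\<in>resid p. \<Sum>(a, b, c, d)\<in>I4. ee p (M * ((r a - r b) + (r c - r d)) * x))"
  proof -
    have "complex_of_real ((Y x)\<^sup>2) = (\<Sum>(a, b, c, d)\<in>I4. ee p (M * ((r a - r b) + (r c - r d)) * x))" for x
    proof -
      have e: "ee p (M * ((r a - r b) + (r c - r d)) * x) = ee p (M * (r a - r b) * x) * ee p (M * (r c - r d) * x)" for a b c d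
        by (simp add: ee_add[symmetric] algebra_simps)
      have "complex_of_real ((Y x)\<^sup>2)
          = (\<Sum>(a, b)\<in>{1..D} \<times> {1..D}. ee p (M * (r a - r b) * x)) * (\<Sum>(c, d)\<in>{1..D} \<times> {1..D}. ee p (M * (r c - r d) * x))"
        unfolding power2_eq_square of_real_mult Y_complex by (simp add: sum.cartesian_product)
      also have "\<dots> = (\<Sum>((a, b), (c, d))\<in>({1..D} \<times> {1..D}) \<times> ({1..D} \<times> {1..D}). ee p (M * ((r a - r b) + (r c - r d)) * x))"
        by (simp add: sum_product sum.cartesian_product e split_def)
      also have "\<dots> = (\<Sum>(a, b, c, d)\<in>I4. ee p (M * ((r a - r b) + (r c - r d)) * x))"
        unfolding I4_def
        by (rule sum.reindex_bij_witness[of _ "\<lambda>(a, b, c, d). ((a, b), (c, d))" "\<lambda>((a, b), (c, d)). (a, b, c, d)"]) auto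
      finally show ?thesis .
    qed
    then show ?thesis by (simp only: of_real_sum)
  qed
  also have "\<dots> = (\<Sum>(a, b, c, d)\<in>I4. \<Sum>x\<in>resid p. ee p (M * ((r a - r b) + (r c - r d)) * x))"
    by (subst sum.swap) (simp add: split_def)
  also have "\<dots> = (\<Sum>z\<in>I4. if z \<in> T then of_nat p else 0)"
    by (rule sum.cong) (auto simp: sum_ee[OF p0] dvd_iff T_def split: if_splits)
  also have "\<dots> = of_nat (card T * p)"
  proof -
    have "I4 \<inter> T = T" by (auto simp: T_def)
    then show ?thesis by (simp add: sum.If_cases I4_def)
  qed
  finally have "complex_of_real (\<Sum>x\<in>resid p. (Y x)\<^sup>2) = of_real (card T * p)" by simp
  then have fourth_eq: "(\<Sum>x\<in>resid p. (Y x)\<^sup>2) = card T * p" by (simp only: of_real_eq_iff)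
  have "T \<subseteq> (\<lambda>(a, b). (a, a, b, b)) ` ({1..D} \<times> {1..D}) \<union> (\<lambda>(a, b). (a, b, b, a)) ` ({1..D} \<times> {1..D})"
  proof
    fix z assume "z \<in> T"
    then obtain a b c d where z: "z = (a, b, c, d)" and mem: "a \<in> {1..D}" "b \<in> {1..D}" "c \<in> {1..D}" "d \<in> {1..D}"
      and dvd: "int p dvd (r a - r b) + (r c - r d)" by (auto simp: T_def I4_def)
    have r_le: "0 \<le> r i" "r i \<le> int (R ^ D)" if "i \<in> {1..D}" for i
    proof -
      show "0 \<le> r i" by (simp add: r_def)
      have "R ^ i \<le> R ^ D" using R that by (intro power_increasing) auto
      then have "int (R ^ i) \<le> int (R ^ D)" by (simp only: of_nat_le_iff)
      then show "r i \<le> int (R ^ D)" by (simp add: r_def)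
    qed
    \<comment> \<open>Both the positive and the negative part are at most \<open>2 * R ^ D\<close>,
      so a multiple of \<open>p\<close> must be 0 and the congruence is an equation.\<close>
    have "int (2 * R ^ D) < int p" using p_large by (simp only: of_nat_less_iff)
    then have "\<bar>(r a - r b) + (r c - r d)\<bar> < int p"
      using r_le[OF mem(1)] r_le[OF mem(2)] r_le[OF mem(3)] r_le[OF mem(4)] by simp
    then have "(r a - r b) + (r c - r d) = 0" using dvd by (metis abs_dvd_iff dvd_abs_iff zdvd_imp_le abs_ge_zero not_le zero_less_abs_iff)
    then have "int (R ^ a + R ^ c) = int (R ^ b + R ^ d)" by (simp add: r_def)
    then have "R ^ a + R ^ c = R ^ b + R ^ d" by (simp only: of_nat_eq_iff)
    then have "a = b \<and> c = d \<or> a = d \<and> c = b" by (rule sum_two_powers_eq[OF R])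
    then show "z \<in> (\<lambda>(a, b). (a, a, b, b)) ` ({1..D} \<times> {1..D}) \<union> (\<lambda>(a, b). (a, b, b, a)) ` ({1..D} \<times> {1..D})"
    proof
      assume "a = b \<and> c = d"
      then have "z \<in> (\<lambda>(a, b). (a, a, b, b)) ` ({1..D} \<times> {1..D})"
        using z mem by (intro image_eqI[of _ _ "(a, c)"]) simp_all
      then show ?thesis by blast
    next
      assume "a = d \<and> c = b"
      then have "z \<in> (\<lambda>(a, b). (a, b, b, a)) ` ({1..D} \<times> {1..D})"
        using z mem by (intro image_eqI[of _ _ "(a, b)"]) simp_all
      then show ?thesis by blast
    qed
  qed
  then have "card T \<le> card ((\<lambda>(a, b). (a, a, b, b)) ` ({1..D} \<times> {1..D}) \<union> (\<lambda>(a, b). (a, b, b, a)) ` ({1..D} \<times> {1..D}))"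
    by (intro card_mono) auto
  also have "\<dots> \<le> card ((\<lambda>(a, b). (a, a, b, b)) ` ({1..D} \<times> {1..D})) + card ((\<lambda>(a, b). (a, b, b, a)) ` ({1..D} \<times> {1..D}))"
    by (rule card_Un_le)
  also have "\<dots> \<le> card ({1..D} \<times> {1..D}) + card ({1..D} \<times> {1..D})"
    by (rule add_mono; rule card_image_le; simp)
  finally have "card T \<le> 2 * D * D" by simp
  then have "real (card T) \<le> real (2 * D * D)" by (simp only: of_nat_le_iff)
  then have "real (card T) \<le> 2 * (real D)\<^sup>2" by (simp add: power2_eq_square)
  then have fourth: "(\<Sum>x\<in>resid p. (Y x)\<^sup>2) \<le> 2 * (real D)\<^sup>2 * p"
    unfolding fourth_eq of_nat_mult by (intro mult_right_mono) auto

  define G where "G = {x \<in> resid p. D / 2 \<le> Y x \<and> Y x \<le> 16 * real D}"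
  have Y0: "Y x \<ge> 0" for x by (simp add: Y_def)
  \<comment> \<open>Averaging over the residues gives at least \<open>D\<close> on the left, and on
    the right at most \<open>D / 2\<close>, \<open>D / 8\<close> and \<open>16 * D\<close> times the
    density of \<open>G\<close>. Hence this density is at least (3/8)/16 = 3/128.\<close>
  have split: "Y x \<le> D / 2 + (Y x)\<^sup>2 / (16 * real D) + (if x \<in> G then 16 * real D else 0)" if x: "x \<in> resid p" for x
  proof -
    consider "Y x < D / 2" | "x \<in> G" | "Y x > 16 * real D" 
      using x linorder_not_less[of "Y x" "real D / 2"] linorder_not_less[of "16 * real D" "Y x"]
      unfolding G_def by auto
    then show ?thesis
    proof cases
      case 3
      then have "Y x * (16 * real D) \<le> Y x * Y x" using Y0 by (intro mult_left_mono) auto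
      then have "Y x \<le> (Y x)\<^sup>2 / (16 * real D)" using D by (simp add: le_divide_eq power2_eq_square)
      then show ?thesis by (simp add: add_increasing add_increasing2)
    next
      case 2
      then have "Y x \<le> 16 * real D" by (simp add: G_def)
      moreover have "0 \<le> real D / 2" "0 \<le> (Y x)\<^sup>2 / (16 * real D)" by simp_all
      moreover have "(if x \<in> G then 16 * real D else 0) = 16 * real D" using 2 by (rule if_P)
      ultimately show ?thesis by linarith
    next
      case 1
      have "0 \<le> (Y x)\<^sup>2 / (16 * real D)" "0 \<le> (if x \<in> G then 16 * real D else 0)" by simp_all
      then show ?thesis using 1 by linarith
    qed
  qed
  have "(\<Sum>x\<in>resid p. Y x)
      \<le> (\<Sum>x\<in>resid p. D / 2 + (Y x)\<^sup>2 / (16 * real D) + (if x \<in> G then 16 * real D else 0))"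
    by (rule sum_mono) (rule split)
  also have "\<dots> = (\<Sum>x\<in>resid p. real D / 2) + (\<Sum>x\<in>resid p. (Y x)\<^sup>2 / (16 * real D))
      + (\<Sum>x\<in>resid p. if x \<in> G then 16 * real D else 0)"
    by (simp only: sum.distrib)
  also have "(\<Sum>x\<in>resid p. real D / 2) = p * (real D / 2)" by simp
  also have "(\<Sum>x\<in>resid p. (Y x)\<^sup>2 / (16 * real D)) = (\<Sum>x\<in>resid p. (Y x)\<^sup>2) / (16 * real D)"
    by (rule sum_divide_distrib[symmetric])
  also have "\<dots> \<le> 2 * (real D)\<^sup>2 * p / (16 * real D)"
    using fourth by (intro divide_right_mono) auto
  also have "2 * (real D)\<^sup>2 * p / (16 * real D) = real D * (p / 8)"
    using D by (simp add: power2_eq_square)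
  also have "(\<Sum>x\<in>resid p. if x \<in> G then 16 * real D else 0) = 16 * real D * card G"
  proof -
    have "resid p \<inter> G = G" by (auto simp: G_def)
    then show ?thesis by (simp add: sum.If_cases)
  qed
  finally have "(\<Sum>x\<in>resid p. Y x) \<le> real D * (p / 2 + p / 8 + 16 * real (card G))"
    by (simp add: distrib_left mult_ac)
  then have "real D * real p \<le> real D * (p / 2 + p / 8 + 16 * real (card G))" by (rule order_trans[OF second])
  then have "real p \<le> p / 2 + p / 8 + 16 * real (card G)" using D by (simp only: mult_le_cancel_left_pos of_nat_0_less_iff)
  then have "3 / 128 * real p \<le> real (card G)" by simp
  then show ?thesis by (simp only: G_def Y_def)
qed

lemma ex_large_fibre:
  assumes "finite G" "f ` G \<subseteq> T" "finite T" "T \<noteq> {}"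
  obtains y where "y \<in> T" "card G \<le> card T * card {x \<in> G. f x = y}"
proof -
  define m where "m = Max ((\<lambda>y. card {x \<in> G. f x = y}) ` T)"
  have "m \<in> (\<lambda>y. card {x \<in> G. f x = y}) ` T" unfolding m_def using assms by (intro Max_in) auto
  then obtain y where y: "y \<in> T" "m = card {x \<in> G. f x = y}" by blast
  have "card G = card (\<Union>y\<in>T. {x \<in> G. f x = y})" using assms(2) by (intro arg_cong[of _ _ card]) auto
  also have "\<dots> \<le> (\<Sum>y\<in>T. card {x \<in> G. f x = y})" by (rule card_UN_le[OF assms(3)])
  also have "\<dots> \<le> (\<Sum>y\<in>T. m)" unfolding m_def using assms by (intro sum_mono Max_ge) auto
  finally have "card G \<le> card T * m" by simp
  then show ?thesis using that y by simp
qed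

lemma ex_ee_gap:
  assumes "P > 0"
  obtains \<gamma> :: real where "\<gamma> > 0" "\<And>m. \<not> int P dvd m \<Longrightarrow> norm (ee P m - 1) \<ge> \<gamma>"
proof -
  define \<gamma> where "\<gamma> = Min (insert 1 ((\<lambda>m. norm (ee P m - 1)) ` {m \<in> resid P. \<not> int P dvd m}))"
  have fin: "finite (insert 1 ((\<lambda>m. norm (ee P m - 1)) ` {m \<in> resid P. \<not> int P dvd m}))"
  proof -
    have "finite {m \<in> resid P. \<not> int P dvd m}" by (rule finite_subset[of _ "resid P"]) auto
    then show ?thesis by (intro finite.insertI finite_imageI)
  qed
  have "\<gamma> \<in> insert 1 ((\<lambda>m. norm (ee P m - 1)) ` {m \<in> resid P. \<not> int P dvd m})"
    unfolding \<gamma>_def by (rule Min_in[OF fin]) simp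
  moreover have "norm (ee P m - 1) > 0" if "\<not> int P dvd m" for m
    using that ee_eq_1_iff[OF assms, of m] by simp
  ultimately have "\<gamma> > 0" by force
  moreover have "norm (ee P m - 1) \<ge> \<gamma>" if "\<not> int P dvd m" for m
  proof -
    have "\<not> int P dvd m mod int P" using that by (simp add: dvd_mod_iff)
    moreover have "m mod int P \<in> resid P" using assms by simp
    ultimately have "\<gamma> \<le> norm (ee P (m mod int P) - 1)"
      unfolding \<gamma>_def by (intro Min_le fin insertI2 imageI CollectI conjI)
    moreover have "ee P (m mod int P) = ee P m" by (rule ee_cong) (simp add: cong_def)
    ultimately show ?thesis by simp
  qed
  ultimately show ?thesis using that by blast
qed

section \<open>Dense solution-free sets of large chromatic number\<close>

text \<open>\<open>M\<close> will be a common multiple of the coefficients. When two variables with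
  coefficients \<open>c i\<close> and \<open>- c i\<close> come from the dense set, the equation is
  multiplied by \<open>M div c i\<close>, so the same sum serves for every \<open>i\<close>.\<close>

definition exp_sum :: "nat \<Rightarrow> int \<Rightarrow> nat \<Rightarrow> nat \<Rightarrow> int \<Rightarrow> complex" where
  "exp_sum p M R D x = (\<Sum>i\<in>{1..D}. ee p (M * int R ^ i * x))"

text \<open>Pigeonhole over arcs for \<open>ee p\<close> and over squares of side
  \<open>\<delta> * sqrt D\<close> for the exponential sum; the number of cells depends on neither
  \<open>D\<close> nor \<open>p\<close>. The cell is then translated to bring \<open>ee p\<close>
  near \<open>ee N0 1\<close>. This spoils the values of the sum but not differences, so the last
  property refers to untranslated elements \<open>g\<close> and \<open>h\<close>.\<close>

lemma ex_dense_exp_sum_cell: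
  fixes p R D n0 N0 L :: nat and M :: int and \<delta> :: real
  assumes p: "prime p" and R: "R \<ge> 3" and M: "\<not> int p dvd M" and p_large: "2 * R ^ D < p" and D: "D > 0"
    and n0: "n0 > 0" and N0: "N0 > 0" and \<delta>: "\<delta> > 0" "4 / \<delta> \<le> L"
  obtains A where "A \<subseteq> resid p" "real (card A) \<ge> 3 / (128 * real (n0 * (2 * L + 1)\<^sup>2)) * real p"
    "\<And>a. a \<in> A \<Longrightarrow> norm (ee p a - ee N0 1) \<le> 2 * pi / n0 + 2 * pi / p"
    "\<And>a b. a \<in> A \<Longrightarrow> b \<in> A \<Longrightarrow> \<exists>g h. [a - b = g - h] (mod int p) \<and>
       norm (exp_sum p M R D g - exp_sum p M R D h) \<le> 2 * \<delta> * sqrt D \<and> sqrt (D / 2) \<le> norm (exp_sum p M R D h)"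
proof -
  have p0: "p > 0" using p by (rule prime_gt_0_nat)
  let ?Z = "exp_sum p M R D"
  define G where "G = {x \<in> resid p. D / 2 \<le> (norm (?Z x))\<^sup>2 \<and> (norm (?Z x))\<^sup>2 \<le> 16 * real D}"
  have card_G: "real (card G) \<ge> 3 / 128 * real p"
    unfolding G_def exp_sum_def by (rule card_moderate_exponential_sum[OF p R M p_large D])
  obtain \<kappa> where \<kappa>: "\<And>x. \<kappa> x < n0 ^ card {1::int}"
    "\<And>x y \<xi>. \<kappa> x = \<kappa> y \<Longrightarrow> \<xi> \<in> {1} \<Longrightarrow> norm (ee p (\<xi> * (x - y)) - 1) \<le> 2 * pi / n0"
    using ex_bohr_cells[OF p0 n0, of "{1}"] by blast
  have sD: "\<delta> * sqrt D > 0" using \<delta> D by simp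
  define q where "q y = \<lfloor>y / (\<delta> * sqrt D)\<rfloor>" for y :: real
  \<comment> \<open>On \<open>G\<close> the sum is at most \<open>4 * sqrt D\<close> in norm, so its
    coordinates in units of \<open>\<delta> * sqrt D\<close> are bounded by
    \<open>L\<close>.\<close>
  define T where "T = {..<n0} \<times> {- int L..int L} \<times> {- int L..int L}"
  define f where "f x = (\<kappa> x, q (Re (?Z x)), q (Im (?Z x)))" for x
  have q_mem: "q y \<in> {- int L..int L}" if "\<bar>y\<bar> \<le> 4 * sqrt D" for y
  proof -
    have "\<bar>y / (\<delta> * sqrt D)\<bar> = \<bar>y\<bar> / (\<delta> * sqrt D)" using sD by (simp add: abs_divide)
    also have "\<dots> \<le> 4 * sqrt D / (\<delta> * sqrt D)" using that sD by (intro divide_right_mono) auto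
    also have "\<dots> = 4 / \<delta>" using D by simp
    finally have "\<bar>y / (\<delta> * sqrt D)\<bar> \<le> real L" using \<delta> by simp
    then have "- real L \<le> y / (\<delta> * sqrt D)" "y / (\<delta> * sqrt D) < real L + 1" by linarith+
    then show ?thesis unfolding q_def by (simp add: le_floor_iff floor_le_iff)
  qed
  have "f x \<in> T" if "x \<in> G" for x
  proof -
    have "norm (?Z x) \<le> sqrt (16 * real D)" using that unfolding G_def by (intro real_le_rsqrt) simp
    then have "norm (?Z x) \<le> 4 * sqrt D" by (simp add: real_sqrt_mult)
    then have "\<bar>Re (?Z x)\<bar> \<le> 4 * sqrt D" "\<bar>Im (?Z x)\<bar> \<le> 4 * sqrt D"
      using abs_Re_le_cmod[of "?Z x"] abs_Im_le_cmod[of "?Z x"] by linarith+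
    then show ?thesis unfolding f_def T_def using q_mem \<kappa>(1) by simp
  qed
  then have fG: "f ` G \<subseteq> T" by blast
  have T: "finite T" "T \<noteq> {}" unfolding T_def using n0 by auto
  have finG: "finite G" unfolding G_def by (rule finite_subset[of _ "resid p"]) auto
  obtain y where y: "y \<in> T" "card G \<le> card T * card {x \<in> G. f x = y}"
    by (rule ex_large_fibre[OF finG fG T])
  define G' where "G' = {x \<in> G. f x = y}"
  have card_T: "card T = n0 * (2 * L + 1)\<^sup>2"
  proof -
    have "nat (int L - - int L + 1) = 2 * L + 1" by linarith
    then show ?thesis unfolding T_def card_cartesian_product card_atLeastAtMost_int by (simp add: power2_eq_square)
  qed
  have fin: "finite G'" unfolding G'_def using finG by simp
  have G'_resid: "G' \<subseteq> resid p" unfolding G'_def G_def by blast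
  have "real (card G) \<le> real (card T * card G')"
    using y(2) unfolding G'_def by (simp only: of_nat_le_iff)
  then have "3 / 128 * real p \<le> real (card T) * real (card G')"
    unfolding of_nat_mult by (rule order_trans[OF card_G])
  moreover have "real (card T) > 0" using T by (simp add: card_gt_0_iff)
  ultimately have card_G': "real (card G') \<ge> 3 / (128 * real (n0 * (2 * L + 1)\<^sup>2)) * real p"
    unfolding card_T by (simp add: divide_le_eq mult_ac)
  moreover have "3 / (128 * real (n0 * (2 * L + 1)\<^sup>2)) * real p > 0" using n0 p0 by simp
  ultimately have "real (card G') > 0" by linarith
  then have "G' \<noteq> {}" by auto
  then obtain x0 where x0: "x0 \<in> G'" by blast
  define z where "z = int p div int N0 - x0"
  define A where "A = (\<lambda>x. (1 * x + z) mod int p) ` G'"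
  have inj: "inj_on (\<lambda>x. (1 * x + z) mod int p) G'"
    using bij_betw_affine_mod[OF p0, of 1 z] G'_resid by (auto simp: bij_betw_def intro: inj_on_subset)
  have "A \<subseteq> resid p" unfolding A_def using p0 by auto
  moreover have "real (card A) \<ge> 3 / (128 * real (n0 * (2 * L + 1)\<^sup>2)) * real p"
    unfolding A_def card_image[OF inj] by (rule card_G')
  moreover have "norm (ee p a - ee N0 1) \<le> 2 * pi / n0 + 2 * pi / p" if "a \<in> A" for a
  proof -
    obtain x where x: "x \<in> G'" "a = (1 * x + z) mod int p" using \<open>a \<in> A\<close> unfolding A_def by blast
    have "ee p a = ee p (x + z)" unfolding x by (rule ee_cong) (simp add: cong_def)
    also have "x + z = (x - x0) + int p div int N0" by (simp add: z_def)
    finally have "ee p a = ee p (x - x0) * ee p (int p div int N0)" by (simp only: ee_add)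
    moreover have "norm (ee p (x - x0) * ee p (int p div int N0) - 1 * ee N0 1)
        \<le> norm (ee p (x - x0) - 1) + norm (ee p (int p div int N0) - ee N0 1)"
      by (rule norm_unit_mult_diff_le) simp_all
    moreover have "norm (ee p (x - x0) - 1) \<le> 2 * pi / n0"
    proof -
      have "f x = f x0" using x x0 by (simp add: G'_def)
      then show ?thesis using \<kappa>(2)[of x x0 1] by (simp add: f_def)
    qed
    moreover have "norm (ee p (int p div int N0) - ee N0 1) \<le> 2 * pi / p"
    proof -
      define m where "m = int p mod int N0"
      have m: "0 \<le> m" "m < int N0" "int N0 * (int p div int N0) = int p - m"
        using N0 by (auto simp: m_def minus_mod_eq_mult_div)
      then have "real N0 * real_of_int (int p div int N0) = real p - real_of_int m"
        by (metis of_int_diff of_int_mult of_int_of_nat_eq)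
      then have eq: "real_of_int (int p div int N0) = (real p - real_of_int m) / real N0"
        using N0 by (simp add: field_simps)
      have "norm (ee p (int p div int N0) - cis (2 * pi * (1 / N0)))
          \<le> 2 * pi * \<bar>real_of_int (int p div int N0) / real p - 1 / N0\<bar>"
        by (rule norm_ee_diff_cis_le)
      also have "real_of_int (int p div int N0) / real p - 1 / N0 = - (real_of_int m / (real N0 * real p))"
        unfolding eq using N0 p0 by (simp add: diff_divide_distrib)
      also have "\<bar>- (real_of_int m / (real N0 * real p))\<bar> \<le> 1 / p"
      proof -
        have "real_of_int m \<le> real N0" using m by linarith
        then show ?thesis using m(1) N0 p0 by (simp add: divide_le_eq)
      qed
      finally show ?thesis by (simp add: ee_def)
    qed
    ultimately show ?thesis by simp
  qed
  moreover have "\<exists>g h. [a - b = g - h] (mod int p) \<and>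
       norm (?Z g - ?Z h) \<le> 2 * \<delta> * sqrt D \<and> sqrt (D / 2) \<le> norm (?Z h)"
    if "a \<in> A" "b \<in> A" for a b
  proof -
    obtain g h where g: "g \<in> G'" "a = (1 * g + z) mod int p" and h: "h \<in> G'" "b = (1 * h + z) mod int p"
      using \<open>a \<in> A\<close> \<open>b \<in> A\<close> unfolding A_def by blast
    have "[a - b = (1 * g + z) - (1 * h + z)] (mod int p)"
      unfolding g(2) h(2) by (intro cong_diff) (simp_all add: cong_def)
    then have "[a - b = g - h] (mod int p)" by simp
    moreover have q_close: "\<bar>x - y\<bar> \<le> \<delta> * sqrt D" if "q x = q y" for x y
    proof -
      have "\<bar>x / (\<delta> * sqrt D) - y / (\<delta> * sqrt D)\<bar> \<le> 1" using that unfolding q_def by linarith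
      then have "\<bar>(x - y) / (\<delta> * sqrt D)\<bar> \<le> 1" by (simp add: diff_divide_distrib)
      then have "\<bar>x - y\<bar> / (\<delta> * sqrt D) \<le> 1" using sD by (simp add: abs_divide)
      then show ?thesis using sD by (simp add: divide_le_eq)
    qed
    have "f g = f h" using g h by (simp add: G'_def)
    then have "\<bar>Re (?Z g) - Re (?Z h)\<bar> \<le> \<delta> * sqrt D" "\<bar>Im (?Z g) - Im (?Z h)\<bar> \<le> \<delta> * sqrt D"
      unfolding f_def by (auto intro: q_close)
    moreover have "norm (?Z g - ?Z h) \<le> \<bar>Re (?Z g - ?Z h)\<bar> + \<bar>Im (?Z g - ?Z h)\<bar>" by (rule cmod_le)
    ultimately have "norm (?Z g - ?Z h) \<le> 2 * \<delta> * sqrt D" by simp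
    moreover have "sqrt (D / 2) \<le> norm (?Z h)"
      using h(1) unfolding G'_def G_def by (intro real_le_lsqrt) auto
    ultimately show ?thesis using \<open>[a - b = g - h] (mod int p)\<close> by blast
  qed
  ultimately show ?thesis by (rule that)
qed

definition almost_root :: "nat \<Rightarrow> nat \<Rightarrow> nat \<Rightarrow> nat \<Rightarrow> nat \<Rightarrow> real \<Rightarrow> int set" where
  "almost_root p P R D t \<epsilon> = {a \<in> resid p. norm (ee p a - 1) \<le> \<epsilon> \<and>
     card {r \<in> {1..D}. \<epsilon> < norm (ee p (int R ^ r * a) - ee P 1)} \<le> t}"

text \<open>Words map to vertices by linear combinations of the approximately dual elements
  \<open>b\<close>. The difference of two vertices has at frequency \<open>R ^ r\<close> the
  character of the difference of the letters, so near-shifts become edges.\<close>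

lemma cayley_chromatic_almost_root:
  fixes b :: "nat \<Rightarrow> int"
  assumes p: "p > 0" and P: "prime P" and D: "D > P * C"
    and dual: "\<And>i j. 1 \<le> i \<Longrightarrow> i \<le> D \<Longrightarrow> j \<le> D \<Longrightarrow> norm (ee p (int R ^ j * b i) - (if i = j then ee P 1 else 1)) \<le> \<epsilon>'"
    and \<epsilon>: "real D * real P * \<epsilon>' \<le> \<epsilon>" "\<epsilon> < norm (ee P 1 - 1)"
    and A: "almost_root p P R D (P * C) \<epsilon> \<subseteq> A"
  shows "C < cayley_chromatic p A"
proof (rule ccontr)
  assume "\<not> C < cayley_chromatic p A"
  then have le: "cayley_chromatic p A \<le> C" by simp
  have P0: "P > 0" using P by (rule prime_gt_0_nat)
  have "cayley_colorable p A (cayley_chromatic p A)"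
    unfolding cayley_chromatic_def using cayley_colorable_trivial by (rule LeastI)
  then obtain f :: "int \<Rightarrow> nat" where f: "\<And>u. u \<in> resid p \<Longrightarrow> f u < cayley_chromatic p A"
    "\<And>u v. u \<in> resid p \<Longrightarrow> v \<in> resid p \<Longrightarrow> u \<noteq> v \<Longrightarrow> (v - u) mod int p \<in> A \<Longrightarrow> f u \<noteq> f v"
    unfolding cayley_colorable_def by blast
  \<comment> \<open>Letters are indexed from 0 and frequencies from 1, as exponent 0 is reserved for
    the condition that \<open>ee p\<close> is near 1.\<close>
  define V where "V y = (\<Sum>i<D. y i * b (Suc i)) mod int p" for y
  have V_resid: "V y \<in> resid p" for y unfolding V_def using p by simp
  have fC: "f (V y) < C" if "\<forall>i<D. y i \<in> {0..<int P}" for y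
    using f(1)[OF V_resid[of y]] le by (rule less_le_trans)
  obtain y y' where y: "\<forall>i<D. y i \<in> {0..<int P}" and y': "\<forall>i<D. y' i \<in> {0..<int P}"
    and mono: "f (V y) = f (V y')" and bad: "card {i. i < D \<and> y' i \<noteq> (y i + 1) mod int P} \<le> P * C"
    by (rule ex_monochromatic_near_shift[where f = "\<lambda>y. f (V y)", OF P D fC]) (assumption, rule that)
  define a where "a = (V y' - V y) mod int p"
  have near: "norm (ee p (int R ^ j * a) - ee P (if j = 0 then 0 else y' (j - 1) - y (j - 1))) \<le> \<epsilon>"
    if j: "j \<le> D" for j
  proof -
    define \<alpha> where "\<alpha> i = (if Suc i = j then 2 * pi / P else 0)" for i
    have "[a = (\<Sum>i<D. y' i * b (Suc i)) - (\<Sum>i<D. y i * b (Suc i))] (mod int p)"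
      unfolding a_def V_def by (simp add: cong_def mod_simps)
    then have "[int R ^ j * a = int R ^ j * ((\<Sum>i<D. y' i * b (Suc i)) - (\<Sum>i<D. y i * b (Suc i)))] (mod int p)"
      by (intro cong_mult cong_refl)
    moreover have "int R ^ j * ((\<Sum>i<D. y' i * b (Suc i)) - (\<Sum>i<D. y i * b (Suc i)))
        = (\<Sum>i<D. (y' i - y i) * (int R ^ j * b (Suc i)))"
      by (simp add: sum_subtractf[symmetric] sum_distrib_left algebra_simps)
    ultimately have eq: "ee p (int R ^ j * a) = ee p (\<Sum>i<D. (y' i - y i) * (int R ^ j * b (Suc i)))"
      by (metis ee_cong)
    have cis_eq: "cis (\<Sum>i<D. real_of_int (y' i - y i) * \<alpha> i) = ee P (if j = 0 then 0 else y' (j - 1) - y (j - 1))"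
    proof (cases "j = 0")
      case True
      then show ?thesis by (simp add: \<alpha>_def)
    next
      case False
      then have "(\<Sum>i<D. real_of_int (y' i - y i) * \<alpha> i) = (\<Sum>i\<in>{j - 1}. real_of_int (y' i - y i) * \<alpha> i)"
        using j by (intro sum.mono_neutral_right) (auto simp: \<alpha>_def)
      then show ?thesis using False by (simp add: \<alpha>_def ee_def mult_ac)
    qed
    have "norm (ee p (\<Sum>i<D. (y' i - y i) * (int R ^ j * b (Suc i))) - cis (\<Sum>i<D. real_of_int (y' i - y i) * \<alpha> i))
        \<le> (\<Sum>i<D. \<bar>real_of_int (y' i - y i)\<bar> * norm (ee p (int R ^ j * b (Suc i)) - cis (\<alpha> i)))"
      by (rule norm_ee_sum_diff_le) simp
    also have "\<dots> \<le> (\<Sum>i<D. real P * \<epsilon>')"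
    proof (rule sum_mono)
      fix i assume i: "i \<in> {..<D}"
      have "\<bar>y' i - y i\<bar> \<le> int P" using y y' i by fastforce
      then have "\<bar>real_of_int (y' i - y i)\<bar> \<le> real P" by linarith
      moreover have "cis (\<alpha> i) = (if Suc i = j then ee P 1 else 1)" by (simp add: \<alpha>_def ee_def)
      then have "norm (ee p (int R ^ j * b (Suc i)) - cis (\<alpha> i)) \<le> \<epsilon>'"
        using dual[of "Suc i" j] i j by auto
      ultimately show "\<bar>real_of_int (y' i - y i)\<bar> * norm (ee p (int R ^ j * b (Suc i)) - cis (\<alpha> i)) \<le> real P * \<epsilon>'"
        by (intro mult_mono) auto
    qed
    also have "\<dots> = real D * real P * \<epsilon>'" by simp
    finally show ?thesis unfolding eq cis_eq using \<epsilon>(1) by linarith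
  qed
  have good: "norm (ee p (int R ^ r * a) - ee P 1) \<le> \<epsilon>"
    if "r \<in> {1..D}" "y' (r - 1) = (y (r - 1) + 1) mod int P" for r
  proof -
    have "[y' (r - 1) - y (r - 1) = y (r - 1) + 1 - y (r - 1)] (mod int P)"
      unfolding that(2) by (intro cong_diff cong_refl) (simp add: cong_def)
    then have "ee P (y' (r - 1) - y (r - 1)) = ee P 1" by (intro ee_cong) simp
    then show ?thesis using near[of r] that(1) by simp
  qed
  have card_bad: "card {r \<in> {1..D}. \<epsilon> < norm (ee p (int R ^ r * a) - ee P 1)} \<le> P * C"
  proof -
    have "{r \<in> {1..D}. \<epsilon> < norm (ee p (int R ^ r * a) - ee P 1)} \<subseteq> Suc ` {i. i < D \<and> y' i \<noteq> (y i + 1) mod int P}"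
    proof
      fix r assume r: "r \<in> {r \<in> {1..D}. \<epsilon> < norm (ee p (int R ^ r * a) - ee P 1)}"
      then have "r - 1 \<in> {i. i < D \<and> y' i \<noteq> (y i + 1) mod int P}" "r = Suc (r - 1)"
        using good[of r] by auto
      then show "r \<in> Suc ` {i. i < D \<and> y' i \<noteq> (y i + 1) mod int P}" by blast
    qed
    then have "card {r \<in> {1..D}. \<epsilon> < norm (ee p (int R ^ r * a) - ee P 1)}
        \<le> card (Suc ` {i. i < D \<and> y' i \<noteq> (y i + 1) mod int P})"
      by (intro card_mono) auto
    also have "\<dots> \<le> card {i. i < D \<and> y' i \<noteq> (y i + 1) mod int P}" by (rule card_image_le) simp
    finally show ?thesis using bad by linarith
  qed
  have "a \<in> almost_root p P R D (P * C) \<epsilon>"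
    unfolding almost_root_def using card_bad near[of 0] p by (simp add: a_def)
  then have "a \<in> A" using A by blast
  \<comment> \<open>If they coincided, every frequency would be exceptional, but \<open>D\<close>
    exceeds \<open>P * C\<close>.\<close>
  moreover have "V y \<noteq> V y'"
  proof
    assume "V y = V y'"
    then have "a = 0" by (simp add: a_def)
    have "{r \<in> {1..D}. \<epsilon> < norm (ee p (int R ^ r * a) - ee P 1)} = {1..D}"
      using \<epsilon>(2) \<open>a = 0\<close> by (auto simp: norm_minus_commute)
    then show False using card_bad D by simp
  qed
  ultimately show False using f(2)[OF V_resid V_resid, of y y'] mono by (simp add: a_def)
qed

text \<open>In \<open>num\<close>, the left side collects the phase errors at good frequencies, a
  loss of 2 at each of at most \<open>k * t\<close> bad ones, and the variation \<eta> of the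
  exponential sum on the dense set. The right side bounds from below the change that rotation by a
  nontrivial root of unity makes to a sum of size at least \<mu>.\<close>

lemma solution_free_union:
  fixes c :: "nat \<Rightarrow> int" and p P R D t N0 k :: nat and M s :: int and \<epsilon> \<epsilon>0 \<gamma> \<gamma>0 \<eta> \<mu> \<sigma> :: real
  defines "s \<equiv> (\<Sum>i=1..k. c i)" and "\<sigma> \<equiv> (\<Sum>i=1..k. \<bar>real_of_int (c i)\<bar>)"
  assumes p: "p > 0" and k: "k \<ge> 3" and c: "\<And>i. i \<in> {1..k} \<Longrightarrow> c i \<noteq> 0"
    and nz: "\<And>I. I \<subseteq> {1..k} \<Longrightarrow> card I \<ge> 3 \<Longrightarrow> (\<Sum>i\<in>I. c i) \<noteq> 0"
    and \<gamma>: "\<And>m. \<not> int P dvd m \<Longrightarrow> \<gamma> \<le> norm (ee P m - 1)"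
    and \<gamma>0: "\<And>m. \<not> int N0 dvd m \<Longrightarrow> \<gamma>0 \<le> norm (ee N0 m - 1)"
    and Ps: "\<not> int P dvd s" "\<And>i. i \<in> {1..k} \<Longrightarrow> \<not> int P dvd (M div c i) * s"
    and M: "M > 0" "\<And>i. i \<in> {1..k} \<Longrightarrow> c i dvd M" and N0: "\<sigma> < N0"
    and A2: "\<And>a. a \<in> A2 \<Longrightarrow> norm (ee p a - ee N0 1) \<le> \<epsilon>0"
    and A2': "\<And>a b. a \<in> A2 \<Longrightarrow> b \<in> A2 \<Longrightarrow> \<exists>g h. [a - b = g - h] (mod int p) \<and>
       norm (exp_sum p M R D g - exp_sum p M R D h) \<le> \<eta> \<and> \<mu> \<le> norm (exp_sum p M R D h)"
    and \<epsilon>: "\<epsilon> \<ge> 0" "\<epsilon> \<le> \<epsilon>0" "\<sigma> * \<epsilon>0 < \<gamma>0" "\<sigma> * \<epsilon> < \<gamma>" and t: "k * t < D"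
    and num: "real D * (M * (\<sigma> * \<epsilon>)) + 2 * real (k * t) + \<eta> < \<mu> * \<gamma>" and "\<gamma> > 0"
  shows "solution_free k c p (almost_root p P R D t \<epsilon> \<union> A2)"
  unfolding solution_free_def
proof
  let ?A1 = "almost_root p P R D t \<epsilon>"
  assume "\<exists>x. (\<forall>i\<in>{1..k}. x i \<in> ?A1 \<union> A2) \<and> inj_on x {1..k} \<and> (\<Sum>i=1..k. c i * x i) mod int p = 0"
  then obtain x where sol: "(\<forall>i\<in>{1..k}. x i \<in> ?A1 \<union> A2) \<and> inj_on x {1..k} \<and> (\<Sum>i=1..k. c i * x i) mod int p = 0"
    by (rule exE)
  have x: "x i \<in> ?A1 \<union> A2" if "i \<in> {1..k}" for i using conjunct1[OF sol] that by (rule bspec)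
  have x0: "(\<Sum>i=1..k. c i * x i) mod int p = 0" using sol by (elim conjE)
  define J where "J = {i \<in> {1..k}. x i \<in> ?A1}"
  define I where "I = {1..k} - J"
  have J_sub: "J \<subseteq> {1..k}" and I_sub: "I \<subseteq> {1..k}" unfolding J_def I_def by auto
  have fin: "finite J" "finite I" unfolding J_def I_def by simp_all
  have in_A1: "x i \<in> ?A1" if "i \<in> J" for i using that by (simp add: J_def)
  have in_A2: "x i \<in> A2" if "i \<in> I" for i using that x[of i] by (auto simp: I_def J_def)
  have split_sum: "(\<Sum>i=1..k. F i) = (\<Sum>i\<in>I. F i) + (\<Sum>i\<in>J. F i)" for F :: "nat \<Rightarrow> int"
    unfolding I_def by (rule sum.subset_diff[OF J_sub]) simp
  have \<sigma>_J: "(\<Sum>i\<in>J. \<bar>real_of_int (c i)\<bar>) \<le> \<sigma>" and \<sigma>_I: "(\<Sum>i\<in>I. \<bar>real_of_int (c i)\<bar>) \<le> \<sigma>"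
    unfolding \<sigma>_def using J_sub I_sub by (auto intro!: sum_mono2)
  \<comment> \<open>At frequency 1 the equation makes \<open>ee N0\<close> of this sum almost 1,
    hence the sum divisible by \<open>N0\<close>, which exceeds its absolute value.\<close>
  have sum_I: "(\<Sum>i\<in>I. c i) = 0"
  proof (rule ccontr)
    assume neq: "(\<Sum>i\<in>I. c i) \<noteq> 0"
    define \<alpha> where "\<alpha> i = (if i \<in> J then 0 else 2 * pi / N0)" for i
    have "norm (ee p (\<Sum>i=1..k. c i * x i) - cis (\<Sum>i=1..k. real_of_int (c i) * \<alpha> i))
        \<le> (\<Sum>i=1..k. \<bar>real_of_int (c i)\<bar> * norm (ee p (x i) - cis (\<alpha> i)))"
      by (rule norm_ee_sum_diff_le) simp
    also have "\<dots> \<le> (\<Sum>i=1..k. \<bar>real_of_int (c i)\<bar> * \<epsilon>0)"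
    proof (intro sum_mono mult_left_mono)
      fix i assume i: "i \<in> {1..k}"
      show "norm (ee p (x i) - cis (\<alpha> i)) \<le> \<epsilon>0"
      proof (cases "i \<in> J")
        case True
        then have "norm (ee p (x i) - 1) \<le> \<epsilon>" using in_A1 by (simp add: almost_root_def)
        then show ?thesis using True \<epsilon>(2) by (simp add: \<alpha>_def)
      next
        case False
        then have "norm (ee p (x i) - ee N0 1) \<le> \<epsilon>0" using A2 in_A2 i by (simp add: I_def)
        then show ?thesis using False by (simp add: \<alpha>_def ee_def)
      qed
    qed simp
    also have "\<dots> = \<sigma> * \<epsilon>0" by (simp add: \<sigma>_def sum_distrib_right)
    finally have le: "norm (ee p (\<Sum>i=1..k. c i * x i) - cis (\<Sum>i=1..k. real_of_int (c i) * \<alpha> i)) < \<gamma>0"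
      using \<epsilon>(3) by linarith
    have "ee p (\<Sum>i=1..k. c i * x i) = 1" using x0 p by (simp add: ee_eq_1_iff mod_0_imp_dvd)
    moreover have "cis (\<Sum>i=1..k. real_of_int (c i) * \<alpha> i) = ee N0 (\<Sum>i\<in>I. c i)"
    proof -
      have "(\<Sum>i=1..k. real_of_int (c i) * \<alpha> i) = (\<Sum>i\<in>I. real_of_int (c i) * \<alpha> i)"
        using I_sub by (intro sum.mono_neutral_right) (auto simp: I_def \<alpha>_def)
      also have "\<dots> = (\<Sum>i\<in>I. real_of_int (c i) * (2 * pi / N0))"
        by (rule sum.cong) (auto simp: I_def \<alpha>_def)
      also have "\<dots> = 2 * pi * real_of_int (\<Sum>i\<in>I. c i) / N0"
        unfolding sum_distrib_right[symmetric] by simp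
      finally show ?thesis by (simp only: ee_def)
    qed
    ultimately have lt: "norm (ee N0 (\<Sum>i\<in>I. c i) - 1) < \<gamma>0" using le by (simp add: norm_minus_commute)
    have "\<bar>real_of_int (\<Sum>i\<in>I. c i)\<bar> \<le> (\<Sum>i\<in>I. \<bar>real_of_int (c i)\<bar>)"
      unfolding of_int_sum by (rule sum_abs)
    then have "\<bar>real_of_int (\<Sum>i\<in>I. c i)\<bar> < real N0" using \<sigma>_I N0 by linarith
    then have "\<bar>\<Sum>i\<in>I. c i\<bar> < int N0" by linarith
    then have "\<not> int N0 dvd (\<Sum>i\<in>I. c i)" using neq dvd_imp_le_int[of "\<Sum>i\<in>I. c i" "int N0"] by auto
    then show False using \<gamma>0 lt by (meson not_le)
  qed
  then have sum_J: "(\<Sum>i\<in>J. c i) = s" using split_sum[of c] by (simp add: s_def)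
  have card_I: "card I < 3" using nz[OF I_sub] sum_I by linarith
  define bad where "bad = {r \<in> {1..D}. \<exists>l\<in>J. \<epsilon> < norm (ee p (int R ^ r * x l) - ee P 1)}"
  have card_bad: "card bad \<le> k * t"
  proof -
    have "bad = (\<Union>l\<in>J. {r \<in> {1..D}. \<epsilon> < norm (ee p (int R ^ r * x l) - ee P 1)})"
      unfolding bad_def by blast
    then have "card bad \<le> (\<Sum>l\<in>J. card {r \<in> {1..D}. \<epsilon> < norm (ee p (int R ^ r * x l) - ee P 1)})"
      by (simp only: card_UN_le[OF fin(1)])
    also have "\<dots> \<le> (\<Sum>l\<in>J. t)"
      by (rule sum_mono) (use in_A1 in \<open>simp add: almost_root_def\<close>)
    also have "\<dots> \<le> k * t"
      using card_mono[OF _ J_sub] by simp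
    finally show ?thesis .
  qed
  have good: "norm (ee p (\<Sum>l\<in>J. c l * (int R ^ r * x l)) - ee P s) \<le> \<sigma> * \<epsilon>" if r: "r \<in> {1..D}" "r \<notin> bad" for r
  proof -
    have "norm (ee p (\<Sum>l\<in>J. c l * (int R ^ r * x l)) - cis (\<Sum>l\<in>J. real_of_int (c l) * (2 * pi / P)))
        \<le> (\<Sum>l\<in>J. \<bar>real_of_int (c l)\<bar> * norm (ee p (int R ^ r * x l) - cis (2 * pi / P)))"
      by (rule norm_ee_sum_diff_le[OF fin(1)])
    also have "\<dots> \<le> (\<Sum>l\<in>J. \<bar>real_of_int (c l)\<bar> * \<epsilon>)"
    proof (intro sum_mono mult_left_mono)
      fix l assume "l \<in> J"
      then have "norm (ee p (int R ^ r * x l) - ee P 1) \<le> \<epsilon>" using r unfolding bad_def by (auto simp: not_less)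
      then show "norm (ee p (int R ^ r * x l) - cis (2 * pi / P)) \<le> \<epsilon>" by (simp add: ee_def)
    qed simp
    also have "\<dots> \<le> \<sigma> * \<epsilon>"
      unfolding sum_distrib_right[symmetric] using \<sigma>_J \<epsilon>(1) by (rule mult_right_mono)
    also have "(\<Sum>l\<in>J. real_of_int (c l) * (2 * pi / P)) = 2 * pi * real_of_int s / P"
      unfolding sum_J[symmetric] sum_distrib_right[symmetric] by simp
    finally show ?thesis by (simp only: ee_def)
  qed
  consider "I = {}" | i where "I = {i}" | i j where "I = {i, j}" "i \<noteq> j"
  proof -
    have "card I = 0 \<or> card I = 1 \<or> card I = 2" using card_I by linarith
    then show ?thesis
      using fin(2) that by (elim disjE) (auto simp: card_1_singleton_iff card_2_iff)
  qed
  then show False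
  proof cases
    case 1
    \<comment> \<open>With all variables in the first set, one good frequency suffices: there the
      equation would bring \<open>ee P s\<close> too close to 1.\<close>
    have "\<not> {1..D} \<subseteq> bad"
    proof
      assume sub: "{1..D} \<subseteq> bad"
      have "finite bad" unfolding bad_def by simp
      from card_mono[OF this sub] have "D \<le> card bad" by simp
      then show False using card_bad t by linarith
    qed
    then obtain r where r: "r \<in> {1..D}" "r \<notin> bad" by blast
    have "(\<Sum>l\<in>J. c l * (int R ^ r * x l)) = int R ^ r * (\<Sum>i=1..k. c i * x i)"
      using split_sum[of "\<lambda>i. c i * x i"] 1 by (simp add: sum_distrib_left mult_ac)
    then have "ee p (\<Sum>l\<in>J. c l * (int R ^ r * x l)) = 1" using x0 p by (simp add: ee_eq_1_iff mod_0_imp_dvd)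
    then have "norm (ee P s - 1) \<le> \<sigma> * \<epsilon>" using good[OF r] by (simp add: norm_minus_commute)
    then show False using \<gamma>[OF Ps(1)] \<epsilon>(4) by linarith
  next
    case (2 i)
    then show False using sum_I c[of i] I_sub by simp
  next
    case (3 i j)
    have ij: "i \<in> {1..k}" "x i \<in> A2" "x j \<in> A2" and cj: "c j = - c i"
      using 3 I_sub in_A2 sum_I by auto
    obtain g h where gh: "[x i - x j = g - h] (mod int p)"
      "norm (exp_sum p M R D g - exp_sum p M R D h) \<le> \<eta>" "\<mu> \<le> norm (exp_sum p M R D h)"
      using A2'[OF ij(2,3)] by blast
    define m where "m = M div c i"
    have m: "m * c i = M" unfolding m_def using M(2)[OF ij(1)] by simp
    have m_le: "\<bar>m\<bar> \<le> M"
    proof -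
      have "\<bar>m\<bar> * 1 \<le> \<bar>m\<bar> * \<bar>c i\<bar>" using c[OF ij(1)] by (intro mult_left_mono) auto
      also have "\<dots> = M" using m M(1) by (metis abs_mult abs_of_pos)
      finally show ?thesis by simp
    qed
    \<comment> \<open>Multiplying the equation by \<open>m * R ^ r\<close> isolates
      \<open>M * R ^ r * (g - h)\<close>. So at every good frequency the phases at \<open>g\<close>
      and at \<open>h\<close> differ by about the factor \<zeta>, whatever \<open>r\<close>
      is.\<close>
    define \<zeta> where "\<zeta> = ee P (- m * s)"
    have term_le: "norm (ee p (M * int R ^ r * g) - \<zeta> * ee p (M * int R ^ r * h)) \<le> M * (\<sigma> * \<epsilon>)"
      if r: "r \<in> {1..D}" "r \<notin> bad" for r
    proof -
      have "[M * int R ^ r * (g - h) = M * int R ^ r * (x i - x j)] (mod int p)"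
        using gh(1) by (intro cong_mult cong_refl) (rule cong_sym)
      also have "M * int R ^ r * (x i - x j) = m * int R ^ r * (\<Sum>l\<in>I. c l * x l)"
        using 3 cj unfolding m[symmetric] by (simp add: algebra_simps)
      also have "\<dots> = m * int R ^ r * (\<Sum>i=1..k. c i * x i) - m * int R ^ r * (\<Sum>l\<in>J. c l * x l)"
        unfolding split_sum by (simp add: algebra_simps)
      also have "[\<dots> = 0 - m * int R ^ r * (\<Sum>l\<in>J. c l * x l)] (mod int p)"
        using x0 by (intro cong_diff cong_refl) (simp add: cong_0_iff mod_0_imp_dvd)
      also have "0 - m * int R ^ r * (\<Sum>l\<in>J. c l * x l) = - m * (\<Sum>l\<in>J. c l * (int R ^ r * x l))"
        by (simp add: sum_distrib_left sum_negf mult_ac)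
      finally have eq: "ee p (M * int R ^ r * (g - h)) = ee p (- m * (\<Sum>l\<in>J. c l * (int R ^ r * x l)))"
        by (rule ee_cong)
      have "ee p (M * int R ^ r * g) = ee p (M * int R ^ r * (g - h)) * ee p (M * int R ^ r * h)"
        unfolding ee_add[symmetric] by (simp add: algebra_simps)
      then have "ee p (M * int R ^ r * g) - \<zeta> * ee p (M * int R ^ r * h)
          = (ee p (- m * (\<Sum>l\<in>J. c l * (int R ^ r * x l))) - \<zeta>) * ee p (M * int R ^ r * h)"
        unfolding eq by (simp add: left_diff_distrib)
      then have "norm (ee p (M * int R ^ r * g) - \<zeta> * ee p (M * int R ^ r * h))
          = norm (ee p (- m * (\<Sum>l\<in>J. c l * (int R ^ r * x l))) - \<zeta>)"
        by (simp add: norm_mult)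
      also have "\<dots> \<le> \<bar>real_of_int (- m)\<bar> * norm (ee p (\<Sum>l\<in>J. c l * (int R ^ r * x l)) - ee P s)"
        using norm_ee_mult_diff_le[of p "- m" "\<Sum>l\<in>J. c l * (int R ^ r * x l)" "2 * pi * real_of_int s / P"]
        by (simp add: \<zeta>_def ee_def mult_ac)
      also have "\<dots> \<le> M * (\<sigma> * \<epsilon>)"
        using m_le M(1) good[OF r] by (intro mult_mono) (auto simp flip: of_int_abs)
      finally show ?thesis .
    qed
    have M\<epsilon>: "0 \<le> M * (\<sigma> * \<epsilon>)" using M(1) \<epsilon>(1) by (simp add: \<sigma>_def sum_nonneg)
    have "norm (exp_sum p M R D g - \<zeta> * exp_sum p M R D h)
        = norm (\<Sum>r\<in>{1..D}. ee p (M * int R ^ r * g) - \<zeta> * ee p (M * int R ^ r * h))"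
      by (simp add: exp_sum_def sum_subtractf sum_distrib_left)
    also have "\<dots> \<le> (\<Sum>r\<in>{1..D}. M * (\<sigma> * \<epsilon>) + (if r \<in> bad then 2 else 0))"
    proof (rule sum_norm_le)
      fix r assume r: "r \<in> {1..D}"
      show "norm (ee p (M * int R ^ r * g) - \<zeta> * ee p (M * int R ^ r * h)) \<le> M * (\<sigma> * \<epsilon>) + (if r \<in> bad then 2 else 0)"
      proof (cases "r \<in> bad")
        case True
        have "norm (ee p (M * int R ^ r * g) - \<zeta> * ee p (M * int R ^ r * h)) \<le> 2"
          using norm_triangle_ineq4[of "ee p (M * int R ^ r * g)" "\<zeta> * ee p (M * int R ^ r * h)"]
          by (simp add: norm_mult \<zeta>_def)
        then show ?thesis using True M\<epsilon> by simp
      next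
        case False
        then show ?thesis using term_le[OF r] by simp
      qed
    qed
    also have "\<dots> = real D * (M * (\<sigma> * \<epsilon>)) + 2 * real (card bad)"
    proof -
      have "{1..D} \<inter> bad = bad" unfolding bad_def by blast
      then show ?thesis by (simp add: sum.distrib sum.If_cases)
    qed
    also have "\<dots> \<le> real D * (M * (\<sigma> * \<epsilon>)) + 2 * real (k * t)"
      using card_bad by (simp only: add_le_cancel_left mult_le_cancel_left_pos zero_less_numeral of_nat_le_iff)
    finally have close: "norm (exp_sum p M R D g - \<zeta> * exp_sum p M R D h) \<le> real D * (M * (\<sigma> * \<epsilon>)) + 2 * real (k * t)" .
    have "\<gamma> \<le> norm (\<zeta> - 1)"
    proof -
      have "\<not> int P dvd - m * s" using Ps(2)[OF ij(1)] by (simp add: m_def)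
      then show ?thesis unfolding \<zeta>_def by (rule \<gamma>)
    qed
    moreover have "norm (exp_sum p M R D h) \<ge> 0" by simp
    ultimately have "\<mu> * \<gamma> \<le> norm (exp_sum p M R D h) * norm (\<zeta> - 1)"
      using gh(3) \<open>\<gamma> > 0\<close> by (meson less_imp_le mult_mono)
    also have "\<dots> = norm ((exp_sum p M R D g - exp_sum p M R D h) - (exp_sum p M R D g - \<zeta> * exp_sum p M R D h))"
      by (simp add: norm_mult[symmetric] algebra_simps)
    also have "\<dots> \<le> norm (exp_sum p M R D g - exp_sum p M R D h) + norm (exp_sum p M R D g - \<zeta> * exp_sum p M R D h)"
      by (rule norm_triangle_ineq4)
    also have "\<dots> \<le> \<eta> + (real D * (M * (\<sigma> * \<epsilon>)) + 2 * real (k * t))" using gh(2) close by (rule add_mono)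
    finally show False using num by linarith
  qed
qed

text \<open>The order of choices is decisive: \<open>P\<close>, \<open>N0\<close>, the gaps,
  \<delta>, \<open>L\<close> and thus the density \<open>d\<close> depend on the equation alone;
  \<open>D\<close>, \<epsilon>, \<open>R\<close> and finally \<open>p\<close> are chosen after
  \<open>C\<close>.\<close>

theorem ex_dense_solution_free_large_chromatic:
  fixes c :: "nat \<Rightarrow> int" and k :: nat
  assumes k: "k \<ge> 3" and nonzero: "\<forall>i\<in>{1..k}. c i \<noteq> 0"
    and no_zero_sum: "\<not> (\<exists>I \<subseteq> {1..k}. card I \<ge> 3 \<and> (\<Sum>i\<in>I. c i) = 0)"
  shows "\<exists>d::real. d > 0 \<and> (\<forall>C. \<exists>p A. prime p \<and> A \<subseteq> resid p \<and>
    solution_free k c p A \<and> d * real p \<le> real (card A) \<and> C < cayley_chromatic p A)"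
proof -
  have c: "c i \<noteq> 0" if "i \<in> {1..k}" for i using nonzero that by (rule bspec)
  have nz: "(\<Sum>i\<in>I. c i) \<noteq> 0" if "I \<subseteq> {1..k}" "card I \<ge> 3" for I using no_zero_sum that by blast
  define s where "s = (\<Sum>i=1..k. c i)"
  define \<sigma> where "\<sigma> = (\<Sum>i=1..k. \<bar>real_of_int (c i)\<bar>)"
  define M where "M = (\<Prod>i=1..k. \<bar>c i\<bar>)"
  have s0: "s \<noteq> 0" unfolding s_def using nz[of "{1..k}"] k by simp
  have M0: "M > 0" unfolding M_def using c by (intro prod_pos) auto
  have M_dvd: "c i dvd M" if "i \<in> {1..k}" for i
  proof -
    have "\<bar>c i\<bar> dvd M" unfolding M_def using that by (intro dvd_prodI) auto
    then show ?thesis by simp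
  qed
  have \<sigma>1: "\<sigma> \<ge> 1"
  proof -
    have "\<bar>real_of_int (c 1)\<bar> \<le> \<sigma>" unfolding \<sigma>_def using k by (intro member_le_sum) auto
    moreover have "\<bar>c 1\<bar> \<ge> 1" using c[of 1] k by auto
    ultimately show ?thesis by linarith
  qed
  \<comment> \<open>Large enough to divide neither \<open>s\<close> nor any
    \<open>(M div c i) * s\<close>; these are the exponents of the roots of unity that must stay
    away from 1.\<close>
  obtain P where P: "prime P" "nat (\<bar>s\<bar> * M) < P" using bigger_prime by blast
  have P0: "P > 0" using P(1) by (rule prime_gt_0_nat)
  have ndvd: "\<not> int P dvd m" if "m \<noteq> 0" "\<bar>m\<bar> \<le> \<bar>s\<bar> * M" for m
  proof
    assume "int P dvd m"
    then have "int P \<le> \<bar>m\<bar>" using dvd_imp_le_int[OF that(1), of "int P"] by simp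
    then show False using that P(2) by linarith
  qed
  have Ps: "\<not> int P dvd s"
    by (rule ndvd[OF s0]) (use M0 in \<open>simp add: mult_le_cancel_left1\<close>)
  have PMs: "\<not> int P dvd (M div c i) * s" if i: "i \<in> {1..k}" for i
  proof (rule ndvd)
    have m: "(M div c i) * c i = M" using M_dvd[OF i] by simp
    then have "M div c i \<noteq> 0" using M0 by auto
    then show "M div c i * s \<noteq> 0" using s0 by simp
    have "\<bar>M div c i\<bar> * 1 \<le> \<bar>M div c i\<bar> * \<bar>c i\<bar>" using c[OF i] by (intro mult_left_mono) auto
    also have "\<dots> = M" using m M0 by (metis abs_mult abs_of_pos)
    finally have "\<bar>M div c i\<bar> * \<bar>s\<bar> \<le> M * \<bar>s\<bar>" by (intro mult_right_mono) auto
    then show "\<bar>M div c i * s\<bar> \<le> \<bar>s\<bar> * M" by (simp add: abs_mult mult.commute)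
  qed
  define N0 where "N0 = nat \<lceil>\<sigma>\<rceil> + 1"
  have N0: "\<sigma> < N0" "N0 > 0" unfolding N0_def by linarith+
  obtain \<gamma> where \<gamma>: "\<gamma> > 0" "\<And>m. \<not> int P dvd m \<Longrightarrow> \<gamma> \<le> norm (ee P m - 1)" using ex_ee_gap[OF P0] by blast
  obtain \<gamma>0 where \<gamma>0: "\<gamma>0 > 0" "\<And>m. \<not> int N0 dvd m \<Longrightarrow> \<gamma>0 \<le> norm (ee N0 m - 1)" using ex_ee_gap[OF N0(2)] by blast
  define \<epsilon>0 where "\<epsilon>0 = \<gamma>0 / (2 * \<sigma>)"
  have \<epsilon>0: "\<epsilon>0 > 0" "\<sigma> * \<epsilon>0 < \<gamma>0" using \<gamma>0(1) \<sigma>1 by (simp_all add: \<epsilon>0_def)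
  have "\<epsilon>0 / 2 > 0" using \<epsilon>0 by simp
  then obtain n0 :: nat where n0: "n0 > 0" "2 * pi / n0 \<le> \<epsilon>0 / 2" using ex_nat_ge_two_pi_div by blast
  \<comment> \<open>The variation \<open>2 * \<delta> * sqrt D\<close> is then an eighth of
    \<open>\<gamma> * sqrt D\<close>, while the rotation changes the sum by at least half of
    it.\<close>
  define \<delta> where "\<delta> = \<gamma> / 16"
  have \<delta>0: "\<delta> > 0" using \<gamma>(1) by (simp add: \<delta>_def)
  obtain L :: nat where L: "4 / \<delta> \<le> L" using real_arch_simple by blast
  define d where "d = 3 / (128 * real (n0 * (2 * L + 1)\<^sup>2))"
  have d0: "d > 0" using n0(1) by (simp add: d_def)
  have large: "\<exists>p A. prime p \<and> A \<subseteq> resid p \<and> solution_free k c p A \<and> d * real p \<le> real (card A) \<and> C < cayley_chromatic p A" for C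
  proof -
    define t where "t = P * C"
    \<comment> \<open>Makes \<open>\<gamma> * sqrt D\<close> at least four times the loss
      \<open>1 + 2 * k * t\<close> from phase errors and bad frequencies.\<close>
    obtain D1 :: nat where D1: "(4 * (1 + 2 * real (k * t)) / \<gamma>)\<^sup>2 \<le> D1" using real_arch_simple by blast
    define D where "D = max D1 (max (P * C + 1) (k * t + 1))"
    have D: "D > P * C" "k * t < D" "D > 0" "D1 \<le> D" by (auto simp: D_def)
    have "4 * (1 + 2 * real (k * t)) / \<gamma> \<le> sqrt D"
    proof (rule real_le_rsqrt)
      show "(4 * (1 + 2 * real (k * t)) / \<gamma>)\<^sup>2 \<le> D" using D1 D(4) by linarith
    qed
    then have D_sqrt: "4 * (1 + 2 * real (k * t)) \<le> \<gamma> * sqrt D"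
      using \<gamma>(1) by (simp add: divide_le_eq mult.commute)
    \<comment> \<open>The last bound keeps the phase errors summed over all \<open>D\<close>
      frequencies at most 1; the others keep a single combination within the gaps.\<close>
    define \<epsilon> where "\<epsilon> = min (min \<epsilon>0 (\<gamma> / (2 * \<sigma>))) (1 / (D * M * \<sigma>))"
    have DM: "real D * real_of_int M * \<sigma> > 0" using D(3) M0 \<sigma>1 by simp
    have \<epsilon>: "\<epsilon> > 0" "\<epsilon> \<le> \<epsilon>0" "\<epsilon> \<le> \<gamma> / (2 * \<sigma>)" "\<epsilon> \<le> 1 / (real D * real_of_int M * \<sigma>)"
      using \<epsilon>0 \<gamma>(1) \<sigma>1 DM by (auto simp: \<epsilon>_def)
    have \<sigma>\<epsilon>: "\<sigma> * \<epsilon> < \<gamma>"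
    proof -
      have "\<sigma> * \<epsilon> \<le> \<sigma> * (\<gamma> / (2 * \<sigma>))" using \<epsilon>(3) \<sigma>1 by (intro mult_left_mono) auto
      also have "\<dots> = \<gamma> / 2" using \<sigma>1 by simp
      finally show ?thesis using \<gamma>(1) by linarith
    qed
    have \<epsilon>_gap: "\<epsilon> < norm (ee P 1 - 1)"
    proof -
      have "\<not> int P dvd 1" using P(1) prime_gt_1_nat[OF P(1)] by simp
      then have "\<gamma> \<le> norm (ee P 1 - 1)" by (rule \<gamma>(2))
      moreover have "1 * \<epsilon> \<le> \<sigma> * \<epsilon>" using \<sigma>1 \<epsilon>(1) by (intro mult_right_mono) auto
      ultimately show ?thesis using \<sigma>\<epsilon> by linarith
    qed
    define \<epsilon>' where "\<epsilon>' = \<epsilon> / (real D * real P)"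
    have DP: "real D * real P > 0" using D(3) P0 by simp
    have \<epsilon>': "\<epsilon>' > 0" "real D * real P * \<epsilon>' \<le> \<epsilon>"
      unfolding \<epsilon>'_def using \<epsilon>(1) DP D(3) P0 by simp_all
    have "\<epsilon>' / 2 > 0" using \<epsilon>' by simp
    then obtain n1 :: nat where n1: "n1 > 0" "2 * pi / n1 \<le> \<epsilon>' / 2" using ex_nat_ge_two_pi_div by blast
    \<comment> \<open>\<open>P dvd R\<close> is needed for the dual system, \<open>R \<ge> 3\<close>
      for unique sums of two powers, and \<open>n1 \<le> R\<close> for the accuracy.\<close>
    define R where "R = P * (3 * n1)"
    have R: "R \<ge> 3" "P dvd R" "R > 0" "n1 \<le> R"
      using P0 n1(1) by (auto simp: R_def Suc_le_eq)
    have R_\<epsilon>': "2 * pi / R \<le> \<epsilon>' / 2"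
    proof -
      have "2 * pi / R \<le> 2 * pi / n1" using n1(1) R(4) by (intro divide_left_mono) auto
      then show ?thesis using n1(2) by linarith
    qed
    define b0 where "b0 = max (max (real (2 * R ^ D)) (real_of_int M)) (max (4 * pi / \<epsilon>0) (4 * pi * real R ^ D / \<epsilon>'))"
    obtain p where p: "prime p" "nat \<lceil>b0\<rceil> < p" using bigger_prime by blast
    have p_pos: "p > 0" using p(1) by (rule prime_gt_0_nat)
    have b0_p: "b0 < real p" using p(2) by linarith
    have p_large: "2 * R ^ D < p" "M < int p" "4 * pi / \<epsilon>0 < p" "4 * pi * real R ^ D / \<epsilon>' < p"
    proof -
      have "real (2 * R ^ D) < real p" "real_of_int M < real p" using b0_p by (auto simp: b0_def)
      then show "2 * R ^ D < p" "M < int p" by linarith+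
      show "4 * pi / \<epsilon>0 < p" "4 * pi * real R ^ D / \<epsilon>' < p" using b0_p by (auto simp: b0_def)
    qed
    have pM: "\<not> int p dvd M" using M0 p_large(2) by (simp add: zdvd_not_zless)
    have p_\<epsilon>0: "2 * pi / p \<le> \<epsilon>0 / 2"
      using p_large(3) \<epsilon>0(1) p_pos by (simp add: field_simps)
    have p_\<epsilon>': "2 * pi * real R ^ D / p \<le> \<epsilon>' / 2"
      using p_large(4) \<epsilon>'(1) p_pos by (simp add: field_simps)
    obtain A2 where A2: "A2 \<subseteq> resid p" "real (card A2) \<ge> d * real p"
      and A2_near: "\<And>a. a \<in> A2 \<Longrightarrow> norm (ee p a - ee N0 1) \<le> 2 * pi / n0 + 2 * pi / p"
      and A2_pair: "\<And>a b. a \<in> A2 \<Longrightarrow> b \<in> A2 \<Longrightarrow> \<exists>g h. [a - b = g - h] (mod int p) \<and>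
       norm (exp_sum p M R D g - exp_sum p M R D h) \<le> 2 * \<delta> * sqrt D \<and> sqrt (D / 2) \<le> norm (exp_sum p M R D h)"
    proof (rule ex_dense_exp_sum_cell[OF p(1) R(1) pM p_large(1) D(3) n0(1) N0(2) \<delta>0 L], fold d_def)
      fix A2
      assume "A2 \<subseteq> resid p" "real (card A2) \<ge> d * real p"
        "\<And>a. a \<in> A2 \<Longrightarrow> norm (ee p a - ee N0 1) \<le> 2 * pi / n0 + 2 * pi / p"
        "\<And>a b. a \<in> A2 \<Longrightarrow> b \<in> A2 \<Longrightarrow> \<exists>g h. [a - b = g - h] (mod int p) \<and>
       norm (exp_sum p M R D g - exp_sum p M R D h) \<le> 2 * \<delta> * sqrt D \<and> sqrt (D / 2) \<le> norm (exp_sum p M R D h)"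
      then show thesis by (rule that)
    qed
    define A where "A = almost_root p P R D t \<epsilon> \<union> A2"
    have "A \<subseteq> resid p" using A2(1) by (auto simp: A_def almost_root_def)
    moreover have "solution_free k c p A"
      unfolding A_def
    proof (rule solution_free_union[OF p_pos k c nz \<gamma>(2) \<gamma>0(2)])
      show "\<not> int P dvd (\<Sum>i=1..k. c i)" using Ps by (simp add: s_def)
      show "\<not> int P dvd M div c i * (\<Sum>i=1..k. c i)" if "i \<in> {1..k}" for i
        using PMs[OF that] by (simp add: s_def)
      show "(\<Sum>i=1..k. \<bar>real_of_int (c i)\<bar>) < real N0" using N0 by (simp add: \<sigma>_def)
      show "norm (ee p a - ee N0 1) \<le> \<epsilon>0" if "a \<in> A2" for a
        using A2_near[OF that] n0(2) p_\<epsilon>0 by linarith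
      show "(\<Sum>i=1..k. \<bar>real_of_int (c i)\<bar>) * \<epsilon>0 < \<gamma>0" using \<epsilon>0 by (simp add: \<sigma>_def)
      show "(\<Sum>i=1..k. \<bar>real_of_int (c i)\<bar>) * \<epsilon> < \<gamma>" using \<sigma>\<epsilon> by (simp add: \<sigma>_def)
      show "real D * (real_of_int M * ((\<Sum>i=1..k. \<bar>real_of_int (c i)\<bar>) * \<epsilon>)) + 2 * real (k * t) + 2 * \<delta> * sqrt D
          < sqrt (D / 2) * \<gamma>"
        unfolding \<sigma>_def[symmetric]
      proof -
        have "real D * (real_of_int M * (\<sigma> * \<epsilon>)) = real D * real_of_int M * \<sigma> * \<epsilon>" by simp
        also have "\<dots> \<le> real D * real_of_int M * \<sigma> * (1 / (real D * real_of_int M * \<sigma>))"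
          using \<epsilon>(4) DM by (intro mult_left_mono) auto
        also have "\<dots> = 1" using D(3) M0 \<sigma>1 by simp
        finally have 1: "real D * (real_of_int M * (\<sigma> * \<epsilon>)) \<le> 1" .
        have "sqrt D / 2 = sqrt (D / 4)" by (simp add: real_sqrt_divide)
        also have "\<dots> \<le> sqrt (D / 2)" by (rule real_sqrt_le_mono) simp
        finally have 2: "sqrt D / 2 * \<gamma> \<le> sqrt (D / 2) * \<gamma>" using \<gamma>(1) by (intro mult_right_mono) auto
        have 3: "2 * \<delta> * sqrt D = \<gamma> * sqrt D / 8" by (simp add: \<delta>_def)
        have 4: "sqrt D / 2 * \<gamma> = \<gamma> * sqrt D / 2" by simp
        have 5: "real (k * t) \<ge> 0" by simp
        have "a + 2 * y + z / 8 < w" if "a \<le> 1" "z / 2 \<le> w" "4 * (1 + 2 * y) \<le> z" "y \<ge> 0" for a y z w :: real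
          using that by argo
        from this[OF 1 2[unfolded 4] D_sqrt 5]
        show "real D * (real_of_int M * (\<sigma> * \<epsilon>)) + 2 * real (k * t) + 2 * \<delta> * sqrt D < sqrt (D / 2) * \<gamma>"
          unfolding 3 .
      qed
    qed (use M0 M_dvd A2_pair \<epsilon> D \<gamma>(1) in auto)
    moreover have "d * real p \<le> real (card A)"
    proof -
      have "finite A" using \<open>A \<subseteq> resid p\<close> finite_subset by blast
      then have "card A2 \<le> card A" by (intro card_mono) (auto simp: A_def)
      then show ?thesis using A2(2) by linarith
    qed
    moreover have "C < cayley_chromatic p A"
    proof (rule cayley_chromatic_almost_root[OF p_pos P(1) D(1) _ \<epsilon>'(2) \<epsilon>_gap, where R = R])
      show "norm (ee p (int R ^ j * (int p div (int P * int R ^ i))) - (if i = j then ee P 1 else 1)) \<le> \<epsilon>'"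
        if "1 \<le> i" "i \<le> D" "j \<le> D" for i j
        using norm_ee_dual_system[OF P0 R(3,2) p_pos that] R_\<epsilon>' p_\<epsilon>' by linarith
      show "almost_root p P R D (P * C) \<epsilon> \<subseteq> A" by (simp add: A_def t_def)
    qed
    ultimately show ?thesis using p(1) by blast
  qed
  show ?thesis by (rule exI[of _ d]) (intro conjI allI d0 large)
qed

section \<open>The chromatic threshold\<close>

theorem theorem1p3:
  fixes k :: nat and c :: "nat \<Rightarrow> int"
  assumes "k \<ge> 3" and "\<forall>i\<in>{1..k}. c i \<noteq> 0"
  shows "chromatic_threshold k c = 0 \<longleftrightarrow>
         (\<exists>I \<subseteq> {1..k}. card I \<ge> 3 \<and> (\<Sum>i\<in>I. c i) = 0)"
proof -
  define B where "B d C \<longleftrightarrow> (\<forall>p A. prime p \<longrightarrow> A \<subseteq> resid p \<longrightarrow> solution_free k c p A \<longrightarrow>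
    real (card A) \<ge> d * real p \<longrightarrow> cayley_chromatic p A \<le> C)" for d C
  have threshold: "chromatic_threshold k c = Inf {d. d > 0 \<and> (\<exists>C. B d C)}"
    unfolding chromatic_threshold_def B_def ..
  show ?thesis
  proof
    assume "\<exists>I \<subseteq> {1..k}. card I \<ge> 3 \<and> (\<Sum>i\<in>I. c i) = 0"
    then obtain I where I: "I \<subseteq> {1..k}" "card I \<ge> 3" "(\<Sum>i\<in>I. c i) = 0" by (elim exE conjE)
    have "\<exists>C. B d C" if "d > 0" for d
      unfolding B_def by (rule bounded_chromatic_if_zero_sum[OF assms I that])
    then have "{d. d > 0 \<and> (\<exists>C. B d C)} = {0<..}" by (simp add: set_eq_iff) blast
    then show "chromatic_threshold k c = 0" unfolding threshold by simp
  next
    assume zero: "chromatic_threshold k c = 0"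
    show "\<exists>I \<subseteq> {1..k}. card I \<ge> 3 \<and> (\<Sum>i\<in>I. c i) = 0"
    proof (rule ccontr)
      assume none: "\<not> ?thesis"
      obtain d where d: "d > 0" and large: "\<forall>C. \<exists>p A. prime p \<and> A \<subseteq> resid p \<and>
        solution_free k c p A \<and> d * real p \<le> real (card A) \<and> C < cayley_chromatic p A"
        using ex_dense_solution_free_large_chromatic[OF assms none] by (elim exE conjE)
      \<comment> \<open>The bound is vacuous at density 2; it shows that the infimum is over a
        nonempty set.\<close>
      have "B 2 0"
        unfolding B_def
      proof (intro allI impI)
        fix p :: nat and A
        assume "prime p" "A \<subseteq> resid p" "real (card A) \<ge> 2 * real p"
        then have "card A \<le> p" using card_mono[of "resid p" A] by simp
        then show "cayley_chromatic p A \<le> 0"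
          using \<open>real (card A) \<ge> 2 * real p\<close> prime_gt_0_nat[OF \<open>prime p\<close>] by linarith
      qed
      then have "{d. d > 0 \<and> (\<exists>C. B d C)} \<noteq> {}" by (auto intro: exI[of _ "2::real"])
      moreover have "d \<le> d'" if d': "d' \<in> {d. d > 0 \<and> (\<exists>C. B d C)}" for d'
      proof (rule ccontr)
        assume "\<not> d \<le> d'"
        obtain C where C: "B d' C" using d' by blast
        obtain p A where A: "prime p" "A \<subseteq> resid p" "solution_free k c p A" "d * real p \<le> real (card A)"
          "C < cayley_chromatic p A" using spec[OF large, of C] by (elim exE conjE)
        have "d' * real p \<le> d * real p" using \<open>\<not> d \<le> d'\<close> by (intro mult_right_mono) auto
        then have "real (card A) \<ge> d' * real p" using A(4) by linarith
        with C[unfolded B_def, rule_format, OF A(1-3)] A(5) show False by linarith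
      qed
      ultimately have "d \<le> chromatic_threshold k c" unfolding threshold by (rule cInf_greatest)
      then show False using zero d by simp
    qed
  qed
qed

end
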